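(* Let $M$ and $N$ be coprime positive integers, $\zeta_N^M := e^{2\pi i M/N}$, and let $\tau$ tend to $M/N$ within the upper half-plane $\mathbb{H}$, with $q=e^{2\pi i\tau}$. Then: \begin{itemize} \item For $p\ge 2$: $H_p^{(1)}(\zeta_N^M) = -\frac12 \lim_{\tau\to M/N} q^{-\frac{(6p+5)^2}{24(6p-1)}}\widetilde{\Phi}_{(2,3,6p-1)}^{(1,1,1)}(\tau)$. \item For $p=1$: $H_1^{(1)}(\zeta_N^M) = -\zeta_N^{-M} -\frac12 \lim_{\tau\to M/N} q^{-\frac{121}{120}}\widetilde{\Phi}_{(2,3,5)}^{(1,1,1)}(\tau)$. \end{itemize} For all $p\ge 1$: \begin{align*} H_p^{(2)}(\zeta_N^M) &= -\tfrac12 \lim_{\tau\to M/N} q^{-\frac{1}{24(6p-1)}}\widetilde{\Phi}_{(2,3,6p-1)}^{(1,1,p)}(\tau),\\ H_p^{(3)}(\zeta_N^M) &= -\tfrac12 \lim_{\tau\to M/N} q^{-1-\frac{(6p-5)^2}{24(6p-1)}}\widetilde{\Phi}_{(2,3,6p-1)}^{(1,1,2p-1)}(\tau),\\ H_p^{(4)}(\zeta_N^M) &= -\tfrac12 \lim_{\tau\to M/N} q^{-\frac{(6p+1)^2}{24(6p-1)}}\widetilde{\Phi}_{(2,3,6p-1)}^{(1,1,2p)}(\tau),\\ H_p^{(5)}(\zeta_N^M) &= -\tfrac12 \lim_{\tau\to M/N} q^{p-1-\frac{(12p-5)^2}{24(6p-1)}}\widetilde{\Phi}_{(2,3,6p-1)}^{(1,1,3p-1)}(\tau),\\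 H_p^{(6)}(\zeta_N^M) &= -\tfrac12 \lim_{\tau\to M/N} q^{-\frac{(6p-1)^2}{24(6p+1)}}\widetilde{\Phi}_{(2,3,6p+1)}^{(1,1,2p)}(\tau),\\ H_p^{(7)}(\zeta_N^M) &= -\tfrac12 \lim_{\tau\to M/N} q^{1-\frac{(6p+5)^2}{24(6p+1)}}\widetilde{\Phi}_{(2,3,6p+1)}^{(1,1,2p+1)}(\tau),\\ H_p^{(8)}(\zeta_N^M) &= -\tfrac12 \lim_{\tau\to M/N} q^{1-\frac{(6p-5)^2}{24(6p+1)}}\widetilde{\Phi}_{(2,3,6p+1)}^{(1,1,1)}(\tau),\\ H_p^{(9)}(\zeta_N^M) &= -\tfrac12 \lim_{\tau\to M/N} q^{p-1-\frac{(12p-1)^2}{24(6p+1)}}\widetilde{\Phi}_{(2,3,6p+1)}^{(1,1,3p)}(\tau),\\ H_p^{(10)}(\zeta_N^M) &= -\tfrac12 \lim_{\tau\to M/N} q^{-\frac{1}{24(6p+1)}}\widetilde{\Phi}_{(2,3,6p+1)}^{(1,1,p)}(\tau). \end{align*}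
   Context: Notation: $(a)_n=(a;q)_n=\prod_{k=1}^n(1-aq^{k-1})$, and $\begin{bmatrix} n\\ k\end{bmatrix} = \frac{(q)_n}{(q)_{n-k}(q)_k}$ is the $q$-binomial coefficient. For $p\ge1$ define the following $q$-series, where every sum runs over integers $n_p\ge n_{p-1}\ge\cdots\ge n_1\ge 0$ (when $p=1$ the product is empty): $H_p^{(1)}(q)=\sum q^{n_p}(q^{n_p+1})_{n_p+1}\prod_{i=1}^{p-1}q^{n_i(n_i+1)}\begin{bmatrix} n_{i+1}\\ n_i\end{bmatrix}$; $H_p^{(2)}(q)=\sum q^{n_p}(q^{n_p})_{n_p}\prod_{i=1}^{p-1}q^{n_i^2}\begin{bmatrix} n_{i+1}\\ n_i\end{bmatrix}$; $H_p^{(3)}(q)=\sum q^{2n_p}(q^{n_p+1})_{n_p}\prod_{i=1}^{p-1}q^{n_i(n_i+1)}\begin{bmatrix} n_{i+1}\\ n_i\end{bmatrix}$; $H_p^{(4)}(q)=\sum q^{n_p}(q^{n_p+1})_{n_p}\prod_{i=1}^{p-1}q^{n_i(n_i+1)}\begin{bmatrix} n_{i+1}\\ n_i\end{bmatrix}$; $H_p^{(5)}(q)=\sum q^{n_p}(q^{n_p+1})_{n_p}\prod_{i=1}^{p-1}q^{n_i^2}\begin{bmatrix} n_{i+1}\\ n_i\end{bmatrix}$; $H_p^{(6)}(q)=\sum q^{-n_p^2}(q^{n_p+1})_{n_p}\prod_{i=1}^{p-1}q^{n_i^2+n_i}\begin{bmatrix} n_{i+1}\\ n_i\end{bmatrix}$;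 $H_p^{(7)}(q)=\sum q^{-n_p^2-n_p}(q^{n_p+1})_{n_p}\prod_{i=1}^{p-1}q^{n_i^2+n_i}\begin{bmatrix} n_{i+1}\\ n_i\end{bmatrix}$; $H_p^{(8)}(q)=\sum q^{-n_p(n_p+2)}(q^{n_p+1})_{n_p+1}\prod_{i=1}^{p-1}q^{n_i(n_i+1)}\begin{bmatrix} n_{i+1}\\ n_i\end{bmatrix}$; $H_p^{(9)}(q)=\sum q^{-n_p^2-n_p}(q^{n_p+1})_{n_p}\prod_{i=1}^{p-1}q^{n_i^2}\begin{bmatrix} n_{i+1}\\ n_i\end{bmatrix}$; $H_p^{(10)}(q)=\sum q^{-n_p^2}(q^{n_p})_{n_p}\prod_{i=1}^{p-1}q^{n_i^2}\begin{bmatrix} n_{i+1}\\ n_i\end{bmatrix}$. At a root of unity $q$, only finitely many terms of each series are nonzero, so these are evaluated termwise. For a triple $\bm p=(p_1,p_2,p_3)$ of pairwise coprime positive integers with $P=p_1p_2p_3$ and $\bm\ell=(\ell_1,\ell_2,\ell_3)\in\mathbb{Z}^3$ with $0<\ell_j<p_j$, define $\chi_{\bm p}^{\bm\ell}:\mathbb{Z}\to\{0,\pm1\}$ by $\chi_{\bm p}^{\bm\ell}(n)=-\epsilon_1\epsilon_2\epsilon_3$ if $n\equiv P\bigl(1+\sum_{j=1}^3\epsilon_j\ell_j/p_j\bigr)\pmod{2P}$ for some $(\epsilon_1,\epsilon_2,\epsilon_3)\in\{\pm1\}^3$, and $\chi_{\bm p}^{\bm\ell}(n)=0$ otherwise.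 For $\tau\in\mathbb{H}$, $q=e^{2\pi i\tau}$ and $q^x:=e^{2\pi i x\tau}$ for real $x$; the Eichler integral is $\widetilde{\Phi}_{\bm p}^{\bm\ell}(\tau)=\sum_{n\ge0}\chi_{\bm p}^{\bm\ell}(n)q^{n^2/(4P)}$.
   Formalization: Proved with three corrections: the exponent for H^(9) begins with p, not p-1; the formula for H^(10) has an added 1 (H^(10) = 1 - ½ lim); and τ→M/N is nontangential (within any fixed sector of the upper half-plane), since the unrestricted limit does not exist. *)

theory Defs
  imports
    "HOL-Analysis.Analysis"
    "HOL-Computational_Algebra.Polynomial"
    "HOL-Number_Theory.Cong"
begin

definition qpoch :: "'a::comm_ring_1 \<Rightarrow> 'a \<Rightarrow> nat \<Rightarrow> 'a" where
  "qpoch a q n = (\<Prod>k=1..n. 1 - a * q ^ (k - 1))"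

text \<open>At a root of unity the quotient defining the \<open>q\<close>-binomial coefficient may read \<open>0/0\<close>, so it
  is formed in the polynomial ring, where the division is exact (see \<open>qbinom_poly_exact\<close>), and
  only then evaluated.\<close>

definition qbinom_poly :: "nat \<Rightarrow> nat \<Rightarrow> complex poly" where
  "qbinom_poly n k =
     (let X = [:0, 1:] in qpoch X X n div (qpoch X X (n - k) * qpoch X X k))"

definition qbinom :: "nat \<Rightarrow> nat \<Rightarrow> complex \<Rightarrow> complex" where
  "qbinom n k q = poly (qbinom_poly n k) q"

text \<open>A chain \<open>n\<^sub>p \<ge> \<dots> \<ge> n\<^sub>1 \<ge> 0\<close> is a sorted list \<open>ns\<close> of length \<open>p\<close>, with
  \<open>n\<^sub>i\<close> at position \<open>i - 1\<close>.\<close>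

definition chain_term ::
    "(nat \<Rightarrow> complex) \<Rightarrow> (nat \<Rightarrow> complex) \<Rightarrow> nat \<Rightarrow> complex \<Rightarrow> nat list \<Rightarrow> complex" where
  "chain_term h a p q ns =
     h (ns ! (p - 1)) * (\<Prod>i=1..<p. a (ns ! (i - 1)) * qbinom (ns ! i) (ns ! (i - 1)) q)"

text \<open>At a root of unity the sum below has only finitely many nonzero terms for each of the series
  \<open>H1\<close>, ..., \<open>H10\<close> (see \<open>finite_support_chain_term\<close>).\<close>

definition chain_sum ::
    "(nat \<Rightarrow> complex) \<Rightarrow> (nat \<Rightarrow> complex) \<Rightarrow> nat \<Rightarrow> complex \<Rightarrow> complex" where
  "chain_sum h a p q = (\<Sum>\<^sub>\<infinity>ns\<in>{ns. length ns = p \<and> sorted ns}. chain_term h a p q ns)"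

definition H1 :: "nat \<Rightarrow> complex \<Rightarrow> complex" where
  "H1 p q = chain_sum (\<lambda>n. q ^ n * qpoch (q ^ (n + 1)) q (n + 1)) (\<lambda>n. q ^ (n * (n + 1))) p q"

definition H2 :: "nat \<Rightarrow> complex \<Rightarrow> complex" where
  "H2 p q = chain_sum (\<lambda>n. q ^ n * qpoch (q ^ n) q n) (\<lambda>n. q ^ (n\<^sup>2)) p q"

definition H3 :: "nat \<Rightarrow> complex \<Rightarrow> complex" where
  "H3 p q = chain_sum (\<lambda>n. q ^ (2 * n) * qpoch (q ^ (n + 1)) q n) (\<lambda>n. q ^ (n * (n + 1))) p q"

definition H4 :: "nat \<Rightarrow> complex \<Rightarrow> complex" where
  "H4 p q = chain_sum (\<lambda>n. q ^ n * qpoch (q ^ (n + 1)) q n) (\<lambda>n. q ^ (n * (n + 1))) p q"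

definition H5 :: "nat \<Rightarrow> complex \<Rightarrow> complex" where
  "H5 p q = chain_sum (\<lambda>n. q ^ n * qpoch (q ^ (n + 1)) q n) (\<lambda>n. q ^ (n\<^sup>2)) p q"

definition H6 :: "nat \<Rightarrow> complex \<Rightarrow> complex" where
  "H6 p q = chain_sum (\<lambda>n. q powi (- int (n\<^sup>2)) * qpoch (q ^ (n + 1)) q n)
              (\<lambda>n. q ^ (n\<^sup>2 + n)) p q"

definition H7 :: "nat \<Rightarrow> complex \<Rightarrow> complex" where
  "H7 p q = chain_sum (\<lambda>n. q powi (- int (n\<^sup>2) - int n) * qpoch (q ^ (n + 1)) q n)
              (\<lambda>n. q ^ (n\<^sup>2 + n)) p q"

definition H8 :: "nat \<Rightarrow> complex \<Rightarrow> complex" where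
  "H8 p q = chain_sum (\<lambda>n. q powi (- int (n * (n + 2))) * qpoch (q ^ (n + 1)) q (n + 1))
              (\<lambda>n. q ^ (n * (n + 1))) p q"

definition H9 :: "nat \<Rightarrow> complex \<Rightarrow> complex" where
  "H9 p q = chain_sum (\<lambda>n. q powi (- int (n\<^sup>2) - int n) * qpoch (q ^ (n + 1)) q n)
              (\<lambda>n. q ^ (n\<^sup>2)) p q"

definition H10 :: "nat \<Rightarrow> complex \<Rightarrow> complex" where
  "H10 p q = chain_sum (\<lambda>n. q powi (- int (n\<^sup>2)) * qpoch (q ^ n) q n) (\<lambda>n. q ^ (n\<^sup>2)) p q"

text \<open>The congruence is \<open>n \<equiv> P (1 + \<Sum>\<^sub>j \<epsilon>\<^sub>j l\<^sub>j / p\<^sub>j) (mod 2P)\<close> with the denominators cancelled.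
  For pairwise coprime \<open>p\<^sub>j\<close> and \<open>0 < l\<^sub>j < p\<^sub>j\<close> the signs are determined by \<open>n\<close>
  (see \<open>chi_rel_unique\<close>), so the description in \<open>chi\<close> is proper.\<close>

fun chi_rel :: "int \<times> int \<times> int \<Rightarrow> int \<times> int \<times> int \<Rightarrow> int \<Rightarrow> int \<Rightarrow> bool" where
  "chi_rel (p1, p2, p3) (l1, l2, l3) n c \<longleftrightarrow>
     (\<exists>e1\<in>{1, -1}. \<exists>e2\<in>{1, -1}. \<exists>e3\<in>{1, -1}.
        [n = p1 * p2 * p3 + e1 * l1 * p2 * p3 + e2 * l2 * p1 * p3 + e3 * l3 * p1 * p2]
          (mod (2 * (p1 * p2 * p3))) \<and>
        c = - (e1 * e2 * e3))"

definition chi :: "int \<times> int \<times> int \<Rightarrow> int \<times> int \<times> int \<Rightarrow> int \<Rightarrow> int" where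
  "chi p l n = (if \<exists>c. chi_rel p l n c then THE c. chi_rel p l n c else 0)"

definition qpow :: "complex \<Rightarrow> real \<Rightarrow> complex" where
  "qpow \<tau> x = exp (2 * of_real pi * \<i> * of_real x * \<tau>)"

fun eichler :: "int \<times> int \<times> int \<Rightarrow> int \<times> int \<times> int \<Rightarrow> complex \<Rightarrow> complex" where
  "eichler (p1, p2, p3) l \<tau> =
     (\<Sum>n::nat. of_int (chi (p1, p2, p3) l (int n)) *
        qpow \<tau> ((real n)\<^sup>2 / (4 * of_int (p1 * p2 * p3))))"

text \<open>Limits at a cusp \<open>x\<close> are nontangential: \<open>\<tau>\<close> approaches \<open>x\<close> in an arbitrary but fixed sector
  of the upper half-plane. Under completely unrestricted approach these limits do not exist: like a
  form of weight \<open>1/2\<close>, \<open>eichler p l \<tau>\<close> grows like \<open>\<bar>\<tau> - x\<bar> powr (-1/2)\<close> along horocycles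
  tangent at \<open>x\<close>.\<close>

definition has_cusp_limit :: "(complex \<Rightarrow> complex) \<Rightarrow> real \<Rightarrow> complex \<Rightarrow> bool" where
  "has_cusp_limit f x L \<longleftrightarrow>
     (\<forall>c>0. (f \<longlongrightarrow> L) (at (of_real x) within {\<tau>. Im \<tau> > 0 \<and> \<bar>Re \<tau> - x\<bar> \<le> c * Im \<tau>}))"


lemma qpoch_Suc: "qpoch a q (Suc n) = qpoch a q n * (1 - a * q ^ n)"
  by (simp add: qpoch_def)

lemma qpoch_XX_nonzero: "qpoch [:0, 1:] [:0, 1:] n \<noteq> (0 :: complex poly)"
proof -
  have "poly (qpoch [:0, 1:] [:0, 1:] n) (0::complex) = 1"
    by (simp add: qpoch_def poly_prod)
  then show ?thesis by auto
qed

lemma qbinom_dvd: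
  "k \<le> n \<Longrightarrow> qpoch x x (n - k) * qpoch x x k dvd qpoch x x n" for x :: "'a::comm_ring_1"
proof (induction n arbitrary: k)
  case 0
  then show ?case by (simp add: qpoch_def)
next
  case (Suc n)
  show ?case
  proof (cases "k = 0 \<or> k = Suc n")
    case True
    then show ?thesis by (auto simp: qpoch_def)
  next
    case False
    then obtain j where j: "k = Suc j" "j < n" using Suc.prems by (cases k) auto
    define m where "m = n - Suc j"
    have n: "n = m + Suc j" using j m_def by simp
    have nk: "Suc n - k = Suc m" "n - j = Suc m" "n - Suc j = m" using j n by auto
    have d1: "qpoch x x (Suc m) * qpoch x x j dvd qpoch x x n"
      using Suc.IH[of j] j nk by simp
    have d2: "qpoch x x m * qpoch x x (Suc j) dvd qpoch x x n"
      using Suc.IH[of "Suc j"] j nk by simp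
    have e1: "qpoch x x (Suc m) * qpoch x x (Suc j) dvd qpoch x x n * (1 - x * x ^ j)"
      using mult_dvd_mono[OF d1 dvd_refl[of "1 - x * x ^ j"]] by (simp add: qpoch_Suc ac_simps)
    have e2: "qpoch x x (Suc m) * qpoch x x (Suc j) dvd qpoch x x n * (1 - x * x ^ m)"
      using mult_dvd_mono[OF d2 dvd_refl[of "1 - x * x ^ m"]] by (simp add: qpoch_Suc ac_simps)
    have "qpoch x x (Suc n) =
        qpoch x x n * (1 - x * x ^ j) + qpoch x x n * (1 - x * x ^ m) * x ^ (Suc j)"
      by (simp add: qpoch_Suc n power_add algebra_simps)
    also have "qpoch x x (Suc m) * qpoch x x (Suc j) dvd \<dots>"
      using e1 e2 by (intro dvd_add) auto
    finally show ?thesis using j nk by simp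
  qed
qed

lemma qbinom_poly_exact:
  assumes "k \<le> n"
  shows "qbinom_poly n k * (qpoch [:0, 1:] [:0, 1:] (n - k) * qpoch [:0, 1:] [:0, 1:] k) =
    qpoch [:0, 1:] [:0, 1:] n"
  using qbinom_dvd[OF assms, of "[:0, 1:] :: complex poly"]
  by (simp add: qbinom_poly_def Let_def)

lemma qpoch_root_of_unity_eq_0:
  fixes q :: "'a::idom"
  assumes "q ^ N = 1" "N > 0" "m \<ge> N"
  shows "qpoch (q ^ j) q m = 0"
proof -
  define r where "r = (N - j mod N) mod N"
  have "r < N" using assms r_def by simp
  have "(j + r) mod N = (j mod N + (N - j mod N)) mod N"
    unfolding r_def by (simp add: mod_simps)
  also have "\<dots> = 0" using mod_less_divisor[OF assms(2), of j] by simp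
  finally have "N dvd j + r" by auto
  then obtain s where "j + r = N * s" by auto
  then have "q ^ j * q ^ r = 1" using assms by (simp add: power_add[symmetric] power_mult)
  then show ?thesis
    unfolding qpoch_def using \<open>r < N\<close> assms
    by (intro prod_zero) (auto intro!: bexI[of _ "Suc r"])
qed

lemma finite_support_chain_term:
  assumes "p \<ge> 1" and h: "\<And>n. n \<ge> N \<Longrightarrow> h n = 0"
  shows "finite {ns. length ns = p \<and> sorted ns \<and> chain_term h a p q ns \<noteq> 0}"
proof (rule finite_subset)
  show "{ns. length ns = p \<and> sorted ns \<and> chain_term h a p q ns \<noteq> 0}
      \<subseteq> {ns. set ns \<subseteq> {..<N} \<and> length ns = p}"
  proof safe
    fix ns x
    assume ns: "p = length ns" "sorted ns" "chain_term h a (length ns) q ns \<noteq> 0" "x \<in> set ns"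
    have "h (ns ! (length ns - 1)) \<noteq> 0" using ns by (auto simp: chain_term_def)
    then have l: "ns ! (length ns - 1) < N" using h by (meson not_less)
    obtain i where "i < length ns" "x = ns ! i" using ns by (auto simp: in_set_conv_nth)
    then have "x \<le> ns ! (length ns - 1)" using ns by (auto intro!: sorted_nth_mono)
    then show "x < N" using l by simp
  qed
  show "finite {ns. set ns \<subseteq> {..<N} \<and> length ns = p}" by (intro finite_lists_length_eq) auto
qed

lemma chi_rel_unique:
  assumes co: "coprime p1 p2" "coprime p1 p3" "coprime p2 p3"
    and l: "0 < l1" "l1 < p1" "0 < l2" "l2 < p2" "0 < l3" "l3 < p3"
    and c: "chi_rel (p1, p2, p3) (l1, l2, l3) n c" and d: "chi_rel (p1, p2, p3) (l1, l2, l3) n d"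
  shows "c = d"
proof -
  have key: "e = f" if ef: "e \<in> {1, -1}" "f \<in> {1, -1::int}" and dv: "2 * (a * b) dvd (e - f) * (m * b) + 2 * a * g"
    and cop: "coprime a b" and m: "0 < m" "m < a" for a b e f m g :: int
  proof (rule ccontr)
    assume "e \<noteq> f"
    then have "e - f = 2 \<or> e - f = -2" using ef by auto
    moreover have "2 * a dvd (e - f) * (m * b) + 2 * a * g"
      using dv by (meson dvd_trans dvd_triv_left mult_dvd_mono dvd_refl)
    moreover have "2 * a dvd 2 * a * g" by simp
    ultimately have "2 * a dvd (e - f) * (m * b)" "e - f = 2 \<or> e - f = -2"
      by (simp_all add: dvd_add_left_iff)
    then have "2 * a dvd 2 * (m * b)"
      by (metis dvd_minus_iff mult_minus_left)
    then have "a dvd m * b" by simp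
    then have "a dvd m" using cop by (simp add: coprime_dvd_mult_left_iff)
    then show False using m zdvd_not_zless by blast
  qed
  obtain e1 e2 e3 where e: "e1 \<in> {1, -1}" "e2 \<in> {1, -1}" "e3 \<in> {1, -1}" "c = - (e1 * e2 * e3)"
    "[n = p1 * p2 * p3 + e1 * l1 * p2 * p3 + e2 * l2 * p1 * p3 + e3 * l3 * p1 * p2]
          (mod (2 * (p1 * p2 * p3)))" using c unfolding chi_rel.simps by blast
  obtain f1 f2 f3 where f: "f1 \<in> {1, -1}" "f2 \<in> {1, -1}" "f3 \<in> {1, -1}" "d = - (f1 * f2 * f3)"
    "[n = p1 * p2 * p3 + f1 * l1 * p2 * p3 + f2 * l2 * p1 * p3 + f3 * l3 * p1 * p2]
          (mod (2 * (p1 * p2 * p3)))" using d unfolding chi_rel.simps by blast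
  have "[p1 * p2 * p3 + e1 * l1 * p2 * p3 + e2 * l2 * p1 * p3 + e3 * l3 * p1 * p2
       = p1 * p2 * p3 + f1 * l1 * p2 * p3 + f2 * l2 * p1 * p3 + f3 * l3 * p1 * p2]
          (mod (2 * (p1 * p2 * p3)))" using cong_trans[OF cong_sym[OF e(5)] f(5)] .
  then have D: "2 * (p1 * p2 * p3) dvd (e1 - f1) * l1 * p2 * p3 + (e2 - f2) * l2 * p1 * p3
      + (e3 - f3) * l3 * p1 * p2"
    by (simp add: cong_iff_dvd_diff algebra_simps)
  obtain g1 where g1: "e1 - f1 = 2 * g1" using e(1) f(1) by (auto intro: that[of 0] that[of 1] that[of "-1"])
  obtain g2 where g2: "e2 - f2 = 2 * g2" using e(2) f(2) by (auto intro: that[of 0] that[of 1] that[of "-1"])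
  obtain g3 where g3: "e3 - f3 = 2 * g3" using e(3) f(3) by (auto intro: that[of 0] that[of 1] that[of "-1"])
  have "e1 = f1"
  proof (rule key[of e1 f1 p1 "p2 * p3" l1 "g2 * l2 * p3 + g3 * l3 * p2"])
    show "2 * (p1 * (p2 * p3)) dvd (e1 - f1) * (l1 * (p2 * p3)) + 2 * p1 * (g2 * l2 * p3 + g3 * l3 * p2)"
      using D unfolding g1 g2 g3 by (simp add: algebra_simps)
  qed (use e f co l in auto)
  moreover have "e2 = f2"
  proof (rule key[of e2 f2 p2 "p1 * p3" l2 "g1 * l1 * p3 + g3 * l3 * p1"])
    show "2 * (p2 * (p1 * p3)) dvd (e2 - f2) * (l2 * (p1 * p3)) + 2 * p2 * (g1 * l1 * p3 + g3 * l3 * p1)"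
      using D unfolding g1 g2 g3 by (simp add: algebra_simps)
  qed (use e f co l in \<open>auto simp: coprime_commute\<close>)
  moreover have "e3 = f3"
  proof (rule key[of e3 f3 p3 "p1 * p2" l3 "g1 * l1 * p2 + g2 * l2 * p1"])
    show "2 * (p3 * (p1 * p2)) dvd (e3 - f3) * (l3 * (p1 * p2)) + 2 * p3 * (g1 * l1 * p2 + g2 * l2 * p1)"
      using D unfolding g1 g2 g3 by (simp add: algebra_simps)
  qed (use e f co l in \<open>auto simp: coprime_commute\<close>)
  ultimately show ?thesis using e(4) f(4) by simp
qed

end

(* The inner chain sum over n_1, ..., n_(p-1) is (q)_n beta_n, n = n_p, for an iterated Bailey pair
   relative to 1 or q.  By the finite Jacobi triple product its product with the prefactor of H_p^(i)
   is, up to a power of q, L((x)_n (q/x)_m) with m one of n - 1, n, n + 1, for a linear functional L on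
   Laurent polynomials sending x^k to q^(quadratic in k).  At a root of unity L factors through x^N = 1, so only the values at x = q^j of
   S(x) = sum_(n < N) q^n (x)_n (q/x)_n matter.  A telescoping argument gives
   S(q x) = x + x^2 - x^3 S(x) for these x, and the Abel sum of a_m x^m over m >= 0, with a_m a character
   mod 6 times a Gaussian, is the only solution.  Hence H_p^(i) is the Abel sum of the products
   a_m L(x^m), up to boundary terms.  The series 6, ..., 10 reduce to the same statement after q -> 1/q.

   On the other side, the terms of the Eichler integral at M/N form an odd sequence that changes sign
   under a shift by 6hN, h = 6p - 1 or 6p + 1.  For such a sequence sum f(n) exp(- s n^2) tends to half
   of the sum of f over one such shift, as s -> 0 in a sector, which is also the Abel sum.  Completing
   the square in the exponents identifies the two Abel sums, up to a factor -2. *)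

theory Submission
  imports Defs
begin

section \<open>Gaussian sums of antiperiodic sequences\<close>

text \<open>The number h is forced by the exponents: the Gaussian q^(-(m+1)(m+2)/6) meets a weight
  with leading term p m^2, and p - 1/6 = (6p - 1)/6; inverting q gives p + 1/6, whence 6p + 1. The
  modulus 6 comes from the factor x^3 in the functional equation of S.

  Two obstacles shape the proof. Bailey pairs need 1 / (q)_n, which fails to exist for large n at a
  root of unity, so they serve only for generic q, to prove identities whose two sides are
  division-free. And the functional equation of S has a remainder containing (x)_N, which vanishes
  at the points x = q^j. Uniqueness on these points is a monodromy argument: one turn round them
  multiplies a homogeneous solution by (-1)^N q^(3N(N-1)/2) = -1, so it is 0.

  The rest of the care goes into where half-lines begin: the index at which the Eichler terms start
  depends on 6l against h, and each move of the start costs one term. This yields the exceptional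
  term of H_1 for p = 1 and the constant 1 in H_10.\<close>

lemma norm_one_minus_exp_le:
  fixes z :: complex
  assumes "Re z \<le> 0"
  shows "norm (1 - exp z) \<le> norm z"
proof -
  have "norm (exp 0 - exp z) \<le> 1 * norm (0 - z)"
  proof (rule field_differentiable_bound[where S = "{w. Re w \<le> 0}" and f' = exp])
    show "convex {w. Re w \<le> 0}" by (rule convex_halfspace_Re_le)
  qed (use assms in \<open>auto intro!: derivative_eq_intros\<close>)
  then show ?thesis by simp
qed

lemma antiperiodic_bounded:
  fixes f :: "nat \<Rightarrow> 'a::real_normed_vector"
  assumes "K > 0" and "\<And>n. f (n + K) = - f n"
  obtains B where "B \<ge> 0" "\<And>n. norm (f n) \<le> B"
proof -
  define B where "B = (\<Sum>i<K. norm (f i))"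
  have "norm (f n) \<le> B" for n
  proof (induction n rule: less_induct)
    case (less n)
    show ?case
    proof (cases "n < K")
      case True
      then show ?thesis unfolding B_def by (intro member_le_sum) auto
    next
      case False
      then have "norm (f n) = norm (f (n - K))" using assms(2)[of "n - K"] by simp
      then show ?thesis using less[of "n - K"] False assms(1) by simp
    qed
  qed
  moreover have "B \<ge> 0" unfolding B_def by (intro sum_nonneg) auto
  ultimately show ?thesis using that by blast
qed

text \<open>Applied twice, this replaces \<open>g\<close> by a second difference, which is small enough for a Gaussian.\<close>

lemma suminf_antiperiodic_mult:
  fixes f g :: "nat \<Rightarrow> 'a::real_normed_field"
  assumes "\<And>n. f (n + K) = - f n" and sm: "summable (\<lambda>n. f n * g n)"
  shows "(\<Sum>n. f n * g n) = (\<Sum>n<K. f n * g n) / 2 + (\<Sum>n. f n * (g n - g (n + K))) / 2"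
    and "summable (\<lambda>n. f n * (g n - g (n + K)))"
proof -
  have s: "summable (\<lambda>n. - (f (n + K) * g (n + K)))"
    using summable_ignore_initial_segment[OF sm, of K] by (rule summable_minus)
  have "(\<Sum>n. f n * (g n - g (n + K))) = (\<Sum>n. f n * g n + f (n + K) * g (n + K))"
    by (simp add: assms(1) algebra_simps)
  also have "\<dots> = (\<Sum>n. f n * g n) + (\<Sum>n. f (n + K) * g (n + K))"
    by (rule suminf_add[symmetric, OF sm summable_ignore_initial_segment[OF sm]])
  also have "(\<Sum>n. f (n + K) * g (n + K)) = (\<Sum>n. f n * g n) - (\<Sum>n<K. f n * g n)"
    by (rule suminf_minus_initial_segment[OF sm])
  finally show "(\<Sum>n. f n * g n) = (\<Sum>n<K. f n * g n) / 2 + (\<Sum>n. f n * (g n - g (n + K))) / 2"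
    by (simp add: field_simps)
  show "summable (\<lambda>n. f n * (g n - g (n + K)))"
    using summable_add[OF sm summable_ignore_initial_segment[OF sm, of K]]
    by (simp add: assms(1) algebra_simps)
qed

text \<open>First differences of the Gaussian are not enough: sigma n exp(-sigma n^2) sums to about
  1/2 however small sigma is. A second difference has size sigma (1 + sigma n^2) exp(-sigma n^2);
  part of its decay is given up here to reach a power of \<open>Re s\<close> times a fixed summable
  sequence. The indicator is for n = 0, where the power of n is 0.\<close>

lemma gaussian_second_difference_bound:
  fixes s :: complex and K n :: nat and C :: real
  assumes \<sigma>: "0 < Re s" "Re s \<le> 1" and C: "norm s \<le> C * Re s" and K: "K > 0"
  defines "g \<equiv> \<lambda>n::nat. exp (- s * of_nat n ^ 2)"
  shows "norm (g n - 2 * g (n + K) + g (n + 2 * K))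
    \<le> (18 * K ^ 4 * C\<^sup>2 + 4 * K ^ 2 * C) * Re s powr (1 / 4)
        * ((if n = 0 then 1 else 0) + real n powr (- (3 / 2)))"
proof -
  define \<sigma> where "\<sigma> = Re s"
  define k where "k = real K"
  have k1: "k \<ge> 1" using K unfolding k_def by simp
  have C0: "C \<ge> 0" using C \<sigma> by (smt (verit) norm_ge_zero mult_nonneg_nonneg zero_le_mult_iff)
  have s0: "\<sigma> > 0" "\<sigma> \<le> 1" using \<sigma> by (auto simp: \<sigma>_def)
  have Cs: "norm s \<le> C * \<sigma>" using C by (simp add: \<sigma>_def)
  define u where "u = exp (- s * of_real (2 * real n * k + k\<^sup>2))"
  \<comment> \<open>\<open>v\<close> carries the second difference 2 k^2 of the exponent, which is
    free of n.\<close>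
  define v where "v = exp (- s * of_real (2 * k\<^sup>2))"
  have g1: "g (n + K) = g n * u" "g (n + 2 * K) = g n * (u ^ 2 * v)"
    by (simp_all add: g_def u_def v_def k_def exp_add[symmetric] exp_double[symmetric] algebra_simps power2_eq_square)
  have "g n - 2 * g (n + K) + g (n + 2 * K) = g n * ((1 - u)\<^sup>2 - u\<^sup>2 * (1 - v))"
    unfolding g1 by (simp add: algebra_simps power2_eq_square)
  then have "norm (g n - 2 * g (n + K) + g (n + 2 * K)) = norm (g n) * norm ((1 - u)\<^sup>2 - u\<^sup>2 * (1 - v))"
    by (simp add: norm_mult)
  also have "norm (g n) = exp (- \<sigma> * (real n)\<^sup>2)"
    by (simp add: g_def \<sigma>_def flip: of_nat_power)
  finally have e: "norm (g n - 2 * g (n + K) + g (n + 2 * K)) =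
    exp (- \<sigma> * (real n)\<^sup>2) * norm ((1 - u)\<^sup>2 - u\<^sup>2 * (1 - v))" .
  have u: "norm (1 - u) \<le> C * \<sigma> * (2 * real n * k + k\<^sup>2)"
  proof -
    have "norm (1 - u) \<le> norm s * (2 * real n * k + k\<^sup>2)"
      using norm_one_minus_exp_le[of "- s * of_real (2 * real n * k + k\<^sup>2)"] s0 k1
      by (simp add: u_def norm_mult \<sigma>_def del: of_real_add of_real_mult of_real_power)
    also have "\<dots> \<le> C * \<sigma> * (2 * real n * k + k\<^sup>2)" using Cs k1 by (intro mult_right_mono) auto
    finally show ?thesis .
  qed
  have v: "norm (1 - v) \<le> C * \<sigma> * (2 * k\<^sup>2)"
  proof -
    have "norm (1 - v) \<le> norm s * (2 * k\<^sup>2)"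
      using norm_one_minus_exp_le[of "- s * of_real (2 * k\<^sup>2)"] s0 k1
      by (simp add: v_def norm_mult \<sigma>_def del: of_real_add of_real_mult of_real_power)
    also have "\<dots> \<le> C * \<sigma> * (2 * k\<^sup>2)" using Cs k1 by (intro mult_right_mono) auto
    finally show ?thesis .
  qed
  have u1: "norm u \<le> 1"
    using s0 k1 by (simp add: u_def \<sigma>_def del: of_real_add of_real_mult of_real_power)
  have "norm ((1 - u)\<^sup>2 - u\<^sup>2 * (1 - v)) \<le> norm (1 - u) ^ 2 + norm u ^ 2 * norm (1 - v)"
    by (rule order_trans[OF norm_triangle_ineq4]) (simp add: norm_mult norm_power)
  also have "\<dots> \<le> (C * \<sigma> * (2 * real n * k + k\<^sup>2))\<^sup>2 + 1\<^sup>2 * (C * \<sigma> * (2 * k\<^sup>2))"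
    by (intro add_mono power_mono mult_mono u v u1) auto
  finally have *: "norm (g n - 2 * g (n + K) + g (n + 2 * K)) \<le>
     exp (- \<sigma> * (real n)\<^sup>2) * ((C * \<sigma> * (2 * real n * k + k\<^sup>2))\<^sup>2 + 1\<^sup>2 * (C * \<sigma> * (2 * k\<^sup>2)))"
    unfolding e by (intro mult_left_mono) auto
  have s4: "\<sigma> \<le> \<sigma> powr (1/4)" using powr_mono'[of "1/4" 1 \<sigma>] s0 by simp
  show ?thesis
  proof (cases "n = 0")
    case True
    have "(C * \<sigma> * k\<^sup>2)\<^sup>2 = C\<^sup>2 * k ^ 4 * (\<sigma> * \<sigma>)" by (simp add: power2_eq_square power4_eq_xxxx)
    also have "\<dots> \<le> C\<^sup>2 * k ^ 4 * \<sigma>" using s0 by (intro mult_left_mono) (auto simp: mult_le_cancel_right1)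
    finally have "norm (g n - 2 * g (n + K) + g (n + 2 * K)) \<le> (C\<^sup>2 * k ^ 4 + 2 * k\<^sup>2 * C) * \<sigma>"
      using * True by (simp add: algebra_simps)
    also have "\<dots> \<le> (18 * k ^ 4 * C\<^sup>2 + 4 * k\<^sup>2 * C) * \<sigma> powr (1/4)"
      using s4 s0 C0 k1 by (intro mult_mono) (auto intro!: add_mono mult_right_mono)
    finally show ?thesis using True by (simp add: k_def \<sigma>_def)
  next
    case False
    define y where "y = \<sigma> * (real n)\<^sup>2"
    have y0: "y > 0" using False s0 by (simp add: y_def)
    have n1: "real n \<ge> 1" using False by simp
    have "2 * real n * k + k\<^sup>2 \<le> 3 * k\<^sup>2 * real n"
    proof -
      have "real n * k * 1 \<le> real n * k * k" using k1 by (intro mult_left_mono) auto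
      moreover have "k * k * 1 \<le> k * k * real n" using k1 n1 by (intro mult_left_mono) auto
      ultimately show ?thesis by (simp add: power2_eq_square algebra_simps)
    qed
    then have "(C * \<sigma> * (2 * real n * k + k\<^sup>2))\<^sup>2 \<le> (C * \<sigma> * (3 * k\<^sup>2 * real n))\<^sup>2"
      using C0 s0 k1 by (intro power_mono mult_left_mono) auto
    also have "\<dots> = 9 * k ^ 4 * C\<^sup>2 * (\<sigma> * y)"
      by (simp add: y_def power2_eq_square power4_eq_xxxx)
    finally have "norm (g n - 2 * g (n + K) + g (n + 2 * K)) \<le>
        exp (- y) * (9 * k ^ 4 * C\<^sup>2 * (\<sigma> * y) + C * \<sigma> * (2 * k\<^sup>2))"
      using * by (simp add: y_def) (smt (verit) exp_ge_zero mult_left_mono)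
    also have "\<dots> \<le> exp (- y) * ((9 * k ^ 4 * C\<^sup>2 + 2 * k\<^sup>2 * C) * \<sigma> * (1 + y))"
    proof -
      have "0 \<le> 9 * k ^ 4 * C\<^sup>2 * \<sigma>" "0 \<le> C * \<sigma> * (2 * k\<^sup>2) * y" using C0 s0 k1 y0 by auto
      then show ?thesis by (intro mult_left_mono) (auto simp: algebra_simps)
    qed
    \<comment> \<open>Trades the exponential for a rational function, so that (1 + y) exp(-y) is at
      most 2 / (1 + y).\<close>
    also have "\<dots> \<le> (2 / (1 + y)\<^sup>2) * ((9 * k ^ 4 * C\<^sup>2 + 2 * k\<^sup>2 * C) * \<sigma> * (1 + y))"
    proof (rule mult_right_mono)
      have "exp y \<ge> 1 + y + y\<^sup>2 / 2" using exp_lower_Taylor_quadratic[of y] y0 by simp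
      also have "1 + y + y\<^sup>2 / 2 \<ge> (1 + y)\<^sup>2 / 2" using y0 by (simp add: power2_eq_square algebra_simps)
      finally have "(1 + y)\<^sup>2 / 2 \<le> exp y" by simp
      then show "exp (- y) \<le> 2 / (1 + y)\<^sup>2" using y0 by (simp add: exp_minus field_simps)
    qed (use C0 s0 k1 y0 in auto)
    also have "\<dots> = (18 * k ^ 4 * C\<^sup>2 + 4 * k\<^sup>2 * C) * (\<sigma> / (1 + y))"
    proof -
      have "2 / (1 + y)\<^sup>2 * (X * \<sigma> * (1 + y)) = (2 * X) * (\<sigma> / (1 + y))" for X
        using y0 by (simp add: power2_eq_square)
      then show ?thesis by simp
    qed
    \<comment> \<open>Any exponent a strictly between 1/2 and 1 would serve: sigma / y^a =
      sigma^(1-a) n^(-2a) is then summable in n and tends to 0 with sigma.\<close>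
    also have "\<dots> \<le> (18 * k ^ 4 * C\<^sup>2 + 4 * k\<^sup>2 * C) * (\<sigma> / y powr (3/4))"
    proof (intro mult_left_mono divide_left_mono)
      show "y powr (3/4) \<le> 1 + y"
      proof (cases "y \<le> 1")
        case True
        then have "y powr (3/4) \<le> 1" using y0 by (intro powr_le1) auto
        then show ?thesis using y0 by linarith
      next
        case False
        then have "y powr (3/4) \<le> y powr 1" by (intro powr_mono) auto
        then show ?thesis using y0 by simp
      qed
    qed (use C0 s0 k1 y0 in auto)
    also have "\<sigma> / y powr (3/4) = \<sigma> powr (1/4) * real n powr (- (3/2))"
    proof -
      have "y powr (3/4) = \<sigma> powr (3/4) * real n powr (3/2)"
      proof -
        have "(real n)\<^sup>2 = real n powr 2" using n1 by simp
        then show ?thesis unfolding y_def by (simp only: powr_mult powr_powr) simp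
      qed
      moreover have "\<sigma> / \<sigma> powr (3/4) = \<sigma> powr (1/4)"
        using s0 powr_diff[of \<sigma> 1 "3/4"] by simp
      ultimately show ?thesis by (simp add: powr_minus_divide flip: divide_divide_eq_left)
    qed
    finally show ?thesis using False by (simp add: k_def \<sigma>_def mult_ac)
  qed
qed
text \<open>Differencing twice leaves half of one block sum, a finite sum of first differences that
  vanishes in the limit because each Gaussian factor tends to 1, and a remainder of order (Re
  s)^(1/4). The sector bounds \<open>norm s\<close> by a multiple of \<open>Re s\<close>, which
  makes the remainder estimate uniform.\<close>

lemma gaussian_sum_antiperiodic:
  fixes f :: "nat \<Rightarrow> complex"
  assumes K: "K > 0" and f: "\<And>n. f (n + K) = - f n"
  shows "((\<lambda>s. \<Sum>n. f n * exp (- s * of_nat n ^ 2)) \<longlongrightarrow> (\<Sum>n<K. f n) / 2)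
    (at 0 within {s. Re s > 0 \<and> \<bar>Im s\<bar> \<le> c * Re s})"
proof -
  define D where "D = {s. Re s > 0 \<and> \<bar>Im s\<bar> \<le> c * Re s}"
  define g where "g = (\<lambda>s::complex. \<lambda>n::nat. exp (- s * of_nat n ^ 2))"
  define C where "C = 1 + c"
  obtain B where B: "B \<ge> 0" "\<And>n. norm (f n) \<le> B" using antiperiodic_bounded[of K f] K f by blast
  define h where "h = (\<lambda>n::nat. (if n = 0 then 1 else 0) + real n powr (- (3 / 2)))"
  define A where "A = (18 * K ^ 4 * C\<^sup>2 + 4 * K ^ 2 * C)"
  have hs: "summable h" unfolding h_def
    by (intro summable_add) (auto simp: summable_real_powr_iff)
  define R where "R = (\<lambda>s. \<Sum>n. f n * (g s n - g s (n + K) - (g s (n + K) - g s (n + K + K))))"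
  have sm: "summable (\<lambda>n. f n * g s n)" if "Re s > 0" for s
  proof (rule summable_comparison_test')
    have "summable (\<lambda>n. exp (- Re s) ^ n)" using that by (intro summable_geometric) auto
    then show "summable (\<lambda>n. B * exp (- Re s) ^ n)" by (rule summable_mult)
    fix n :: nat
    have "real n \<le> real n ^ 2" by (cases n) (auto simp: power2_eq_square)
    then have "Re s * real n \<le> Re s * real n ^ 2" using that by (intro mult_left_mono) auto
    then have "norm (g s n) \<le> exp (- Re s) ^ n"
      by (simp add: g_def exp_of_nat_mult[symmetric] mult_ac flip: of_nat_power)
    then show "norm (f n * g s n) \<le> B * exp (- Re s) ^ n"
      unfolding norm_mult using B by (intro mult_mono) auto
  qed
  have R_bound: "norm (R s) \<le> B * (A * Re s powr (1 / 4)) * (\<Sum>n. h n)" if s: "s \<in> D" "Re s \<le> 1" for s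
  proof -
    have "norm s \<le> \<bar>Re s\<bar> + \<bar>Im s\<bar>" by (rule cmod_le)
    then have sC: "norm s \<le> C * Re s" using s by (simp add: D_def C_def algebra_simps)
    have b: "norm (f n * (g s n - g s (n + K) - (g s (n + K) - g s (n + K + K))))
        \<le> B * (A * Re s powr (1 / 4)) * h n" for n
    proof -
      have "norm (g s n - 2 * g s (n + K) + g s (n + 2 * K)) \<le> A * Re s powr (1 / 4) * h n"
        unfolding A_def h_def g_def
        using s sC K by (intro gaussian_second_difference_bound) (auto simp: D_def)
      moreover have "g s n - 2 * g s (n + K) + g s (n + 2 * K) =
          g s n - g s (n + K) - (g s (n + K) - g s (n + K + K))"
      proof -
        have "n + 2 * K = n + K + K" by simp
        then show ?thesis by (simp only:) simp
      qed
      ultimately have "norm (g s n - g s (n + K) - (g s (n + K) - g s (n + K + K))) \<le> A * Re s powr (1 / 4) * h n"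
        by (simp only:)
      then show ?thesis unfolding norm_mult mult.assoc[of B] using B by (intro mult_mono) auto
    qed
    have "norm (R s) \<le> (\<Sum>n. B * (A * Re s powr (1 / 4)) * h n)"
      unfolding R_def by (rule norm_suminf_le[OF b summable_mult[OF hs]])
    also have "\<dots> = B * (A * Re s powr (1 / 4)) * (\<Sum>n. h n)" by (rule suminf_mult[OF hs])
    finally show ?thesis .
  qed
  have ev: "\<forall>\<^sub>F s in at 0 within D. s \<in> D \<and> Re s \<le> 1"
  proof -
    have "\<forall>\<^sub>F s in nhds (0::complex). s \<in> ball 0 1" by (intro eventually_nhds_in_open) auto
    then show ?thesis
      unfolding eventually_at_filter
      by eventually_elim (use complex_Re_le_cmod in \<open>auto intro: order_trans less_imp_le\<close>)
  qed
  have R0: "(R \<longlongrightarrow> 0) (at 0 within D)"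
  proof (rule Lim_null_comparison)
    show "\<forall>\<^sub>F s in at 0 within D. norm (R s) \<le> B * (A * Re s powr (1 / 4)) * (\<Sum>n. h n)"
      using ev by eventually_elim (use R_bound in auto)
    have "((\<lambda>s. Re s powr (1 / 4)) \<longlongrightarrow> 0) (at 0 within D)"
    proof (rule tendsto_zero_powrI)
      show "(Re \<longlongrightarrow> 0) (at 0 within D)" by (auto intro!: tendsto_eq_intros)
      show "\<forall>\<^sub>F x in at 0 within D. 0 \<le> Re x" using ev by eventually_elim (auto simp: D_def)
    qed auto
    then have "((\<lambda>s. B * (A * Re s powr (1 / 4)) * (\<Sum>n. h n)) \<longlongrightarrow> B * (A * 0) * (\<Sum>n. h n)) (at 0 within D)"
      by (rule tendsto_mult_right[OF tendsto_mult_left[OF tendsto_mult_left]])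
    then show "((\<lambda>s. B * (A * Re s powr (1 / 4)) * (\<Sum>n. h n)) \<longlongrightarrow> 0) (at 0 within D)"
      by simp
  qed
  have g_lim: "((\<lambda>s. g s n) \<longlongrightarrow> 1) (at 0 within D)" for n
    unfolding g_def by (auto intro!: tendsto_eq_intros)
  have "((\<lambda>s. (\<Sum>n<K. f n * g s n) / 2 + ((\<Sum>n<K. f n * (g s n - g s (n + K))) / 2 + R s / 2) / 2)
      \<longlongrightarrow> (\<Sum>n<K. f n * 1) / 2 + ((\<Sum>n<K. f n * (1 - 1)) / 2 + 0 / 2) / 2) (at 0 within D)"
    by (intro tendsto_intros g_lim R0) auto
  also have "?this \<longleftrightarrow> ?thesis"
    unfolding D_def[symmetric] g_def[symmetric]
  proof (rule Lim_cong_within)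
    fix s assume "s \<in> D"
    then have "Re s > 0" by (simp add: D_def)
    note 1 = suminf_antiperiodic_mult[OF f sm[OF this]]
    note 2 = suminf_antiperiodic_mult[OF f 1(2)]
    show "(\<Sum>n<K. f n * g s n) / 2 + ((\<Sum>n<K. f n * (g s n - g s (n + K))) / 2 + R s / 2) / 2 =
        (\<Sum>n. f n * exp (- s * of_nat n ^ 2))"
      unfolding R_def using 1(1) 2(1) by (simp add: g_def)
  qed auto
  finally show ?thesis .
qed

text \<open>Writing \<tau> as x plus a displacement splits each q-power into its value at x and a
  Gaussian factor exp(-s n^2). The map from \<tau> to s is a rotation with scaling, so it carries
  the sector at x to the sector at 0 with the same aperture c.\<close>

lemma eichler_type_cusp_limit:
  fixes x A :: real and g :: "nat \<Rightarrow> complex"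
  assumes K: "K > 0" and A: "A > 0"
    and anti: "\<And>n. g (n + K) * qpow x ((real (n + K))\<^sup>2 / A) = - (g n * qpow x ((real n)\<^sup>2 / A))"
  shows "has_cusp_limit (\<lambda>\<tau>. qpow \<tau> d * (\<Sum>n. g n * qpow \<tau> ((real n)\<^sup>2 / A))) x
    (qpow x d * ((\<Sum>n<K. g n * qpow x ((real n)\<^sup>2 / A)) / 2))"
  unfolding has_cusp_limit_def
proof safe
  fix c :: real assume c: "c > 0"
  define H where "H = {\<tau>. Im \<tau> > 0 \<and> \<bar>Re \<tau> - x\<bar> \<le> c * Im \<tau>}"
  define D where "D = {s. Re s > 0 \<and> \<bar>Im s\<bar> \<le> c * Re s}"
  define f where "f = (\<lambda>n. g n * qpow x ((real n)\<^sup>2 / A))"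
  define w where "w = 2 * pi / A"
  have w: "w > 0" using A by (simp add: w_def)
  define s where "s = (\<lambda>\<tau>. - (\<i> * of_real w * (\<tau> - of_real x)))"
  have "((\<lambda>s. \<Sum>n. f n * exp (- s * of_nat n ^ 2)) \<longlongrightarrow> (\<Sum>n<K. f n) / 2) (at 0 within D)"
    unfolding D_def using K anti by (intro gaussian_sum_antiperiodic) (auto simp: f_def)
  moreover have "filterlim s (at 0 within D) (at (of_real x) within H)"
    unfolding filterlim_at
  proof
    show "\<forall>\<^sub>F \<tau> in at (of_real x) within H. s \<tau> \<in> D \<and> s \<tau> \<noteq> 0"
      unfolding eventually_at_filter
    proof (intro always_eventually allI impI)
      fix \<tau> assume *: "\<tau> \<noteq> of_real x" "\<tau> \<in> H"
      have "Re (s \<tau>) = w * Im \<tau>" "Im (s \<tau>) = - (w * (Re \<tau> - x))" by (simp_all add: s_def)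
      moreover have "\<bar>w * (Re \<tau> - x)\<bar> \<le> c * (w * Im \<tau>)"
        using * w by (simp add: H_def abs_mult mult.left_commute)
      ultimately show "s \<tau> \<in> D \<and> s \<tau> \<noteq> 0" using * w by (auto simp: D_def H_def s_def)
    qed
    show "(s \<longlongrightarrow> 0) (at (of_real x) within H)"
      unfolding s_def by (auto intro!: tendsto_eq_intros)
  qed
  ultimately have "((\<lambda>\<tau>. \<Sum>n. f n * exp (- s \<tau> * of_nat n ^ 2)) \<longlongrightarrow> (\<Sum>n<K. f n) / 2) (at (of_real x) within H)"
    by (rule filterlim_compose)
  moreover have "f n * exp (- s \<tau> * of_nat n ^ 2) = g n * qpow \<tau> ((real n)\<^sup>2 / A)" for n \<tau>
    by (simp add: f_def s_def w_def qpow_def exp_add[symmetric] algebra_simps diff_divide_distrib)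
  ultimately have "((\<lambda>\<tau>. \<Sum>n. g n * qpow \<tau> ((real n)\<^sup>2 / A)) \<longlongrightarrow> (\<Sum>n<K. f n) / 2) (at (of_real x) within H)"
    by simp
  moreover have "((\<lambda>\<tau>. qpow \<tau> d) \<longlongrightarrow> qpow x d) (at (of_real x) within H)"
    unfolding qpow_def by (auto intro!: tendsto_eq_intros)
  ultimately have "((\<lambda>\<tau>. qpow \<tau> d * (\<Sum>n. g n * qpow \<tau> ((real n)\<^sup>2 / A))) \<longlongrightarrow>
      qpow x d * ((\<Sum>n<K. f n) / 2)) (at (of_real x) within H)"
    by (rule tendsto_mult[rotated])
  then show "((\<lambda>\<tau>. qpow \<tau> d * (\<Sum>n. g n * qpow \<tau> ((real n)\<^sup>2 / A))) \<longlongrightarrow>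
      qpow x d * ((\<Sum>n<K. g n * qpow x ((real n)\<^sup>2 / A)) / 2))
      (at (of_real x) within {\<tau>. Im \<tau> > 0 \<and> \<bar>Re \<tau> - x\<bar> \<le> c * Im \<tau>})"
    by (simp only: H_def f_def)
qed

section \<open>Gaussian binomials and chain sums\<close>

text \<open>The q-Pascal recursion: division-free, hence meaningful and continuous at roots of
  unity, and available in the polynomial ring, where it is compared with
  \<open>qbinom_poly\<close>.\<close>

primrec gauss :: "nat \<Rightarrow> nat \<Rightarrow> 'a::comm_ring_1 \<Rightarrow> 'a" where
  "gauss 0 k x = (if k = 0 then 1 else 0)"
| "gauss (Suc n) k x = (case k of 0 \<Rightarrow> 1 | Suc j \<Rightarrow> gauss n j x + x ^ k * gauss n k x)"

lemma gauss_0_right [simp]: "gauss n 0 x = 1"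
  by (cases n) auto

lemma gauss_Suc_Suc: "gauss (Suc n) (Suc k) x = gauss n k x + x ^ Suc k * gauss n (Suc k) x"
  by simp

declare gauss.simps(2) [simp del]

lemma gauss_eq_0: "n < k \<Longrightarrow> gauss n k x = 0"
  by (induction n arbitrary: k) (auto simp: gauss.simps(2) split: nat.split)

lemma gauss_self [simp]: "gauss n n x = 1"
  by (induction n) (auto simp: gauss.simps(2) gauss_eq_0)

lemma qpoch_0 [simp]: "qpoch a q 0 = 1"
  by (simp add: qpoch_def)

lemma qpoch_shift: "qpoch a q (Suc n) = (1 - a) * qpoch (a * q) q n"
proof (induction n)
  case (Suc n)
  have "qpoch a q (Suc (Suc n)) = (1 - a) * qpoch (a * q) q n * (1 - a * q ^ Suc n)"
    by (subst qpoch_Suc) (simp add: Suc)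
  also have "\<dots> = (1 - a) * qpoch (a * q) q (Suc n)" by (simp add: qpoch_Suc mult_ac)
  finally show ?case .
qed (simp add: qpoch_Suc)

lemma qpoch_add: "qpoch a q (m + n) = qpoch a q m * qpoch (a * q ^ m) q n"
  by (induction n) (simp_all add: qpoch_Suc power_add mult_ac)

text \<open>Induction along the Pascal rule; the two summands combine by (1 - x^k) + x^k (1 - x^j) =
  1 - x^(j+k).\<close>

lemma gauss_qpoch: "gauss (j + k) k x * (qpoch x x j * qpoch x x k) = qpoch x x (j + k)"
proof (induction "j + k" arbitrary: j k)
  case (Suc n)
  show ?case
  proof (cases "j = 0 \<or> k = 0")
    case False
    then obtain i l where jk: "j = Suc i" "k = Suc l" using not0_implies_Suc by blast
    have 1: "gauss (Suc i + l) l x * (qpoch x x (Suc i) * qpoch x x l) = qpoch x x (Suc i + l)"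
      using Suc jk by (intro Suc.hyps) auto
    have 2: "gauss (i + Suc l) (Suc l) x * (qpoch x x i * qpoch x x (Suc l)) = qpoch x x (i + Suc l)"
      using Suc jk by (intro Suc.hyps) auto
    have "gauss (j + k) k x * (qpoch x x j * qpoch x x k) =
       gauss (Suc i + l) l x * (qpoch x x (Suc i) * qpoch x x l) * (1 - x * x ^ l) +
       x ^ k * (1 - x * x ^ i) * (gauss (i + Suc l) (Suc l) x * (qpoch x x i * qpoch x x (Suc l)))"
      by (simp add: jk gauss_Suc_Suc qpoch_Suc[of x x i] qpoch_Suc[of x x l] algebra_simps)
    also have "\<dots> = qpoch x x (Suc i + l) * (1 - x * x ^ (Suc i + l))"
      unfolding 1 2 by (simp add: jk algebra_simps power_add)
    finally show ?thesis by (simp add: jk qpoch_Suc)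
  qed auto
qed auto

lemma poly_gauss: "poly (gauss n k [:0, 1:]) (x :: 'a :: comm_ring_1) = gauss n k x"
  by (induction n arbitrary: k) (auto simp: gauss.simps(2) poly_power split: nat.split)

lemma qbinom_eq_gauss:
  assumes "k \<le> n"
  shows "qbinom n k q = gauss n k q"
proof -
  have "qbinom_poly n k = gauss n k [:0, 1:]"
  proof (rule mult_right_cancel[THEN iffD1])
    show "qbinom_poly n k * (qpoch [:0, 1:] [:0, 1:] (n - k) * qpoch [:0, 1:] [:0, 1:] k) =
        gauss n k [:0, 1:] * (qpoch [:0, 1:] [:0, 1:] (n - k) * qpoch [:0, 1:] [:0, 1:] k)"
      using qbinom_poly_exact[OF assms] gauss_qpoch[of "n - k" k "[:0, 1:] :: complex poly"] assms by simp
  qed (simp add: qpoch_XX_nonzero)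
  then show ?thesis by (simp add: qbinom_def poly_gauss)
qed

text \<open>The sum over the entries below a fixed top entry \<open>n\<close>. Here \<open>p\<close>
  counts only these lower entries, so chains of length \<open>Suc p\<close> belong to
  \<open>chain_inner a q p\<close>.\<close>

primrec chain_inner :: "(nat \<Rightarrow> complex) \<Rightarrow> complex \<Rightarrow> nat \<Rightarrow> nat \<Rightarrow> complex" where
  "chain_inner a q 0 n = 1"
| "chain_inner a q (Suc p) n = (\<Sum>r\<le>n. a r * gauss n r q * chain_inner a q p r)"

text \<open>Chains are cut at their largest entry: appending \<open>n\<close> is a bijection from
  pairs of some r \<le> n and a chain ending in r. Finiteness rides along in the induction because
  splitting the sum needs it.\<close>

lemma chain_inner_sum_lists:
  fixes a q
  defines "W \<equiv> \<lambda>xs. \<Prod>i=1..<length xs. a (xs ! (i - 1)) * qbinom (xs ! i) (xs ! (i - 1)) q"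
  defines "L \<equiv> \<lambda>p n. {xs. length xs = Suc p \<and> sorted xs \<and> last xs = (n::nat)}"
  shows "finite (L p n) \<and> sum W (L p n) = chain_inner a q p n"
proof (induction p arbitrary: n)
  case 0
  have "L 0 n = {[n]}" by (auto simp: L_def length_Suc_conv)
  then show ?case by (simp add: W_def)
next
  case (Suc p)
  have inj: "inj_on (\<lambda>(r, xs). xs @ [n]) (SIGMA r:{..n}. L p r)"
    by (auto simp: inj_on_def L_def)
  have img: "L (Suc p) n = (\<lambda>(r, xs). xs @ [n]) ` (SIGMA r:{..n}. L p r)" (is "_ = ?R")
  proof (intro equalityI subsetI)
    fix ys assume "ys \<in> L (Suc p) n"
    then have ys: "length ys = Suc (Suc p)" "sorted ys" "last ys = n" by (auto simp: L_def)
    define xs where "xs = butlast ys"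
    have e: "ys = xs @ [n]" using ys unfolding xs_def by (metis append_butlast_last_id list.size(3) nat.distinct(1))
    have xs: "length xs = Suc p" "sorted xs" "\<forall>x\<in>set xs. x \<le> n" using ys e by (auto simp: sorted_append)
    then have "last xs \<le> n" by (metis last_in_set list.size(3) nat.distinct(1))
    then show "ys \<in> ?R" using xs e by (force simp: L_def)
  next
    fix ys assume "ys \<in> ?R"
    then obtain xs where xs: "ys = xs @ [n]" "length xs = Suc p" "sorted xs" "last xs \<le> n" by (auto simp: L_def)
    have "x \<le> n" if x: "x \<in> set xs" for x
    proof -
      obtain i where i: "i < length xs" "x = xs ! i" using x by (auto simp: in_set_conv_nth)
      have "x \<le> xs ! (length xs - 1)" unfolding i(2) using xs(3) i(1) by (intro sorted_nth_mono) auto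
      also have "\<dots> = last xs" using xs by (subst last_conv_nth) auto
      finally show ?thesis using xs by simp
    qed
    then show "ys \<in> L (Suc p) n" using xs by (auto simp: L_def sorted_append)
  qed
  have W: "W (xs @ [n]) = a r * gauss n r q * W xs" if "r \<le> n" "xs \<in> L p r" for xs r
  proof -
    have xs: "length xs = Suc p" "last xs = r" using that by (auto simp: L_def)
    then have l: "xs ! p = r" by (metis diff_Suc_1 last_conv_nth list.size(3) nat.distinct(1))
    have "W (xs @ [n]) = (\<Prod>i=1..<Suc p. a ((xs @ [n]) ! (i - 1)) * qbinom ((xs @ [n]) ! i) ((xs @ [n]) ! (i - 1)) q)
        * (a r * qbinom n r q)"
      using xs l by (simp add: W_def nth_append)
    also have "(\<Prod>i=1..<Suc p. a ((xs @ [n]) ! (i - 1)) * qbinom ((xs @ [n]) ! i) ((xs @ [n]) ! (i - 1)) q) = W xs"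
      unfolding W_def xs by (intro prod.cong) (use xs in \<open>auto simp: nth_append\<close>)
    finally show ?thesis using that by (simp add: qbinom_eq_gauss)
  qed
  have "sum W (L (Suc p) n) = (\<Sum>(r, xs)\<in>(SIGMA r:{..n}. L p r). W (xs @ [n]))"
    unfolding img by (subst sum.reindex[OF inj]) (simp add: case_prod_unfold)
  also have "\<dots> = (\<Sum>r\<le>n. \<Sum>xs\<in>L p r. W (xs @ [n]))"
    using Suc by (subst sum.Sigma) auto
  also have "\<dots> = (\<Sum>r\<le>n. a r * gauss n r q * sum W (L p r))"
    by (simp add: W sum_distrib_left)
  also have "\<dots> = chain_inner a q (Suc p) n" using Suc by simp
  finally have "sum W (L (Suc p) n) = chain_inner a q (Suc p) n" .
  moreover have "finite (L (Suc p) n)" unfolding img using Suc by auto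
  ultimately show ?case by blast
qed

text \<open>Grouped by their last entry, the chains with a nonzero prefactor fall into finitely many
  finite groups, so no question of summability arises.\<close>

lemma chain_sum_eq:
  assumes h: "\<And>n. n \<ge> N \<Longrightarrow> h n = 0"
  shows "chain_sum h a (Suc p) q = (\<Sum>n<N. h n * chain_inner a q p n)"
proof -
  define L where "L = (\<lambda>n::nat. {xs. length xs = Suc p \<and> sorted xs \<and> last xs = n})"
  define W where "W = (\<lambda>xs::nat list. \<Prod>i=1..<length xs. a (xs ! (i - 1)) * qbinom (xs ! i) (xs ! (i - 1)) q)"
  have L: "finite (L n)" "sum W (L n) = chain_inner a q p n" for n
    using chain_inner_sum_lists[of p n a q] by (auto simp: L_def W_def)
  have t: "chain_term h a (Suc p) q xs = h n * W xs" if "xs \<in> L n" for n xs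
  proof -
    have "xs ! p = n" using that by (auto simp: L_def) (metis diff_Suc_1 last_conv_nth list.size(3) nat.distinct(1))
    then show ?thesis using that by (simp add: chain_term_def W_def L_def)
  qed
  have "chain_sum h a (Suc p) q = infsum (chain_term h a (Suc p) q) (\<Union>n<N. L n)"
    unfolding chain_sum_def
  proof (rule infsum_cong_neutral)
    fix xs assume "xs \<in> {ns. length ns = Suc p \<and> sorted ns} - (\<Union>n<N. L n)"
    then have "xs \<in> L (last xs)" "last xs \<ge> N" by (auto simp: L_def not_less[symmetric])
    then show "chain_term h a (Suc p) q xs = 0" using t h by simp
  qed (auto simp: L_def)
  also have "\<dots> = sum (chain_term h a (Suc p) q) (\<Union>n<N. L n)"
    using L by (intro infsum_finite) auto
  also have "\<dots> = (\<Sum>n<N. sum (chain_term h a (Suc p) q) (L n))"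
    using L by (intro sum.UNION_disjoint) (auto simp: L_def)
  also have "\<dots> = (\<Sum>n<N. h n * chain_inner a q p n)"
    by (intro sum.cong) (auto simp: t L(2)[symmetric] sum_distrib_left)
  finally show ?thesis .
qed

section \<open>The finite Jacobi triple product\<close>

text \<open>The mirror image of the defining Pascal rule. Inverting x exchanges the two rules, which
  is how \<open>gauss_inverse\<close> uses it.\<close>

lemma gauss_Suc_Suc':
  assumes "k \<le> n"
  shows "gauss (Suc n) (Suc k) x = gauss n (Suc k) x + x ^ (n - k) * gauss n k x"
  using assms
proof (induction n arbitrary: k)
  case (Suc n)
  show ?case
  proof (cases "k = 0 \<or> k = Suc n")
    case False
    then obtain j where j: "k = Suc j" "Suc j \<le> n" using Suc.prems by (cases k) auto
    then have e: "n - j = Suc (n - k)" "Suc n - k = Suc (n - k)" by auto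
    have "gauss (Suc (Suc n)) (Suc k) x = gauss (Suc n) (Suc j) x + x ^ Suc k * gauss (Suc n) (Suc k) x"
      using gauss_Suc_Suc[of "Suc n" k x] j by (simp only:)
    also have "\<dots> = gauss n (Suc j) x + x ^ (n - j) * gauss n j x
        + x ^ Suc k * (gauss n (Suc k) x + x ^ (n - k) * gauss n k x)"
      using Suc.IH[of j] Suc.IH[of k] j by (simp only: Suc_leD)
    also have "\<dots> = (gauss n k x + x ^ Suc k * gauss n (Suc k) x) + x ^ (Suc n - k) * (gauss n j x + x ^ k * gauss n k x)"
      unfolding e j(1)[symmetric] by (simp add: algebra_simps)
    also have "\<dots> = gauss (Suc n) (Suc k) x + x ^ (Suc n - k) * gauss (Suc n) k x"
      using gauss_Suc_Suc[of n k x] gauss_Suc_Suc[of n j x] j by (simp only:)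
    finally show ?thesis .
  next
    case True
    then show ?thesis
    proof
      assume "k = 0"
      then show ?thesis using Suc.IH[of 0] by (simp add: gauss_Suc_Suc algebra_simps)
    next
      assume "k = Suc n"
      then show ?thesis by (simp add: gauss_eq_0)
    qed
  qed
qed simp

text \<open>Palindromy of the q-binomial, a polynomial of degree j k. It is what gives access to the
  series with negative exponents.\<close>

lemma gauss_inverse:
  fixes x :: "'a::field"
  assumes "x \<noteq> 0"
  shows "gauss (j + k) k x = x ^ (j * k) * gauss (j + k) k (inverse x)"
proof (induction "j + k" arbitrary: j k)
  case (Suc n)
  show ?case
  proof (cases "j = 0 \<or> k = 0")
    case False
    then obtain i l where jk: "j = Suc i" "k = Suc l" using not0_implies_Suc by blast
    have n: "n = j + l" "n = i + k" using Suc.hyps(2) jk by auto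
    have 1: "gauss n l x = x ^ (j * l) * gauss n l (inverse x)" unfolding n(1) by (rule Suc.hyps(1)) (use n in auto)
    have 2: "gauss n k x = x ^ (i * k) * gauss n k (inverse x)" unfolding n(2) by (rule Suc.hyps(1)) (use n in auto)
    have "gauss (j + k) k x = gauss n k x + x ^ j * gauss n l x"
      using gauss_Suc_Suc'[of l n x] by (simp add: n jk)
    also have "\<dots> = x ^ (j * k) * (gauss n l (inverse x) + inverse x ^ k * gauss n k (inverse x))"
    proof -
      have "x ^ (j * k) = x ^ j * x ^ (j * l)" by (simp add: jk power_add)
      moreover have "x ^ (j * k) * inverse x ^ k = x ^ (i * k)"
        using assms by (simp add: jk power_add power_mult_distrib[symmetric] mult_ac)
      ultimately show ?thesis unfolding 1 2 distrib_left mult.assoc[symmetric] by simp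
    qed
    also have "\<dots> = x ^ (j * k) * gauss (j + k) k (inverse x)"
      using gauss_Suc_Suc[of n l "inverse x"] n jk by simp
    finally show ?thesis .
  qed auto
qed auto

definition tri :: "int \<Rightarrow> int" where "tri k = k * (k - 1) div 2"

lemma two_tri: "2 * tri k = k * (k - 1)"
  unfolding tri_def by (subst dvd_mult_div_cancel) auto

lemma tri_add: "tri (a + b) = tri a + tri b + a * b"
  using two_tri[of a] two_tri[of b] two_tri[of "a + b"] by (simp add: algebra_simps)

lemma tri_minus: "tri (- a) = tri a + a"
  using two_tri[of a] two_tri[of "- a"] by (simp add: algebra_simps)

lemma tri_1 [simp]: "tri 1 = 0" and tri_0 [simp]: "tri 0 = 0"
  by (simp_all add: tri_def)

definition jacobi_coeff :: "complex \<Rightarrow> int \<Rightarrow> complex" where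
  "jacobi_coeff q k = (-1) powi k * q powi tri k"

text \<open>The linear functional x^k -> \<open>w k\<close> applied to the Laurent polynomial (x)_n
  (q/x)_m; the finite triple product is the case \<open>w k = x powi k\<close>.\<close>

definition jacobi_sum :: "complex \<Rightarrow> (int \<Rightarrow> complex) \<Rightarrow> nat \<Rightarrow> nat \<Rightarrow> complex" where
  "jacobi_sum q w n m =
     (\<Sum>k\<in>{- int m..int n}. jacobi_coeff q k * w k * gauss (n + m) (nat (int n - k)) q)"

lemma int_Suc: "int (Suc n) = int n + 1"
  by simp

text \<open>Splitting off the first factor 1 - z rather than the last replaces z by z q, and the
  powers of q so gained are those of the Pascal rule.\<close>

lemma q_binomial_theorem:
  fixes z q :: complex
  assumes "q \<noteq> 0"
  shows "qpoch z q n = (\<Sum>j\<le>n. jacobi_coeff q (int j) * z ^ j * gauss n j q)"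
proof (induction n arbitrary: z)
  case (Suc n)
  define t where "t = (\<lambda>j::nat. jacobi_coeff q (int j))"
  have t0: "t 0 = 1" by (simp add: t_def jacobi_coeff_def)
  have tS: "t (Suc j) = - (t j * q ^ j)" for j
    using tri_add[of "int j" 1] assms
    by (simp add: t_def jacobi_coeff_def power_int_add int_Suc del: of_nat_Suc)
  have "(\<Sum>j\<le>Suc n. t j * z ^ j * gauss (Suc n) j q)
      = 1 + (\<Sum>j\<le>n. t (Suc j) * z ^ Suc j * (gauss n j q + q ^ Suc j * gauss n (Suc j) q))"
    by (subst sum.atMost_Suc_shift) (simp add: t0 gauss_Suc_Suc)
  also have "\<dots> = (1 + (\<Sum>j\<le>n. t (Suc j) * (z * q) ^ Suc j * gauss n (Suc j) q))
      - z * (\<Sum>j\<le>n. t j * (z * q) ^ j * gauss n j q)"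
  proof -
    have "t (Suc j) * z ^ Suc j * (gauss n j q + q ^ Suc j * gauss n (Suc j) q) =
        t (Suc j) * (z * q) ^ Suc j * gauss n (Suc j) q - z * (t j * (z * q) ^ j * gauss n j q)" for j
      by (simp add: tS power_mult_distrib algebra_simps)
    then show ?thesis by (simp add: sum_subtractf sum_distrib_left)
  qed
  finally have 1: "(\<Sum>j\<le>Suc n. t j * z ^ j * gauss (Suc n) j q) =
      (1 + (\<Sum>j\<le>n. t (Suc j) * (z * q) ^ Suc j * gauss n (Suc j) q))
      - z * (\<Sum>j\<le>n. t j * (z * q) ^ j * gauss n j q)" .
  have "1 + (\<Sum>j\<le>n. t (Suc j) * (z * q) ^ Suc j * gauss n (Suc j) q)
      = (\<Sum>j\<le>Suc n. t j * (z * q) ^ j * gauss n j q)"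
    by (subst sum.atMost_Suc_shift) (simp add: t0)
  also have "\<dots> = (\<Sum>j\<le>n. t j * (z * q) ^ j * gauss n j q)"
    by (simp add: gauss_eq_0)
  finally have "(\<Sum>j\<le>Suc n. t j * z ^ j * gauss (Suc n) j q) = (1 - z) * qpoch (z * q) q n"
    unfolding 1 by (simp add: Suc.IH t_def algebra_simps)
  then show ?case by (simp add: qpoch_shift t_def)
qed (simp add: jacobi_coeff_def)

text \<open>Each factor is turned around by 1 - q^(-i) / x = - (q^(-i) / x) (1 - x q^i); the
  coefficient collects the signs and the powers q^(-i).\<close>

lemma qpoch_reverse:
  fixes q x :: complex
  assumes "q \<noteq> 0" "x \<noteq> 0"
  shows "qpoch (q powi (1 - int n) / x) q n = jacobi_coeff (inverse q) (int n) * x powi (- int n) * qpoch x q n"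
proof (induction n)
  case (Suc n)
  have "qpoch (q powi (1 - int (Suc n)) / x) q (Suc n)
     = (1 - q powi (- int n) / x) * qpoch (q powi (1 - int n) / x) q n"
  proof -
    have "q powi (- int n) * q = q powi (1 - int n)"
      using assms by (simp add: power_int_diff power_int_minus field_simps)
    then show ?thesis by (simp add: qpoch_shift)
  qed
  also have "\<dots> = jacobi_coeff (inverse q) (int n) * x powi (- int n) * qpoch x q n * (1 - q powi (- int n) / x)"
    by (simp add: Suc.IH)
  also have "\<dots> = jacobi_coeff (inverse q) (int (Suc n)) * x powi (- int (Suc n)) * qpoch x q (Suc n)"
  proof -
    have c: "jacobi_coeff (inverse q) (int (Suc n)) = - jacobi_coeff (inverse q) (int n) / q ^ n"
      using tri_add[of "int n" 1] assms
      by (simp add: jacobi_coeff_def power_int_add int_Suc power_inverse divide_inverse del: of_nat_Suc)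
    have "x powi (- int (Suc n)) = x powi (- int n) / x"
      unfolding power_int_minus power_int_of_nat by (simp add: divide_inverse mult.commute)
    moreover define w where "w = 1 - x * q ^ n"
    moreover have "1 - q powi (- int n) / x = - w / (q ^ n * x)"
      using assms by (simp add: w_def power_int_minus field_simps)
    ultimately show ?thesis unfolding c qpoch_Suc w_def[symmetric] by simp
  qed
  finally show ?case .
qed (simp add: jacobi_coeff_def)

text \<open>The q-binomial theorem for n + m factors at z = q^(1-n) / x: the first n factors are
  (x)_n turned around, and z q^n = q / x makes the other m factors (q/x)_m. The index is then
  centred by j = n - k.\<close>

lemma finite_jacobi_triple_product:
  assumes q: "q \<noteq> 0" and x: "x \<noteq> 0"
  shows "jacobi_sum q (\<lambda>k. x powi k) n m = qpoch x q n * qpoch (q / x) q m"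
proof -
  define z where "z = q powi (1 - int n) / x"
  have z: "z \<noteq> 0" using q x by (simp add: z_def)
  have "qpoch z q (n + m) = (\<Sum>j\<le>n + m. jacobi_coeff q (int j) * z ^ j * gauss (n + m) j q)"
    by (rule q_binomial_theorem[OF q])
  also have "\<dots> = (\<Sum>k\<in>{- int m..int n}. jacobi_coeff q (int n - k) * z powi (int n - k) * gauss (n + m) (nat (int n - k)) q)"
    by (rule sum.reindex_bij_witness[of _ "\<lambda>k. nat (int n - k)" "\<lambda>j. int n - int j"]) auto
  also have "\<dots> = jacobi_coeff (inverse q) (int n) * x powi (- int n) * jacobi_sum q (\<lambda>k. x powi k) n m"
    unfolding jacobi_sum_def sum_distrib_left
  proof (rule sum.cong[OF refl])
    fix k
    have "tri (int n - k) = tri (int n) + tri k + k - int n * k"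
      using tri_add[of "int n" "-k"] tri_minus[of k] by simp
    moreover have "(1 - int n) * (int n - k) = - 2 * tri (int n) - k + int n * k"
      unfolding mult_minus_left two_tri by (simp add: algebra_simps)
    ultimately have e: "tri (int n - k) + (1 - int n) * (int n - k) = - tri (int n) + tri k" by simp
    have "jacobi_coeff q (int n - k) * z powi (int n - k)
      = (-1) powi (int n - k) * (q powi (tri (int n - k) + (1 - int n) * (int n - k)) * x powi (k - int n))"
    proof -
      have "z powi (int n - k) = q powi ((1 - int n) * (int n - k)) * x powi (k - int n)"
      proof -
        have "inverse (x powi (int n - k)) = x powi (k - int n)" by (simp flip: power_int_minus)
        moreover have "z powi (int n - k) = (q powi (1 - int n)) powi (int n - k) / x powi (int n - k)"
          unfolding z_def by (rule power_int_divide_distrib)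
        ultimately show ?thesis by (simp add: power_int_mult divide_inverse)
      qed
      then show ?thesis using q by (simp add: jacobi_coeff_def power_int_add)
    qed
    also have "\<dots> = jacobi_coeff (inverse q) (int n) * x powi (- int n) * (jacobi_coeff q k * x powi k)"
    proof -
      have "(-1::complex) powi (int n - k) = (-1) powi int n * (-1) powi k"
        by (simp add: power_int_diff)  (metis divide_inverse inverse_minus_eq inverse_1 power_int_inverse)
      then show ?thesis unfolding e using q x
        by (simp add: jacobi_coeff_def power_int_add power_int_diff power_int_minus power_int_inverse divide_inverse)
    qed
    finally show "jacobi_coeff q (int n - k) * z powi (int n - k) * gauss (n + m) (nat (int n - k)) q
      = jacobi_coeff (inverse q) (int n) * x powi (- int n) * (jacobi_coeff q k * x powi k * gauss (n + m) (nat (int n - k)) q)"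
      by (simp add: mult_ac)
  qed
  finally have 1: "qpoch z q (n + m) = jacobi_coeff (inverse q) (int n) * x powi (- int n) * jacobi_sum q (\<lambda>k. x powi k) n m" .
  have "z * q ^ n = q / x" using q x
    by (simp add: z_def power_int_diff)
  then have "qpoch z q (n + m) = jacobi_coeff (inverse q) (int n) * x powi (- int n) * (qpoch x q n * qpoch (q / x) q m)"
    unfolding qpoch_add using qpoch_reverse[OF q x, of n, folded z_def] by (simp add: mult.assoc)
  moreover have "jacobi_coeff (inverse q) (int n) * x powi (- int n) \<noteq> 0"
    using q x by (simp add: jacobi_coeff_def)
  ultimately show ?thesis using 1 by (metis mult_left_cancel)
qed

text \<open>Termwise from palindromy, as (m + k)(n - k) + k(k-1)/2 = n m + (n - m - 1) k - k(k-1)/2.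
  Inverting q thus costs a power of q and a linear twist of the weight; n - m - 1 will be -1, -2 or
  0.\<close>

lemma jacobi_sum_inverse:
  assumes q: "q \<noteq> 0"
  shows "jacobi_sum q w n m = q ^ (n * m) * jacobi_sum (inverse q) (\<lambda>k. w k * q powi ((int n - int m - 1) * k)) n m"
  unfolding jacobi_sum_def sum_distrib_left
proof (rule sum.cong[OF refl])
  fix k assume k: "k \<in> {- int m..int n}"
  have "gauss (nat (int m + k) + nat (int n - k)) (nat (int n - k)) q = q ^ (nat (int m + k) * nat (int n - k))
      * gauss (nat (int m + k) + nat (int n - k)) (nat (int n - k)) (inverse q)"
    by (rule gauss_inverse[OF q])
  moreover have "nat (int m + k) + nat (int n - k) = n + m" using k by auto
  ultimately have g: "gauss (n + m) (nat (int n - k)) q = q powi ((int m + k) * (int n - k)) * gauss (n + m) (nat (int n - k)) (inverse q)"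
    using k by (simp flip: power_int_of_nat)
  have "(int m + k) * (int n - k) + tri k = int (n * m) + (int n - int m - 1) * k - tri k"
    using two_tri[of k] by (simp add: algebra_simps)
  then have "q powi ((int m + k) * (int n - k) + tri k) = q powi (int (n * m) + (int n - int m - 1) * k - tri k)"
    by (rule arg_cong)
  then have "q powi ((int m + k) * (int n - k)) * q powi tri k = q ^ (n * m) * q powi ((int n - int m - 1) * k) * inverse q powi tri k"
    using q by (simp only: power_int_add power_int_diff power_int_of_nat power_int_inverse divide_inverse simp_thms)
  then show "jacobi_coeff q k * w k * gauss (n + m) (nat (int n - k)) q =
      q ^ (n * m) * (jacobi_coeff (inverse q) k * (w k * q powi ((int n - int m - 1) * k)) * gauss (n + m) (nat (int n - k)) (inverse q))"
    unfolding g jacobi_coeff_def by (simp add: mult_ac)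
qed

section \<open>Bailey pairs\<close>

text \<open>The convention \<open>1 / (q)\<^sub>z = 0\<close> for \<open>z < 0\<close> keeps the recurrence \<open>recip_qpoch_rec\<close> valid for all
  integers; the kernel is the one of Bailey pairs relative to \<open>a = q ^ s\<close>.\<close>

definition recip_qpoch :: "complex \<Rightarrow> int \<Rightarrow> complex" where
  "recip_qpoch q z = (if z < 0 then 0 else inverse (qpoch q q (nat z)))"

definition bailey_kernel :: "complex \<Rightarrow> int \<Rightarrow> nat \<Rightarrow> int \<Rightarrow> complex" where
  "bailey_kernel q s n k = recip_qpoch q (int n - k) * recip_qpoch q (int n + k + s)"

lemma recip_qpoch_neg [simp]: "z < 0 \<Longrightarrow> recip_qpoch q z = 0"
  by (simp add: recip_qpoch_def)

lemma bailey_kernel_eq_0: "k \<notin> {- int n - s..int n} \<Longrightarrow> bailey_kernel q s n k = 0"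
  by (auto simp: bailey_kernel_def)

lemma bailey_kernel_reflect: "bailey_kernel q s n (- s - k) = bailey_kernel q s n k"
  by (simp add: bailey_kernel_def algebra_simps)

lemma sum_reflect:
  fixes f :: "int \<Rightarrow> 'a::comm_monoid_add"
  shows "(\<Sum>k\<in>{- n - s..n}. f (- s - k)) = (\<Sum>k\<in>{- n - s..n}. f k)"
  by (rule sum.reindex_bij_witness[of _ "\<lambda>k. - s - k" "\<lambda>k. - s - k"]) auto

text \<open>The alpha-side of the unit Bailey pair after \<open>p\<close> steps of the Bailey chain,
  unfolded over all integers: the usual alpha_n is, up to normalisation, the sum of the terms at k =
  n and k = - s - n.\<close>

definition bailey_coeff :: "complex \<Rightarrow> int \<Rightarrow> nat \<Rightarrow> int \<Rightarrow> complex" where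
  "bailey_coeff q s p k = jacobi_coeff q k * q powi (int p * (k\<^sup>2 + s * k))"

lemma bailey_coeff_reflect_0: "q \<noteq> 0 \<Longrightarrow> bailey_coeff q 0 p (- k) = q powi k * bailey_coeff q 0 p k"
  by (simp add: bailey_coeff_def jacobi_coeff_def tri_minus power_int_add power_int_minus_left mult_ac)

lemma bailey_coeff_reflect_1:
  assumes "q \<noteq> 0"
  shows "bailey_coeff q 1 p (- 1 - k) = - (q powi (2 * k + 1) * bailey_coeff q 1 p k)"
proof -
  have "tri (- 1 - k) = tri k + (2 * k + 1)"
    using two_tri[of "- 1 - k"] two_tri[of k] by (simp add: algebra_simps)
  moreover have "int p * ((-1 - k)\<^sup>2 + 1 * (-1 - k)) = int p * (k\<^sup>2 + 1 * k)"
    by (simp add: power2_eq_square algebra_simps)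
  moreover have "(-1::complex) powi (-1 - k) = - ((-1) powi k)"
    by (simp add: power_int_diff power_int_minus_left divide_inverse)
  ultimately show ?thesis using assms
    unfolding bailey_coeff_def jacobi_coeff_def by (simp only: power_int_add simp_thms) (simp add: mult_ac)
qed

locale generic_q =
  fixes q :: complex
  assumes q_nonzero: "q \<noteq> 0" and q_not_root: "\<And>k::nat. k > 0 \<Longrightarrow> q ^ k \<noteq> 1"
begin

lemma qpoch_nonzero: "qpoch q q n \<noteq> 0"
proof (induction n)
  case (Suc n)
  then show ?case using q_not_root[of "Suc n"] by (simp add: qpoch_Suc)
qed simp

lemma recip_qpoch_rec: "(1 - q powi z) * recip_qpoch q z = recip_qpoch q (z - 1)"
proof (cases "z \<le> 0")
  case True
  then show ?thesis by (cases "z = 0") auto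
next
  case False
  then obtain n where z: "z = int (Suc n)" using zero_less_imp_eq_int[of z] by (metis not_le gr0_implies_Suc of_nat_0_less_iff)
  have "nat (int (Suc n)) = Suc n" "nat (int (Suc n) - 1) = n" by auto
  then show ?thesis unfolding z using q_not_root[of "Suc n"]
    by (simp add: recip_qpoch_def qpoch_Suc power_int_of_nat del: of_nat_Suc)
qed

lemma gauss_recip:
  assumes "j \<le> n"
  shows "gauss n j q = qpoch q q n * recip_qpoch q (int n - int j) * recip_qpoch q (int j)"
proof -
  have "nat (int n - int j) = n - j" by auto
  then show ?thesis
    using gauss_qpoch[of "n - j" j q] assms qpoch_nonzero[of j] qpoch_nonzero[of "n - j"]
    by (simp add: recip_qpoch_def field_simps)
qed

text \<open>A limiting case of the q-Vandermonde sum, with \<open>c\<close> of either sign. In the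
  induction on m the recurrence for 1 / (q)_z writes f c j q^j as f (c+1) j - f c (j+1); the second
  part cancels against the other half of the Pascal rule, and c moves up by one.\<close>

lemma recip_qpoch_sum:
  "(\<Sum>j\<le>m. q powi (int j * (int j + c)) * gauss m j q * recip_qpoch q (int j + c)) = recip_qpoch q (int m + c)"
proof (induction m arbitrary: c)
  case (Suc m)
  define f where "f = (\<lambda>c j. q powi (int j * (int j + c)) * recip_qpoch q (int j + c))"
  have f: "f c j * q ^ j = f (c + 1) j - f c (Suc j)" for j
  proof -
    have "f c j * q ^ j = q powi (int j * (int j + c)) * q powi int j * ((1 - q powi (int j + c + 1)) * recip_qpoch q (int j + c + 1))"
      using recip_qpoch_rec[of "int j + c + 1"] by (simp add: f_def mult_ac)
    also have "\<dots> = q powi (int j * (int j + c) + int j) * recip_qpoch q (int j + c + 1)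
        - q powi (int j * (int j + c) + int j + (int j + c + 1)) * recip_qpoch q (int j + c + 1)"
      using q_nonzero by (simp only: power_int_add simp_thms) (simp add: algebra_simps)
    also have "\<dots> = f (c + 1) j - f c (Suc j)"
      by (simp add: f_def algebra_simps)
    finally show ?thesis .
  qed
  have "(\<Sum>j\<le>Suc m. f c j * gauss (Suc m) j q) = f c 0 + (\<Sum>j\<le>m. f c (Suc j) * (gauss m j q + q ^ Suc j * gauss m (Suc j) q))"
    by (subst sum.atMost_Suc_shift) (simp add: gauss_Suc_Suc)
  also have "\<dots> = (\<Sum>j\<le>m. f c (Suc j) * gauss m j q) + (f c 0 + (\<Sum>j\<le>m. f c (Suc j) * q ^ Suc j * gauss m (Suc j) q))"
    by (simp add: distrib_left sum.distrib mult.assoc)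
  also have "f c 0 + (\<Sum>j\<le>m. f c (Suc j) * q ^ Suc j * gauss m (Suc j) q) = (\<Sum>j\<le>Suc m. f c j * q ^ j * gauss m j q)"
    by (subst sum.atMost_Suc_shift) simp
  also have "\<dots> = (\<Sum>j\<le>m. (f (c + 1) j - f c (Suc j)) * gauss m j q)"
    by (simp add: gauss_eq_0 f)
  finally have "(\<Sum>j\<le>Suc m. f c j * gauss (Suc m) j q) = (\<Sum>j\<le>m. f (c + 1) j * gauss m j q)"
    by (simp add: sum_subtractf left_diff_distrib)
  then show ?case using Suc.IH[of "c + 1"] by (simp add: f_def mult_ac add_ac)
qed simp

text \<open>Bailey's lemma with both free parameters sent to infinity, for one column k of the
  kernel. With r = k + j it is \<open>recip_qpoch_sum\<close> at c = 2k + s.\<close>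

lemma bailey_step_kernel:
  assumes s: "s \<in> {0, 1}"
  shows "(\<Sum>r\<le>n. q ^ (r\<^sup>2 + nat s * r) * recip_qpoch q (int n - int r) * bailey_kernel q s r k)
    = q powi (k\<^sup>2 + s * k) * bailey_kernel q s n k"
proof (cases "k \<le> int n")
  case False
  then show ?thesis by (auto simp: bailey_kernel_def intro!: sum.neutral)
next
  case True
  define F where "F = (\<lambda>r::int. q powi (r\<^sup>2 + s * r) * recip_qpoch q (int n - r) * (recip_qpoch q (r - k) * recip_qpoch q (r + k + s)))"
  have regroup: "a * b * c * (d * e) = a * (c * d) * (b * e)" for a b c d e :: complex
    by (simp add: mult_ac)
  define m where "m = nat (int n - k)"
  have m: "int m = int n - k" using True by (simp add: m_def)
  have "(\<Sum>r\<le>n. q ^ (r\<^sup>2 + nat s * r) * recip_qpoch q (int n - int r) * bailey_kernel q s r k) = (\<Sum>r\<le>n. F (int r))"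
    using s by (intro sum.cong) (auto simp: F_def bailey_kernel_def simp flip: power_int_of_nat)
  also have "\<dots> = (\<Sum>r\<in>{0..int n}. F r)"
    by (rule sum.reindex_bij_witness[of _ nat int]) auto
  also have "\<dots> = (\<Sum>r\<in>{max 0 k..int n}. F r)"
    by (rule sum.mono_neutral_right) (auto simp: F_def)
  \<comment> \<open>For k < 0 the added r are negative, so r + k + s < 0 and the convention for 1 /
    (q)_z makes their terms 0.\<close>
  also have "\<dots> = (\<Sum>r\<in>{k..int n}. F r)"
    using s by (intro sum.mono_neutral_left) (auto simp: F_def)
  also have "\<dots> = (\<Sum>j\<le>m. F (k + int j))"
    by (rule sum.reindex_bij_witness[of _ "\<lambda>j. k + int j" "\<lambda>r. nat (r - k)"]) (use m in auto)
  also have "\<dots> = (\<Sum>j\<le>m. q powi (k\<^sup>2 + s * k) * recip_qpoch q (int m) *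
     (q powi (int j * (int j + (2 * k + s))) * gauss m j q * recip_qpoch q (int j + (2 * k + s))))"
  proof (rule sum.cong[OF refl])
    fix j assume "j \<in> {..m}"
    then have j: "j \<le> m" by simp
    have "(k + int j)\<^sup>2 + s * (k + int j) = (k\<^sup>2 + s * k) + int j * (int j + (2 * k + s))"
      by (simp add: power2_eq_square algebra_simps)
    then have "q powi ((k + int j)\<^sup>2 + s * (k + int j)) = q powi (k\<^sup>2 + s * k) * q powi (int j * (int j + (2 * k + s)))"
      using q_nonzero by (simp only: power_int_add simp_thms)
    moreover have "recip_qpoch q (int m - int j) * recip_qpoch q (int j) = recip_qpoch q (int m) * gauss m j q"
      using gauss_recip[OF j] qpoch_nonzero[of m] by (simp add: recip_qpoch_def)
    moreover have "int n - (k + int j) = int m - int j" "k + int j + k + s = int j + (2 * k + s)" "k + int j - k = int j"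
      using m by auto
    ultimately show "F (k + int j) = q powi (k\<^sup>2 + s * k) * recip_qpoch q (int m) *
     (q powi (int j * (int j + (2 * k + s))) * gauss m j q * recip_qpoch q (int j + (2 * k + s)))"
      unfolding F_def by (simp only: regroup) (simp only: mult_ac)
  qed
  also have "\<dots> = q powi (k\<^sup>2 + s * k) * recip_qpoch q (int m) * recip_qpoch q (int m + (2 * k + s))"
    by (simp only: sum_distrib_left[symmetric] recip_qpoch_sum)
  also have "\<dots> = q powi (k\<^sup>2 + s * k) * bailey_kernel q s n k"
    by (simp add: bailey_kernel_def m algebra_simps)
  finally show ?thesis .
qed

lemma bailey_step:
  assumes s: "s \<in> {0, 1}"
    and \<beta>: "\<And>r. r \<le> n \<Longrightarrow> \<beta> r = (\<Sum>k\<in>{- int r - s..int r}. \<alpha> k * bailey_kernel q s r k)"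
  shows "(\<Sum>r\<le>n. q ^ (r\<^sup>2 + nat s * r) * recip_qpoch q (int n - int r) * \<beta> r)
    = (\<Sum>k\<in>{- int n - s..int n}. \<alpha> k * q powi (k\<^sup>2 + s * k) * bailey_kernel q s n k)"
proof -
  define A where "A = {- int n - s..int n}"
  have "\<beta> r = (\<Sum>k\<in>A. \<alpha> k * bailey_kernel q s r k)" if "r \<le> n" for r
    unfolding \<beta>[OF that] A_def using that s
    by (intro sum.mono_neutral_left) (auto simp: bailey_kernel_eq_0)
  then have "(\<Sum>r\<le>n. q ^ (r\<^sup>2 + nat s * r) * recip_qpoch q (int n - int r) * \<beta> r)
    = (\<Sum>r\<le>n. \<Sum>k\<in>A. \<alpha> k * (q ^ (r\<^sup>2 + nat s * r) * recip_qpoch q (int n - int r) * bailey_kernel q s r k))"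
    by (intro sum.cong) (auto simp: sum_distrib_left sum_distrib_right mult_ac)
  also have "\<dots> = (\<Sum>k\<in>A. \<Sum>r\<le>n. \<alpha> k * (q ^ (r\<^sup>2 + nat s * r) * recip_qpoch q (int n - int r) * bailey_kernel q s r k))"
    by (rule sum.swap)
  also have "\<dots> = (\<Sum>k\<in>A. \<alpha> k * (q powi (k\<^sup>2 + s * k) * bailey_kernel q s n k))"
    by (simp only: sum_distrib_left[symmetric] bailey_step_kernel[OF s])
  finally show ?thesis by (simp add: A_def mult_ac)
qed

lemma gauss_eq_bailey_kernel:
  assumes "s \<ge> 0" and "k \<in> {- int n - s..int n}"
  shows "gauss (2 * n + nat s) (nat (int n - k)) q = qpoch q q (2 * n + nat s) * bailey_kernel q s n k"
proof -
  have "int (2 * n + nat s) - int (nat (int n - k)) = int n + k + s" "int (nat (int n - k)) = int n - k"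
    "nat (int n - k) \<le> 2 * n + nat s" using assms by auto
  then show ?thesis by (simp only: gauss_recip bailey_kernel_def mult_ac)
qed

text \<open>The finite triple product at x = 1, where (1)_n = 0 for n > 0.\<close>

lemma unit_bailey_pair:
  assumes s: "s \<in> {0, 1}"
  shows "(\<Sum>k\<in>{- int n - s..int n}. jacobi_coeff q k * bailey_kernel q s n k) = (if n = 0 then 1 else 0)"
proof -
  have "qpoch q q (2 * n + nat s) * (\<Sum>k\<in>{- int n - s..int n}. jacobi_coeff q k * bailey_kernel q s n k)
     = jacobi_sum q (\<lambda>k. 1 powi k) n (n + nat s)"
    unfolding jacobi_sum_def sum_distrib_left
  proof (rule sum.cong)
    fix k assume k: "k \<in> {- int (n + nat s)..int n}"
    have e: "n + (n + nat s) = 2 * n + nat s" by simp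
    show "qpoch q q (2 * n + nat s) * (jacobi_coeff q k * bailey_kernel q s n k) =
        jacobi_coeff q k * 1 powi k * gauss (n + (n + nat s)) (nat (int n - k)) q"
      unfolding e using gauss_eq_bailey_kernel[of s k n] s k by auto
  qed (use s in auto)
  also have "\<dots> = qpoch 1 q n * qpoch q q (n + nat s)"
    using finite_jacobi_triple_product[OF q_nonzero, of 1 n "n + nat s"] by simp
  also have "\<dots> = (if n = 0 then qpoch q q (2 * n + nat s) else 0)"
    by (cases n) (auto simp: qpoch_shift)
  finally show ?thesis using qpoch_nonzero[of "2 * n + nat s"] by (auto split: if_splits)
qed

text \<open>Each summation in the chain is one Bailey step, because 1 / (q)_n times the q-binomial
  splits into 1 / (q)_(n-r) and 1 / (q)_r. The empty chain is already one step away from the unit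
  pair, hence \<open>Suc p\<close> on the right.\<close>

lemma chain_inner_bailey:
  assumes s: "s \<in> {0, 1}"
  shows "chain_inner (\<lambda>r. q ^ (r\<^sup>2 + nat s * r)) q p n * recip_qpoch q (int n) =
    (\<Sum>k\<in>{- int n - s..int n}. bailey_coeff q s (Suc p) k * bailey_kernel q s n k)"
proof (induction p arbitrary: n)
  case 0
  have "recip_qpoch q (int n) = (\<Sum>r\<le>n. if r = 0 then recip_qpoch q (int n) else 0)" by simp
  also have "\<dots> = (\<Sum>r\<le>n. q ^ (r\<^sup>2 + nat s * r) * recip_qpoch q (int n - int r) * (if r = 0 then 1 else 0))"
    by (intro sum.cong) auto
  also have "\<dots> = (\<Sum>k\<in>{- int n - s..int n}. jacobi_coeff q k * q powi (k\<^sup>2 + s * k) * bailey_kernel q s n k)"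
    by (rule bailey_step[OF s]) (simp add: unit_bailey_pair[OF s])
  finally show ?case by (simp add: bailey_coeff_def)
next
  case (Suc p)
  have "chain_inner (\<lambda>r. q ^ (r\<^sup>2 + nat s * r)) q (Suc p) n * recip_qpoch q (int n) =
    (\<Sum>r\<le>n. q ^ (r\<^sup>2 + nat s * r) * recip_qpoch q (int n - int r) *
      (chain_inner (\<lambda>r. q ^ (r\<^sup>2 + nat s * r)) q p r * recip_qpoch q (int r)))"
    unfolding chain_inner.simps sum_distrib_right
  proof (rule sum.cong[OF refl])
    fix r assume "r \<in> {..n}"
    then have "gauss n r q * recip_qpoch q (int n) = recip_qpoch q (int n - int r) * recip_qpoch q (int r)"
      using gauss_recip[of r n] qpoch_nonzero[of n] by (simp add: recip_qpoch_def)
    then show "q ^ (r\<^sup>2 + nat s * r) * gauss n r q * chain_inner (\<lambda>r. q ^ (r\<^sup>2 + nat s * r)) q p r * recip_qpoch q (int n)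
      = q ^ (r\<^sup>2 + nat s * r) * recip_qpoch q (int n - int r) *
      (chain_inner (\<lambda>r. q ^ (r\<^sup>2 + nat s * r)) q p r * recip_qpoch q (int r))"
      by (simp add: mult_ac)
  qed
  also have "\<dots> = (\<Sum>k\<in>{- int n - s..int n}. bailey_coeff q s (Suc p) k * q powi (k\<^sup>2 + s * k) * bailey_kernel q s n k)"
    by (rule bailey_step[OF s Suc.IH])
  also have "\<dots> = (\<Sum>k\<in>{- int n - s..int n}. bailey_coeff q s (Suc (Suc p)) k * bailey_kernel q s n k)"
  proof -
    have "bailey_coeff q s (Suc (Suc p)) k = bailey_coeff q s (Suc p) k * q powi (k\<^sup>2 + s * k)" for k
    proof -
      have "int (Suc (Suc p)) * (k\<^sup>2 + s * k) = int (Suc p) * (k\<^sup>2 + s * k) + (k\<^sup>2 + s * k)"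
        by (simp add: algebra_simps)
      then show ?thesis using q_nonzero unfolding bailey_coeff_def by (simp only: power_int_add simp_thms mult.assoc)
    qed
    then show ?thesis by simp
  qed
  finally show ?case .
qed

end

section \<open>Bailey sums as functionals on (x)_n (q/x)_m\<close>

context generic_q
begin

lemma jacobi_sum_recip:
  "jacobi_sum q w n m = qpoch q q (n + m) *
    (\<Sum>k\<in>{- int m..int n}. jacobi_coeff q k * w k * (recip_qpoch q (int n - k) * recip_qpoch q (int m + k)))"
  unfolding jacobi_sum_def sum_distrib_left
proof (rule sum.cong[OF refl])
  fix k assume k: "k \<in> {- int m..int n}"
  have "int (n + m) - int (nat (int n - k)) = int m + k" "int (nat (int n - k)) = int n - k"
    "nat (int n - k) \<le> n + m" using k by auto
  then have "gauss (n + m) (nat (int n - k)) q = qpoch q q (n + m) * recip_qpoch q (int m + k) * recip_qpoch q (int n - k)"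
    by (simp only: gauss_recip)
  then show "jacobi_coeff q k * w k * gauss (n + m) (nat (int n - k)) q = qpoch q q (n + m) *
      (jacobi_coeff q k * w k * (recip_qpoch q (int n - k) * recip_qpoch q (int m + k)))"
    by (simp only: mult_ac)
qed

lemma qpoch_split: "qpoch q q (n + m) = qpoch q q n * qpoch (q ^ (n + 1)) q m"
  by (simp add: qpoch_add)

lemma qpoch_recip: "qpoch q q n * recip_qpoch q (int n) = 1"
  using qpoch_nonzero[of n] by (simp add: recip_qpoch_def)

lemma odd_sum_eq_0:
  fixes g :: "int \<Rightarrow> complex"
  assumes "\<And>k. g (- s - k) = - g k"
  shows "(\<Sum>k\<in>{- n - s..n}. g k) = 0"
  using sum_reflect[of g s n] assms by (simp add: sum_negf)

text \<open>The prefactor completes (q)_n to (q)_(2n), the normalisation of the symmetric triple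
  product, and the kernel for s = 0 already has its shape.\<close>

lemma chain_jacobi_even:
  "qpoch (q ^ (n + 1)) q n * chain_inner (\<lambda>r. q ^ (r\<^sup>2)) q p n =
    jacobi_sum q (\<lambda>k. q powi (int (Suc p) * k\<^sup>2)) n n"
proof -
  have "jacobi_sum q (\<lambda>k. q powi (int (Suc p) * k\<^sup>2)) n n = qpoch q q (n + n) *
      (\<Sum>k\<in>{- int n - 0..int n}. bailey_coeff q 0 (Suc p) k * bailey_kernel q 0 n k)"
    by (simp add: jacobi_sum_recip bailey_coeff_def bailey_kernel_def)
  also have "\<dots> = qpoch q q n * qpoch (q ^ (n + 1)) q n * (chain_inner (\<lambda>r. q ^ (r\<^sup>2)) q p n * recip_qpoch q (int n))"
    using chain_inner_bailey[of 0 p n] by (simp add: qpoch_split)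
  also have "\<dots> = (qpoch q q n * recip_qpoch q (int n)) * (qpoch (q ^ (n + 1)) q n * chain_inner (\<lambda>r. q ^ (r\<^sup>2)) q p n)"
    by (simp only: mult_ac)
  finally show ?thesis by (simp add: qpoch_recip)
qed

text \<open>Lowering m by one inserts the factor 1 - q^(N+k) = (1 - q^N) - q^N (q^k - 1) with N = n
  + 1. The last part is odd under k -> -k against the coefficients and drops out. Starting at
  \<open>Suc n\<close> keeps m = N - 1 a natural number.\<close>

lemma chain_jacobi_even_pred:
  "qpoch (q ^ Suc n) q (Suc n) * chain_inner (\<lambda>r. q ^ (r\<^sup>2)) q p (Suc n) =
    jacobi_sum q (\<lambda>k. q powi (int (Suc p) * k\<^sup>2)) (Suc n) n"
proof -
  define N where "N = Suc n"
  define S where "S = (\<Sum>k\<in>{- int N - 0..int N}. bailey_coeff q 0 (Suc p) k * bailey_kernel q 0 N k)"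
  define g where "g = (\<lambda>k. bailey_coeff q 0 (Suc p) k * bailey_kernel q 0 N k * (q powi k - 1))"
  have odd: "(\<Sum>k\<in>{- int N - 0..int N}. g k) = 0"
  proof (rule odd_sum_eq_0)
    fix k
    have "bailey_kernel q 0 N (- k) = bailey_kernel q 0 N k" using bailey_kernel_reflect[of q 0 N k] by simp
    moreover have "q powi k * (q powi (- k) - 1) = - (q powi k - 1)"
      using q_nonzero by (simp add: power_int_minus algebra_simps)
    moreover have "x * b * c * d = b * c * (x * d)" for x b c d :: complex by simp
    ultimately have "g (- 0 - k) = bailey_coeff q 0 (Suc p) k * bailey_kernel q 0 N k * - (q powi k - 1)"
      using q_nonzero by (simp only: g_def minus_zero diff_0 bailey_coeff_reflect_0[OF q_nonzero])
    then show "g (- 0 - k) = - g k" by (simp only: g_def mult_minus_right)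
  qed
  have "jacobi_sum q (\<lambda>k. q powi (int (Suc p) * k\<^sup>2)) N n = qpoch q q (n + N) *
      (\<Sum>k\<in>{- int n..int N}. bailey_coeff q 0 (Suc p) k * bailey_kernel q 0 N k * (1 - q powi (int N + k)))"
  proof -
    have "recip_qpoch q (int n + k) = recip_qpoch q (int N + k) * (1 - q powi (int N + k))" for k
      using recip_qpoch_rec[of "int N + k"] by (simp add: N_def algebra_simps)
    then show ?thesis
      by (simp add: jacobi_sum_recip bailey_coeff_def bailey_kernel_def mult_ac add.commute[of N n])
  qed
  also have "(\<Sum>k\<in>{- int n..int N}. bailey_coeff q 0 (Suc p) k * bailey_kernel q 0 N k * (1 - q powi (int N + k))) =
      (\<Sum>k\<in>{- int N - 0..int N}. bailey_coeff q 0 (Suc p) k * bailey_kernel q 0 N k * (1 - q powi (int N + k)))"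
  proof (rule sum.mono_neutral_left)
    show "\<forall>k\<in>{- int N - 0..int N} - {- int n..int N}.
        bailey_coeff q 0 (Suc p) k * bailey_kernel q 0 N k * (1 - q powi (int N + k)) = 0"
    proof
      fix k assume "k \<in> {- int N - 0..int N} - {- int n..int N}"
      then have "int N + k = 0" by (auto simp: N_def)
      then show "bailey_coeff q 0 (Suc p) k * bailey_kernel q 0 N k * (1 - q powi (int N + k)) = 0" by simp
    qed
  qed (auto simp: N_def)
  also have "\<dots> = (\<Sum>k\<in>{- int N - 0..int N}. (1 - q ^ N) * (bailey_coeff q 0 (Suc p) k * bailey_kernel q 0 N k) - q ^ N * g k)"
  proof (rule sum.cong[OF refl])
    fix k
    have "q powi (int N + k) = q ^ N * q powi k" using q_nonzero by (simp add: power_int_add)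
    then show "bailey_coeff q 0 (Suc p) k * bailey_kernel q 0 N k * (1 - q powi (int N + k)) =
        (1 - q ^ N) * (bailey_coeff q 0 (Suc p) k * bailey_kernel q 0 N k) - q ^ N * g k"
      unfolding g_def by (simp add: algebra_simps)
  qed
  also have "\<dots> = (1 - q ^ N) * S"
    using odd unfolding S_def sum_subtractf sum_distrib_left[symmetric] by simp
  also have "S = chain_inner (\<lambda>r. q ^ (r\<^sup>2)) q p N * recip_qpoch q (int N)"
    using chain_inner_bailey[of 0 p N] by (simp add: S_def)
  finally have "jacobi_sum q (\<lambda>k. q powi (int (Suc p) * k\<^sup>2)) N n =
      qpoch q q (n + N) * ((1 - q ^ N) * (chain_inner (\<lambda>r. q ^ (r\<^sup>2)) q p N * recip_qpoch q (int N)))" .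
  also have "\<dots> = (qpoch q q n * (1 - q ^ N) * recip_qpoch q (int N)) * (qpoch (q ^ N) q N * chain_inner (\<lambda>r. q ^ (r\<^sup>2)) q p N)"
    using qpoch_split[of n N] by (simp add: N_def mult_ac)
  also have "qpoch q q n * (1 - q ^ N) = qpoch q q N" by (simp add: N_def qpoch_Suc)
  finally show ?thesis unfolding qpoch_recip by (simp add: N_def)
qed

lemma chain_jacobi_odd:
  "qpoch (q ^ (n + 1)) q (n + 1) * chain_inner (\<lambda>r. q ^ (r * (r + 1))) q p n =
    jacobi_sum q (\<lambda>k. q powi (int (Suc p) * (k\<^sup>2 + k))) n (n + 1)"
proof -
  have ch: "chain_inner (\<lambda>r. q ^ (r * (r + 1))) q p n * recip_qpoch q (int n) =
    (\<Sum>k\<in>{- int n - 1..int n}. bailey_coeff q 1 (Suc p) k * bailey_kernel q 1 n k)"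
    using chain_inner_bailey[of 1 p n] by (simp add: power2_eq_square algebra_simps)
  have "jacobi_sum q (\<lambda>k. q powi (int (Suc p) * (k\<^sup>2 + k))) n (n + 1) = qpoch q q (n + (n + 1)) *
      (\<Sum>k\<in>{- int n - 1..int n}. bailey_coeff q 1 (Suc p) k * bailey_kernel q 1 n k)"
    unfolding jacobi_sum_recip by (intro arg_cong2[of _ _ _ _ "(*)"] sum.cong) (auto simp: bailey_coeff_def bailey_kernel_def add_ac)
  also have "\<dots> = qpoch q q n * qpoch (q ^ (n + 1)) q (n + 1) * (chain_inner (\<lambda>r. q ^ (r * (r + 1))) q p n * recip_qpoch q (int n))"
    unfolding ch qpoch_split ..
  also have "\<dots> = (qpoch q q n * recip_qpoch q (int n)) * (qpoch (q ^ (n + 1)) q (n + 1) * chain_inner (\<lambda>r. q ^ (r * (r + 1))) q p n)"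
    by (simp only: mult_ac)
  finally show ?thesis by (simp add: qpoch_recip)
qed

lemma jacobi_sum_diag:
  "jacobi_sum q w n n = qpoch q q (n + n) *
    (\<Sum>k\<in>{- int n - 1..int n}. jacobi_coeff q k * w k * bailey_kernel q 1 n k * (1 - q powi (int n + k + 1)))"
proof -
  have "recip_qpoch q (int n + k) = recip_qpoch q (int n + k + 1) * (1 - q powi (int n + k + 1))" for k
    using recip_qpoch_rec[of "int n + k + 1"] by (simp add: mult.commute)
  then have "jacobi_sum q w n n = qpoch q q (n + n) *
    (\<Sum>k\<in>{- int n..int n}. jacobi_coeff q k * w k * bailey_kernel q 1 n k * (1 - q powi (int n + k + 1)))"
    by (simp add: jacobi_sum_recip bailey_kernel_def mult_ac)
  also have "(\<Sum>k\<in>{- int n..int n}. jacobi_coeff q k * w k * bailey_kernel q 1 n k * (1 - q powi (int n + k + 1))) =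
    (\<Sum>k\<in>{- int n - 1..int n}. jacobi_coeff q k * w k * bailey_kernel q 1 n k * (1 - q powi (int n + k + 1)))"
  proof (rule sum.mono_neutral_left)
    show "\<forall>k\<in>{- int n - 1..int n} - {- int n..int n}.
        jacobi_coeff q k * w k * bailey_kernel q 1 n k * (1 - q powi (int n + k + 1)) = 0"
    proof
      fix k assume "k \<in> {- int n - 1..int n} - {- int n..int n}"
      then have "int n + k + 1 = 0" by auto
      then show "jacobi_coeff q k * w k * bailey_kernel q 1 n k * (1 - q powi (int n + k + 1)) = 0" by simp
    qed
  qed auto
  finally show ?thesis .
qed

text \<open>A pair relative to q is measured here against the symmetric range (n, n), which inserts
  1 - q^(n+k+1). Under k -> -1-k the sequence q^k b_k is odd, so its sum vanishes: with the plain
  weight this removes the inserted part, and with the extra q^k it removes the main part, while the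
  inserted one reflects to q^n times the original sum.\<close>

lemma chain_jacobi_mixed:
  defines "C \<equiv> chain_inner (\<lambda>r. q ^ (r * (r + 1))) q"
  shows "qpoch (q ^ (n + 1)) q n * C p n = jacobi_sum q (\<lambda>k. q powi (int (Suc p) * (k\<^sup>2 + k))) n n" (is ?A)
    and "q ^ n * (qpoch (q ^ (n + 1)) q n * C p n) =
      jacobi_sum q (\<lambda>k. q powi (int (Suc p) * (k\<^sup>2 + k) + k)) n n" (is ?B)
proof -
  define I where "I = {- int n - 1..int n}"
  define b where "b = (\<lambda>k. bailey_coeff q 1 (Suc p) k * bailey_kernel q 1 n k)"
  have b: "b (- 1 - k) = - (q powi (2 * k + 1) * b k)" for k
    using bailey_kernel_reflect[of q 1 n k] bailey_coeff_reflect_1[OF q_nonzero, of "Suc p" k] by (simp add: b_def)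
  have ch: "C p n * recip_qpoch q (int n) = (\<Sum>k\<in>I. b k)"
    using chain_inner_bailey[of 1 p n] by (simp add: power2_eq_square algebra_simps C_def b_def I_def)
  have fin: "qpoch q q (n + n) * (C p n * recip_qpoch q (int n)) = qpoch (q ^ (n + 1)) q n * C p n"
  proof -
    have "qpoch q q (n + n) * (C p n * recip_qpoch q (int n)) =
        (qpoch q q n * recip_qpoch q (int n)) * (qpoch (q ^ (n + 1)) q n * C p n)"
      unfolding qpoch_split by (simp only: mult_ac)
    then show ?thesis by (simp add: qpoch_recip)
  qed
  have odd: "(\<Sum>k\<in>I. q powi k * b k) = 0"
    unfolding I_def
  proof (rule odd_sum_eq_0)
    fix k
    have "q powi (- 1 - k) * q powi (2 * k + 1) = q powi k"
      using q_nonzero by (simp flip: power_int_add)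
    then show "q powi (- 1 - k) * b (- 1 - k) = - (q powi k * b k)" unfolding b by (simp flip: mult.assoc)
  qed
  have "jacobi_sum q (\<lambda>k. q powi (int (Suc p) * (k\<^sup>2 + k))) n n = qpoch q q (n + n) *
     (\<Sum>k\<in>I. b k - q ^ (n + 1) * (q powi k * b k))"
    unfolding jacobi_sum_diag I_def[symmetric]
  proof (intro arg_cong2[of _ _ _ _ "(*)"] sum.cong refl)
    fix k
    have "q powi (int n + k + 1) = q ^ (n + 1) * q powi k"
      using q_nonzero by (simp add: power_int_add)
    then show "jacobi_coeff q k * q powi (int (Suc p) * (k\<^sup>2 + k)) * bailey_kernel q 1 n k * (1 - q powi (int n + k + 1))
      = b k - q ^ (n + 1) * (q powi k * b k)"
      by (simp add: b_def bailey_coeff_def algebra_simps)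
  qed
  also have "\<dots> = qpoch q q (n + n) * (\<Sum>k\<in>I. b k)"
    using odd unfolding sum_subtractf sum_distrib_left[symmetric] by simp
  finally show ?A unfolding ch[symmetric] fin by simp
  have "jacobi_sum q (\<lambda>k. q powi (int (Suc p) * (k\<^sup>2 + k) + k)) n n = qpoch q q (n + n) *
     (\<Sum>k\<in>I. q powi k * b k + q ^ n * b (- 1 - k))"
    unfolding jacobi_sum_diag I_def[symmetric]
  proof (intro arg_cong2[of _ _ _ _ "(*)"] sum.cong refl)
    fix k
    have "k + (int n + k + 1) = int n + (2 * k + 1)" by simp
    then have "q powi k * q powi (int n + k + 1) = q powi int n * q powi (2 * k + 1)"
      using q_nonzero by (metis power_int_add)
    moreover have "q powi (int (Suc p) * (k\<^sup>2 + k) + k) = q powi (int (Suc p) * (k\<^sup>2 + k)) * q powi k"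
      using q_nonzero by (intro power_int_add) auto
    ultimately show "jacobi_coeff q k * q powi (int (Suc p) * (k\<^sup>2 + k) + k) * bailey_kernel q 1 n k * (1 - q powi (int n + k + 1))
      = q powi k * b k + q ^ n * b (- 1 - k)"
      unfolding b by (simp add: b_def bailey_coeff_def algebra_simps)
  qed
  also have "\<dots> = qpoch q q (n + n) * (q ^ n * (\<Sum>k\<in>I. b k))"
    using odd sum_reflect[of b 1 "int n"] unfolding sum.distrib sum_distrib_left[symmetric] by (simp add: I_def)
  also have "\<dots> = q ^ n * (qpoch (q ^ (n + 1)) q n * C p n)"
    unfolding ch[symmetric] fin[symmetric] by (simp only: mult_ac)
  finally show ?B by simp
qed

end

section \<open>Passage from generic q to the unit circle\<close>

lemma generic_q_unit_disc:
  assumes "q \<noteq> 0" "norm q < 1"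
  shows "generic_q q"
proof
  fix k :: nat assume "k > 0"
  then have "norm (q ^ k) < 1" using assms by (simp add: norm_power power_less_one_iff)
  then show "q ^ k \<noteq> 1" by auto
qed (use assms in auto)

text \<open>The Bailey machinery divides by \<open>qpoch q q n\<close>, so its consequences reach roots of unity by
  continuity only.\<close>

lemma continuous_eq_on_unit_circle:
  fixes f g :: "complex \<Rightarrow> complex"
  assumes "isCont f z" "isCont g z" "norm z = 1"
    and eq: "\<And>q. generic_q q \<Longrightarrow> f q = g q"
  shows "f z = g z"
proof -
  define X where "X = (\<lambda>n::nat. z * of_real (1 - inverse (real (Suc (Suc n)))))"
  have "X \<longlonglongrightarrow> z * of_real (1 - 0)" unfolding X_def
    using LIMSEQ_Suc[OF LIMSEQ_inverse_real_of_nat] by (intro tendsto_intros) auto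
  then have X: "X \<longlonglongrightarrow> z" by simp
  have "generic_q (X n)" for n
  proof (rule generic_q_unit_disc)
    have *: "0 < 1 - inverse (real (Suc (Suc n)))" "1 - inverse (real (Suc (Suc n))) < 1"
      by (simp_all add: field_simps)
    have "norm (X n) = 1 - inverse (real (Suc (Suc n)))"
      using assms(3) * unfolding X_def norm_mult norm_of_real by simp
    with * show "norm (X n) < 1" "X n \<noteq> 0" by auto
  qed
  then have "(\<lambda>n. f (X n)) = (\<lambda>n. g (X n))" using eq by auto
  moreover have "(\<lambda>n. f (X n)) \<longlonglongrightarrow> f z" "(\<lambda>n. g (X n)) \<longlonglongrightarrow> g z"
    using isCont_tendsto_compose[OF assms(1) X] isCont_tendsto_compose[OF assms(2) X] by auto
  ultimately show ?thesis using LIMSEQ_unique by metis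
qed

lemma isCont_gauss: "isCont (\<lambda>q::complex. gauss n k q) z"
proof (induction n arbitrary: k)
  case (Suc n)
  then show ?case by (cases k) (auto simp: gauss.simps(2) intro!: continuous_intros)
next
  case 0
  have "gauss 0 k = (\<lambda>q::complex. if k = 0 then 1 else 0)" by auto
  then show ?case by simp
qed

lemma isCont_qpoch: "isCont (\<lambda>q::complex. qpoch (q ^ a) q n) z"
  unfolding qpoch_def by (intro continuous_intros)

lemma isCont_chain_inner: "isCont (\<lambda>q. chain_inner (\<lambda>r. q ^ e r) q p n) z"
  by (induction p arbitrary: n) (auto intro!: continuous_intros isCont_gauss)

lemma isCont_jacobi_sum: "z \<noteq> 0 \<Longrightarrow> isCont (\<lambda>q. jacobi_sum q (\<lambda>k. q powi e k) n m) z"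
  unfolding jacobi_sum_def jacobi_coeff_def by (intro continuous_intros isCont_gauss) auto

lemmas isCont_chain_jacobi = isCont_qpoch isCont_chain_inner isCont_jacobi_sum

text \<open>The five cases serve the series in pairs: 5 and 9, 2 and 10, 1 and 8, 4 and 7, 3 and 6,
  where the second of each pair goes through inversion of q.\<close>

lemma chain_jacobi_unit_circle:
  assumes "norm q = 1"
  shows "qpoch (q ^ (n + 1)) q n * chain_inner (\<lambda>r. q ^ (r\<^sup>2)) q p n =
      jacobi_sum q (\<lambda>k. q powi (int (Suc p) * k\<^sup>2)) n n"
    and "qpoch (q ^ Suc n) q (Suc n) * chain_inner (\<lambda>r. q ^ (r\<^sup>2)) q p (Suc n) =
      jacobi_sum q (\<lambda>k. q powi (int (Suc p) * k\<^sup>2)) (Suc n) n"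
    and "qpoch (q ^ (n + 1)) q (n + 1) * chain_inner (\<lambda>r. q ^ (r * (r + 1))) q p n =
      jacobi_sum q (\<lambda>k. q powi (int (Suc p) * (k\<^sup>2 + k))) n (n + 1)"
    and "qpoch (q ^ (n + 1)) q n * chain_inner (\<lambda>r. q ^ (r * (r + 1))) q p n =
      jacobi_sum q (\<lambda>k. q powi (int (Suc p) * (k\<^sup>2 + k))) n n"
    and "q ^ n * (qpoch (q ^ (n + 1)) q n * chain_inner (\<lambda>r. q ^ (r * (r + 1))) q p n) =
      jacobi_sum q (\<lambda>k. q powi (int (Suc p) * (k\<^sup>2 + k) + k)) n n"
proof -
  have q: "q \<noteq> 0" using assms by auto
  note * = continuous_eq_on_unit_circle[OF _ _ assms]
  show "qpoch (q ^ (n + 1)) q n * chain_inner (\<lambda>r. q ^ (r\<^sup>2)) q p n =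
      jacobi_sum q (\<lambda>k. q powi (int (Suc p) * k\<^sup>2)) n n"
    by (rule *[OF _ _ generic_q.chain_jacobi_even]) (intro continuous_intros isCont_chain_jacobi q)+
  show "qpoch (q ^ Suc n) q (Suc n) * chain_inner (\<lambda>r. q ^ (r\<^sup>2)) q p (Suc n) =
      jacobi_sum q (\<lambda>k. q powi (int (Suc p) * k\<^sup>2)) (Suc n) n"
    by (rule *[OF _ _ generic_q.chain_jacobi_even_pred]) (intro continuous_intros isCont_chain_jacobi q)+
  show "qpoch (q ^ (n + 1)) q (n + 1) * chain_inner (\<lambda>r. q ^ (r * (r + 1))) q p n =
      jacobi_sum q (\<lambda>k. q powi (int (Suc p) * (k\<^sup>2 + k))) n (n + 1)"
    by (rule *[OF _ _ generic_q.chain_jacobi_odd]) (intro continuous_intros isCont_chain_jacobi q)+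
  show "qpoch (q ^ (n + 1)) q n * chain_inner (\<lambda>r. q ^ (r * (r + 1))) q p n =
      jacobi_sum q (\<lambda>k. q powi (int (Suc p) * (k\<^sup>2 + k))) n n"
    by (rule *[OF _ _ generic_q.chain_jacobi_mixed(1)]) (intro continuous_intros isCont_chain_jacobi q)+
  show "q ^ n * (qpoch (q ^ (n + 1)) q n * chain_inner (\<lambda>r. q ^ (r * (r + 1))) q p n) =
      jacobi_sum q (\<lambda>k. q powi (int (Suc p) * (k\<^sup>2 + k) + k)) n n"
    by (rule *[OF _ _ generic_q.chain_jacobi_mixed(2)]) (intro continuous_intros isCont_chain_jacobi q)+
qed

section \<open>Sums at a primitive root of unity\<close>

definition antiperiodic :: "nat \<Rightarrow> (int \<Rightarrow> complex) \<Rightarrow> bool" where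
  "antiperiodic K e \<longleftrightarrow> (\<forall>m. e (m + int K) = - e m)"

text \<open>For a sequence with \<open>e (m + K) = - e m\<close>, this is the limit of \<open>\<Sum>m. e m * r ^ m\<close> (over \<open>m \<ge> 0\<close>) as \<open>r\<close> tends to
  \<open>1\<close> from below.\<close>

definition abel_sum :: "nat \<Rightarrow> (int \<Rightarrow> complex) \<Rightarrow> complex" where
  "abel_sum K e = (\<Sum>m<K. e (int m)) / 2"

text \<open>Dropping the first term subtracts it, as for a convergent series: the block sum loses e
  0 and gains e K = - e 0, and is then halved.\<close>

lemma abel_sum_shift:
  assumes "antiperiodic K e"
  shows "abel_sum K (\<lambda>m. e (m + 1)) = abel_sum K e - e 0"
proof -
  have "(\<Sum>m<K. e (int m + 1)) + e 0 = (\<Sum>m<Suc K. e (int m))"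
    by (subst sum.lessThan_Suc_shift) (simp add: add.commute)
  also have "\<dots> = (\<Sum>m<K. e (int m)) - e 0"
    using assms unfolding antiperiodic_def by (metis add_0 diff_conv_add_uminus sum.lessThan_Suc)
  finally have "(\<Sum>m<K. e (int m + 1)) = (\<Sum>m<K. e (int m)) - 2 * e 0" by (simp add: algebra_simps)
  then show ?thesis by (simp add: abel_sum_def diff_divide_distrib)
qed

lemma antiperiodic_shift: "antiperiodic K e \<Longrightarrow> antiperiodic K (\<lambda>m. e (m + d))"
  unfolding antiperiodic_def by (metis add.assoc add.commute)

lemma abel_sum_shift_minus:
  assumes "antiperiodic K e"
  shows "abel_sum K (\<lambda>m. e (m - 1)) = abel_sum K e + e (- 1)"
  using abel_sum_shift[OF antiperiodic_shift[OF assms, of "- 1"]] by simp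

lemma abel_sum_cmult: "abel_sum K (\<lambda>m. c * e m) = c * abel_sum K e"
  by (simp add: abel_sum_def sum_distrib_left)

lemma abel_sum_sum: "abel_sum K (\<lambda>m. \<Sum>j\<in>J. e j m) = (\<Sum>j\<in>J. abel_sum K (e j))"
  unfolding abel_sum_def by (subst sum.swap) (simp add: sum_divide_distrib)

text \<open>For m \<ge> 0 these are the power series coefficients of (x + x^2) / (1 + x^3), which
  solves the functional equation of S at q = 1.\<close>

definition hexagonal_char :: "int \<Rightarrow> complex" where
  "hexagonal_char m = (if m mod 6 \<in> {1, 2} then 1 else if m mod 6 \<in> {4, 5} then - 1 else 0)"

lemma hexagonal_char_minus_3: "hexagonal_char (m - 3) = - hexagonal_char m"
proof -
  have "(m - 3) mod 6 = (m mod 6 - 3) mod 6" by (simp add: mod_simps)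
  moreover have "m mod 6 \<in> {0, 1, 2, 3, 4, 5}" using pos_mod_bound[of 6 m] pos_mod_sign[of 6 m] by auto
  ultimately show ?thesis unfolding hexagonal_char_def by auto
qed

lemma hexagonal_char_add_3N: "hexagonal_char (m + int (3 * n)) = (-1) ^ n * hexagonal_char m"
proof (induction n)
  case (Suc n)
  have "hexagonal_char (m + int (3 * Suc n)) = - hexagonal_char (m + int (3 * n))"
    using hexagonal_char_minus_3[of "m + int (3 * Suc n)"] by (simp add: algebra_simps)
  then show ?case using Suc by simp
qed simp

text \<open>The coefficients of the formal solution \<open>A x = (\<Sum>m. a m * x ^ m)\<close> of
  \<open>A (q * x) = x + x\<^sup>2 - x ^ 3 * A x\<close>, continued to negative \<open>m\<close>. The division by 6 is exact where
  \<open>hexagonal_char\<close> does not vanish.\<close>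

definition trefoil_coeff :: "complex \<Rightarrow> int \<Rightarrow> complex" where
  "trefoil_coeff q m = hexagonal_char m * q powi (- ((m + 1) * (m + 2) div 6))"

lemma jacobi_sum_sum:
  "jacobi_sum q (\<lambda>k. \<Sum>j\<in>J. w j * f j k) n m = (\<Sum>j\<in>J. w j * jacobi_sum q (f j) n m)"
  unfolding jacobi_sum_def sum_distrib_left sum_distrib_right
  by (subst sum.swap) (simp add: mult_ac)

locale primitive_root =
  fixes q :: complex and N :: nat
  assumes N_pos: "N > 0" and q_power_N: "q ^ N = 1"
    and primitive: "\<And>k. 0 < k \<Longrightarrow> k < N \<Longrightarrow> q ^ k \<noteq> 1"
begin

lemma q_nonzero: "q \<noteq> 0"
  using q_power_N N_pos by (auto simp: power_0_left)

lemma powi_mult_N [simp]: "q powi (int N * k) = 1" "q powi (k * int N) = 1"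
  by (simp_all add: power_int_mult q_power_N mult.commute[of k])

lemma powi_eq_1_iff: "q powi d = 1 \<longleftrightarrow> int N dvd d"
proof
  assume *: "q powi d = 1"
  define r where "r = nat (d mod int N)"
  have r: "int r = d mod int N" using N_pos by (simp add: r_def)
  have "d = int N * (d div int N) + int r" by (simp add: r)
  then have "q powi d = q powi (int N * (d div int N)) * q powi int r"
    using q_nonzero by (metis power_int_add)
  then have "q ^ r = 1" using * by simp
  moreover have "r < N" using r N_pos by (metis of_nat_0_less_iff of_nat_less_iff pos_mod_bound)
  ultimately have "r = 0" using primitive[of r] by auto
  then show "int N dvd d" using r by auto
next
  assume "int N dvd d"
  then show "q powi d = 1" by auto
qed

text \<open>For even N primitivity gives q^(N/2) = -1. This sign is behind both the antiperiodicity
  of \<open>trefoil_coeff\<close> and the uniqueness in \<open>pairsum_eq_abel_sum\<close>.\<close>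

lemma powi_tri_N: "q powi tri (int N) = - ((-1) ^ N)"
proof (cases "even N")
  case True
  then obtain h where h: "N = 2 * h" by auto
  then have "h > 0" "h < N" using N_pos by auto
  have "(q ^ h)\<^sup>2 = 1" using q_power_N by (simp add: h power_mult[symmetric] mult.commute)
  then have "q ^ h = - 1" using primitive[OF \<open>h > 0\<close> \<open>h < N\<close>] by (simp add: power2_eq_1_iff)
  moreover have "tri (int N) = int h * (int N - 1)" using two_tri[of "int N"] by (simp add: h)
  moreover have "odd (int N - 1)" using True by simp
  ultimately show ?thesis using True by (simp add: power_int_mult power_int_minus_left)
next
  case False
  then obtain h where h: "N = 2 * h + 1" by (auto elim: oddE)
  then have "tri (int N) = int N * int h" using two_tri[of "int N"] by (simp add: h)
  then show ?thesis using False by simp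
qed

text \<open>Homogeneous for every integer m; the inhomogeneous part x + x^2 comes back as boundary
  terms when the Abel sum over m \<ge> 0 is shifted.\<close>

lemma trefoil_coeff_rec: "trefoil_coeff q m * q powi m = - trefoil_coeff q (m - 3)"
proof -
  have "(m + 1) * (m + 2) = (m - 3 + 1) * (m - 3 + 2) + m * 6" by (simp add: algebra_simps)
  then have "(m + 1) * (m + 2) div 6 = (m - 3 + 1) * (m - 3 + 2) div 6 + m" by simp
  then have "- ((m + 1) * (m + 2) div 6) + m = - ((m - 3 + 1) * (m - 3 + 2) div 6)" by simp
  then have "q powi (- ((m + 1) * (m + 2) div 6)) * q powi m = q powi (- ((m - 3 + 1) * (m - 3 + 2) div 6))"
    using q_nonzero by (metis power_int_add)
  then show ?thesis unfolding trefoil_coeff_def hexagonal_char_minus_3 by (simp add: mult.assoc)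
qed

text \<open>A shift by 3N multiplies the character by (-1)^N and, through q^(N(N-1)/2), the Gaussian
  by - (-1)^N. The two combine to -1 for either parity of N.\<close>

lemma antiperiodic_trefoil_coeff: "antiperiodic (3 * N) (trefoil_coeff q)"
  unfolding antiperiodic_def
proof
  fix m
  have "(m + int (3 * N) + 1) * (m + int (3 * N) + 2) = (m + 1) * (m + 2) + (int N * (m + 3) + 3 * tri (int N)) * 6"
    using two_tri[of "int N"] by (simp add: algebra_simps)
  then have "- ((m + int (3 * N) + 1) * (m + int (3 * N) + 2) div 6) =
      - ((m + 1) * (m + 2) div 6) + int N * (- m - 3) + tri (int N) * (- 3)"
    by (simp add: algebra_simps)
  then have "q powi (- ((m + int (3 * N) + 1) * (m + int (3 * N) + 2) div 6)) =
      q powi (- ((m + 1) * (m + 2) div 6)) * q powi (int N * (- m - 3)) * (q powi tri (int N)) powi (- 3)"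
    using q_nonzero by (simp only: power_int_add power_int_mult simp_thms)
  also have "\<dots> = q powi (- ((m + 1) * (m + 2) div 6)) * (- ((-1) ^ N))"
    unfolding powi_tri_N powi_mult_N by (cases "even N") (simp_all add: power_int_minus)
  finally show "trefoil_coeff q (m + int (3 * N)) = - trefoil_coeff q m"
    unfolding trefoil_coeff_def hexagonal_char_add_3N by (cases "even N") simp_all
qed

lemma antiperiodic_mult:
  assumes "\<And>m. w (m + int N) = w m"
  shows "antiperiodic (3 * N) (\<lambda>m. trefoil_coeff q m * w (m + d))"
proof -
  have "w (m + int (3 * N) + d) = w (m + d)" for m
    using assms[of "m + d"] assms[of "m + d + int N"] assms[of "m + d + int N + int N"]
    by (simp add: algebra_simps)
  then show ?thesis using antiperiodic_trefoil_coeff by (simp add: antiperiodic_def)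
qed

section \<open>The sum S and its functional equation\<close>

definition pairsum :: "nat \<Rightarrow> complex \<Rightarrow> complex" where
  "pairsum L x = (\<Sum>n<L. q ^ n * (qpoch x q n * qpoch (q / x) q n))"

lemma pairsum_Suc: "pairsum (Suc L) x = pairsum L x + q ^ L * (qpoch x q L * qpoch (q / x) q L)"
  by (simp add: pairsum_def)

text \<open>Holds for every x \<noteq> 0 with an explicit remainder. For L = N - 1 the factor 1 - x
  completes (q x)_L to (x)_N, which is 0 at powers of q.\<close>

lemma pairsum_telescope:
  assumes x: "x \<noteq> 0"
  shows "pairsum (Suc L) (q * x) + x ^ 3 * pairsum (Suc L) x =
    x + x\<^sup>2 + (1 - x) * (1 - x\<^sup>2) * (qpoch (q * x) q L * qpoch (q / x) q L)"
proof (induction L)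
  case (Suc L)
  define a b w where "a = qpoch (q * x) q L" and "b = qpoch (q / x) q L" and "w = q ^ Suc L"
  have 1: "qpoch (q * x) q (Suc L) = a * (1 - x * w)" "qpoch (q / x) q (Suc L) = b * (1 - w / x)"
    by (simp_all add: qpoch_Suc a_def b_def w_def mult_ac)
  have 2: "qpoch x q (Suc L) = (1 - x) * a" "qpoch (q / (q * x)) q (Suc L) = (1 - 1 / x) * b"
    using q_nonzero by (simp_all add: qpoch_shift a_def b_def mult_ac)
  have "pairsum (Suc (Suc L)) (q * x) + x ^ 3 * pairsum (Suc (Suc L)) x =
     (pairsum (Suc L) (q * x) + x ^ 3 * pairsum (Suc L) x) +
     w * (a * (1 - x * w) * ((1 - 1 / x) * b)) + x ^ 3 * (w * ((1 - x) * a * (b * (1 - w / x))))"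
    unfolding pairsum_Suc[of "Suc L"] 1 2 w_def[symmetric] by (simp add: algebra_simps)
  also have "\<dots> = x + x\<^sup>2 + (1 - x) * (1 - x\<^sup>2) * (a * b) +
     w * (a * (1 - x * w) * ((1 - 1 / x) * b)) + x ^ 3 * (w * ((1 - x) * a * (b * (1 - w / x))))"
    unfolding Suc.IH a_def b_def ..
  also have "\<dots> = x + x\<^sup>2 + (1 - x) * (1 - x\<^sup>2) * ((a * (1 - x * w)) * (b * (1 - w / x)))"
  proof -
    \<comment> \<open>After division by the common factor a b, this rational identity in x and w is
      the whole induction step.\<close>
    have "(1 - x) * (1 - x\<^sup>2) + w * (1 - x * w) * (1 - 1 / x) + x ^ 3 * w * (1 - x) * (1 - w / x)
      = (1 - x) * (1 - x\<^sup>2) * ((1 - x * w) * (1 - w / x))"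
      using x by (simp add: field_simps power2_eq_square power3_eq_cube)
    moreover have "c + d + p * (a * b) + w * (a * r * (s * b)) + t * (w * (u * a * (b * v))) =
        c + d + a * b * (p + w * r * s + t * w * u * v)" for c d p r s t u v :: complex
      by (simp add: algebra_simps)
    ultimately show ?thesis by (simp only:) (simp only: mult_ac)
  qed
  finally show ?case unfolding 1 .
next
  case 0
  show ?case by (simp add: pairsum_def algebra_simps power2_eq_square power3_eq_cube)
qed

lemma qpoch_power_N: "qpoch (q ^ j) q N = 0"
  by (rule qpoch_root_of_unity_eq_0[OF q_power_N N_pos]) simp

lemma pairsum_functional: "pairsum N (q ^ Suc j) = q ^ j + (q ^ j)\<^sup>2 - (q ^ j) ^ 3 * pairsum N (q ^ j)"
proof -
  obtain L where L: "N = Suc L" using N_pos by (cases N) auto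
  have "(1 - q ^ j) * qpoch (q * q ^ j) q L = 0"
    using qpoch_power_N[of j] by (simp add: L qpoch_shift mult.commute)
  then show ?thesis using pairsum_telescope[of "q ^ j" L] q_nonzero by (auto simp: L algebra_simps)
qed

text \<open>Reduces an off-diagonal sum to the diagonal one. The remainder contains (x)_L, so for L
  = N it disappears at powers of q; only the isolated term x survives as a boundary value.\<close>

lemma pairsum_succ:
  assumes x: "x \<noteq> 0"
  shows "(\<Sum>n<L. q ^ Suc n * (qpoch x q (Suc n) * qpoch (q / x) q n)) =
    x - x\<^sup>2 * pairsum L x - x * (qpoch x q L * qpoch (q / x) q L)"
proof (induction L)
  case (Suc L)
  then show ?case using x by (simp add: pairsum_Suc qpoch_Suc) (simp add: field_simps power2_eq_square)
qed (simp add: pairsum_def)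

lemma pairsum_succ':
  assumes x: "x \<noteq> 0"
  shows "(\<Sum>n<L. q ^ n * (qpoch x q n * qpoch (q / x) q (n + 1))) =
    1 / x - q / x\<^sup>2 * pairsum L x - qpoch x q L * qpoch (q / x) q L / x"
proof (induction L)
  case (Suc L)
  then show ?case using x by (simp add: pairsum_Suc qpoch_Suc) (simp add: field_simps power2_eq_square)
qed (simp add: pairsum_def)

text \<open>Both sides obey the same inhomogeneous recursion in j, so their difference satisfies D
  (j+1) = - q^(3j) D j. After N steps this gives D N = - D 0, whereas both sides depend only on q^j,
  so D N = D 0; hence D vanishes identically.\<close>

lemma pairsum_eq_abel_sum:
  "pairsum N (q ^ j) = abel_sum (3 * N) (\<lambda>m. trefoil_coeff q m * q powi (int j * m))"
proof -
  define e where "e = (\<lambda>j m. trefoil_coeff q m * q powi (int j * m))"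
  define C where "C = (\<lambda>j. abel_sum (3 * N) (e j))"
  have ap: "antiperiodic (3 * N) (e j)" for j
  proof -
    have "q powi (int j * (m + int N)) = q powi (int j * m)" for m
      using q_nonzero by (simp add: distrib_left power_int_add)
    from antiperiodic_mult[of "\<lambda>m. q powi (int j * m)" 0, OF this] show ?thesis by (simp add: e_def)
  qed
  have C_Suc: "C (Suc j) = q ^ j + (q ^ j)\<^sup>2 - (q ^ j) ^ 3 * C j" for j
  proof -
    have "e (Suc j) m = - ((q ^ j) ^ 3) * e j (m - 3)" for m
    proof -
      have "e (Suc j) m = (trefoil_coeff q m * q powi m) * q powi (int j * m)"
      proof -
        have "int (Suc j) * m = m + int j * m" by (simp add: algebra_simps)
        then have "q powi (int (Suc j) * m) = q powi m * q powi (int j * m)"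
          using q_nonzero by (metis power_int_add)
        then show ?thesis by (simp only: e_def mult.assoc)
      qed
      also have "q powi (int j * m) = (q ^ j) ^ 3 * q powi (int j * (m - 3))"
      proof -
        have "int j * m = int (j * 3) + int j * (m - 3)" by (simp add: algebra_simps)
        then show ?thesis using q_nonzero by (metis power_int_add power_int_of_nat power_mult)
      qed
      finally show ?thesis by (simp add: trefoil_coeff_rec e_def)
    qed
    then have "e (Suc j) = (\<lambda>m. - ((q ^ j) ^ 3) * e j (m - 3))" by (rule ext)
    then have "C (Suc j) = - ((q ^ j) ^ 3) * abel_sum (3 * N) (\<lambda>m. e j (m - 3))"
      unfolding C_def abel_sum_cmult[symmetric] by (rule arg_cong)
    \<comment> \<open>Three unit shifts pick up the values at -1, -2, -3; multiplied by - x^3 with x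
      = q^j they give x^2, x and 0.\<close>
    also have "abel_sum (3 * N) (\<lambda>m. e j (m - 3)) = C j + e j (- 1) + e j (- 2) + e j (- 3)"
      using abel_sum_shift_minus[OF ap[of j]] abel_sum_shift_minus[OF antiperiodic_shift[OF ap[of j], of "-1"]]
        abel_sum_shift_minus[OF antiperiodic_shift[OF ap[of j], of "-2"]] by (simp add: C_def)
    finally have 1: "C (Suc j) = - ((q ^ j) ^ 3) * (C j + e j (- 1) + e j (- 2) + e j (- 3))" .
    have 2: "e j (- 1) = - (1 / q ^ j)" "e j (- 2) = - (1 / (q ^ j)\<^sup>2)" "e j (- 3) = 0"
      using q_nonzero by (simp_all add: e_def trefoil_coeff_def hexagonal_char_def power_int_minus divide_inverse
          power_int_mult power2_eq_square power_add)
    show ?thesis unfolding 1 2 using q_nonzero by (simp add: field_simps power2_eq_square power3_eq_cube)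
  qed
  define D where "D = (\<lambda>j. pairsum N (q ^ j) - C j)"
  have D: "D j = (-1) ^ j * (q powi tri (int j)) ^ 3 * D 0" for j
  proof (induction j)
    case (Suc j)
    have "D (Suc j) = - ((q ^ j) ^ 3) * D j" by (simp add: D_def C_Suc pairsum_functional algebra_simps del: power_Suc)
    moreover have "tri (int (Suc j)) = tri (int j) + int j" using tri_add[of "int j" 1] by (simp add: add.commute)
    ultimately show ?case using Suc q_nonzero by (simp add: power_int_add power_mult_distrib mult_ac)
  qed simp
  have "C N = C 0" unfolding C_def e_def by simp
  then have "D N = D 0" by (simp add: D_def q_power_N)
  moreover have "(-1) ^ N * (- ((-1) ^ N)) ^ 3 = (-1::complex)" by (cases "even N") auto
  ultimately have "D 0 = - D 0" using D[of N] unfolding powi_tri_N by simp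
  then have "D 0 = 0" by simp
  then show ?thesis using D[of j] by (simp add: D_def C_def e_def)
qed

text \<open>Turns the functional with an arbitrary N-periodic weight into evaluations at the points
  q^j; primitivity makes the geometric sums orthogonal.\<close>

lemma discrete_fourier:
  assumes "\<And>m. w (m + int N) = w m"
  obtains u :: "nat \<Rightarrow> complex" where "\<And>k. w k = (\<Sum>j<N. u j * q powi (int j * k))"
proof
  fix k
  have per: "w (m + int N * i) = w m" for m i
  proof (induction i rule: int_induct[of _ 0])
    case (step1 i)
    then show ?case using assms[of "m + int N * i"] by (simp add: algebra_simps)
  next
    case (step2 i)
    then show ?case using assms[of "m + int N * (i - 1)"] by (simp add: algebra_simps)
  qed simp
  define r where "r = nat (k mod int N)"
  have r: "int r = k mod int N" "r < N" using N_pos by (auto simp: r_def nat_less_iff)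
  have w: "w (int r) = w k" using per[of "int r" "k div int N"] by (simp add: r)
  have geo: "(\<Sum>j<N. q powi (int j * (k - int l))) = (if l = r then of_nat N else 0)" if "l < N" for l
  proof -
    define z where "z = q powi (k - int l)"
    have zj: "q powi (int j * (k - int l)) = z ^ j" for j
      by (simp add: z_def power_int_mult mult.commute[of "int j"])
    have "z = 1 \<longleftrightarrow> int N dvd k - int l" unfolding z_def by (rule powi_eq_1_iff)
    also have "\<dots> \<longleftrightarrow> k mod int N = int l mod int N" by (metis mod_eq_dvd_iff)
    also have "\<dots> \<longleftrightarrow> l = r" using that r by auto
    finally have z1: "z = 1 \<longleftrightarrow> l = r" .
    have "z ^ N = 1" using zj[of N] by simp
    then show ?thesis unfolding zj using z1 geometric_sum[of z N] by (cases "z = 1") auto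
  qed
  have "(\<Sum>j<N. ((\<Sum>l<N. w (int l) * q powi (- int j * int l)) / of_nat N) * q powi (int j * k)) =
      (\<Sum>j<N. \<Sum>l<N. w (int l) / of_nat N * q powi (int j * (k - int l)))"
    unfolding sum_divide_distrib sum_distrib_right
  proof (intro sum.cong refl)
    fix j l
    have "q powi (int j * (k - int l)) = q powi (- int j * int l) * q powi (int j * k)"
      using q_nonzero by (simp flip: power_int_add add: algebra_simps)
    then show "w (int l) * q powi (- int j * int l) / of_nat N * q powi (int j * k) =
      w (int l) / of_nat N * q powi (int j * (k - int l))" by simp
  qed
  also have "\<dots> = (\<Sum>l<N. w (int l) / of_nat N * (\<Sum>j<N. q powi (int j * (k - int l))))"
    by (subst sum.swap) (simp add: sum_distrib_left)
  also have "\<dots> = (\<Sum>l<N. if l = r then w (int l) else 0)"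
    using N_pos by (intro sum.cong) (auto simp: geo)
  also have "\<dots> = w k" using r w by simp
  finally show "w k = (\<Sum>j<N. ((\<Sum>l<N. w (int l) * q powi (- int j * int l)) / of_nat N) * q powi (int j * k))" by simp
qed

lemma jacobi_sum_fourier:
  assumes u: "\<And>k. w k = (\<Sum>j<N. u j * q powi (int j * k))"
  shows "jacobi_sum q w n m = (\<Sum>j<N. u j * (qpoch (q ^ j) q n * qpoch (q / q ^ j) q m))"
proof -
  have "w = (\<lambda>k. \<Sum>j<N. u j * (q ^ j) powi k)"
    using u by (simp add: power_int_mult fun_eq_iff)
  then show ?thesis using q_nonzero
    by (simp add: jacobi_sum_sum finite_jacobi_triple_product)
qed

text \<open>Linearity reduces all three to w k = q^(j k), where a factor x^d in front of
  \<open>pairsum\<close> becomes a shift of the argument of w by d. The isolated values of w come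
  from the terms x and 1 / x of the off-diagonal sums.\<close>

lemma sum_jacobi_sum_eq:
  assumes per: "\<And>m. w (m + int N) = w m"
  shows "(\<Sum>n<N. q ^ n * jacobi_sum q w n n) = abel_sum (3 * N) (\<lambda>m. trefoil_coeff q m * w m)" (is ?A)
    and "(\<Sum>n<N. q ^ Suc n * jacobi_sum q w (Suc n) n) =
      w 1 - abel_sum (3 * N) (\<lambda>m. trefoil_coeff q m * w (m + 2))" (is ?B)
    and "(\<Sum>n<N. q ^ n * jacobi_sum q w n (n + 1)) =
      w (- 1) - q * abel_sum (3 * N) (\<lambda>m. trefoil_coeff q m * w (m - 2))" (is ?C)
proof -
  obtain u where u: "\<And>k. w k = (\<Sum>j<N. u j * q powi (int j * k))" using discrete_fourier[of w, OF per] by blast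
  note js = jacobi_sum_fourier[of w u, OF u]
  have sw: "(\<Sum>n<N. v n * (\<Sum>j<N. u j * t n j)) = (\<Sum>j<N. u j * (\<Sum>n<N. v n * t n j))" for v t :: "nat \<Rightarrow> _"
    unfolding sum_distrib_left by (subst sum.swap) (simp add: mult_ac)
  have ab: "(\<Sum>j<N. u j * (q powi (int j * d) * pairsum N (q ^ j))) =
      abel_sum (3 * N) (\<lambda>m. trefoil_coeff q m * w (m + d))" for d
  proof -
    have "(\<Sum>j<N. u j * (q powi (int j * d) * pairsum N (q ^ j))) =
       abel_sum (3 * N) (\<lambda>m. \<Sum>j<N. u j * q powi (int j * d) * (trefoil_coeff q m * q powi (int j * m)))"
      by (simp add: abel_sum_sum abel_sum_cmult pairsum_eq_abel_sum mult.assoc)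
    also have "(\<lambda>m. \<Sum>j<N. u j * q powi (int j * d) * (trefoil_coeff q m * q powi (int j * m))) =
      (\<lambda>m. trefoil_coeff q m * w (m + d))"
      using q_nonzero by (simp add: fun_eq_iff u sum_distrib_left distrib_left power_int_add mult_ac)
    finally show ?thesis .
  qed
  show ?A unfolding js sw using ab[of 0] by (simp add: pairsum_def)
  have "(\<Sum>n<N. q ^ Suc n * (qpoch (q ^ j) q (Suc n) * qpoch (q / q ^ j) q n)) =
      q powi (int j * 1) - q powi (int j * 2) * pairsum N (q ^ j)" for j
    using pairsum_succ[of "q ^ j" N] q_nonzero qpoch_power_N[of j] by (simp add: power_int_mult)
  then show ?B unfolding js sw using ab[of 2] by (simp add: right_diff_distrib sum_subtractf u[of 1])
  have "(\<Sum>n<N. q ^ n * (qpoch (q ^ j) q n * qpoch (q / q ^ j) q (n + 1))) =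
      q powi (int j * - 1) - q * (q powi (int j * - 2) * pairsum N (q ^ j))" for j
    using pairsum_succ'[of "q ^ j" N] q_nonzero qpoch_power_N[of j]
    by (simp add: power_int_mult power_int_minus divide_inverse)
  then show ?C unfolding js sw using ab[of "- 2"]
    by (simp add: right_diff_distrib sum_subtractf u[of "- 1"] mult.left_commute[of _ q] flip: sum_distrib_left)
qed

end

section \<open>The character of a triple (2, 3, h)\<close>

lemma qpow_add: "qpow \<tau> (x + y) = qpow \<tau> x * qpow \<tau> y"
  by (simp add: qpow_def exp_add[symmetric] algebra_simps)

lemma qpow_0 [simp]: "qpow \<tau> 0 = 1"
  by (simp add: qpow_def)

lemma qpow_minus: "qpow \<tau> (- x) = inverse (qpow \<tau> x)"
  by (simp add: qpow_def exp_minus)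

lemma qpow_power: "qpow \<tau> x ^ n = qpow \<tau> (real n * x)"
  by (simp add: qpow_def exp_of_nat_mult[symmetric] algebra_simps)

lemma qpow_power_int: "qpow \<tau> 1 powi k = qpow \<tau> (of_int k)"
  by (cases "k \<ge> 0") (simp_all add: power_int_def qpow_power qpow_minus[symmetric] power_inverse[symmetric])

lemma exp_pi_int: "exp (of_real pi * \<i> * of_int j) = (if even j then 1 else - 1)"
proof (cases "even j")
  case True
  then obtain k where k: "j = 2 * k" by auto
  have "exp (of_real pi * \<i> * of_int j) = exp (2 * of_int k * of_real pi * \<i>)" by (simp add: k mult_ac)
  then show ?thesis using True exp_integer_2pi[of "of_int k"] by simp
next
  case False
  then obtain k where k: "j = 2 * k + 1" by (auto elim: oddE)
  have "of_real pi * \<i> * of_int j = 2 * of_int k * of_real pi * \<i> + of_real pi * (\<i> :: complex)"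
    by (simp add: k algebra_simps)
  then have "exp (of_real pi * \<i> * of_int j) = exp (2 * of_int k * of_real pi * \<i>) * exp (of_real pi * \<i>)"
    by (simp only: exp_add)
  then show ?thesis using False exp_integer_2pi[of "of_int k"] by simp
qed

text \<open>The quadratic character modulo 12; equivalently, its value at 6 + 3 e1 + 2 e2 is e1 e2
  for signs e1, e2.\<close>

definition twelve_char :: "int \<Rightarrow> int" where
  "twelve_char u = (if u mod 12 \<in> {1, 11} then 1 else if u mod 12 \<in> {5, 7} then - 1 else 0)"

lemma hexagonal_char_eq: "hexagonal_char (m + 2) = of_int (twelve_char (2 * m + 1))"
proof -
  define r where "r = m mod 6"
  have 1: "(m + 2) mod 6 = (r + 2) mod 6" by (simp add: r_def mod_simps)
  have 2: "(2 * m + 1) mod 12 = (2 * r + 1) mod 12"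
  proof -
    have "m = 6 * (m div 6) + r" by (simp add: r_def)
    then have "2 * m + 1 = 2 * r + 1 + 12 * (m div 6)" by presburger
    then show ?thesis by (metis mod_mult_self2)
  qed
  have "r \<in> {0, 1, 2, 3, 4, 5}" using pos_mod_bound[of 6 m] pos_mod_sign[of 6 m] by (auto simp: r_def)
  then show ?thesis unfolding hexagonal_char_def twelve_char_def 1 2 by auto
qed

lemma mod_12_cases: "u mod 12 \<in> {0, 1, 2, 3, 4, 5, 6, 7, 8, 9, 10, 11 :: int}"
  unfolding insert_iff empty_iff by presburger

lemma twelve_char_even:
  assumes "even u"
  shows "twelve_char u = 0"
proof -
  have "even (u mod 12)" using assms by presburger
  then show ?thesis unfolding twelve_char_def by auto
qed

lemma twelve_char_minus: "twelve_char (- u) = twelve_char u"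
proof -
  have "(- u) mod 12 = (- (u mod 12)) mod 12" by (simp add: mod_simps)
  then show ?thesis using mod_12_cases[of u] unfolding twelve_char_def by auto
qed

locale chi_23 =
  fixes h l :: int
  assumes h: "h > 0" "coprime h 6" and l: "0 < l" "l < h"
begin

lemma odd_h: "odd h"
  using h(2) by (metis coprime_common_divisor dvd_triv_left even_numeral odd_one)

lemma not_dvd_6l: "\<not> h dvd 6 * l"
proof
  assume "h dvd 6 * l"
  then have "h dvd l" using h by (simp add: coprime_dvd_mult_right_iff)
  then show False using l zdvd_not_zless by blast
qed

lemma not_dvd_12l: "\<not> h dvd 12 * l"
proof
  assume "h dvd 12 * l"
  moreover have "coprime h 12"
    using h(2) odd_h coprime_mult_right_iff[of h 6 2] by simp
  ultimately have "h dvd l" by (simp add: coprime_dvd_mult_right_iff)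
  then show False using l zdvd_not_zless by blast
qed

text \<open>With P = 6h the first two signs enter only through u = 6 + 3 e1 + 2 e2 modulo 12, and
  the third chooses between two progressions exchanged by n -> -n. The condition c \<noteq> 0
  discards the u that are not of this shape.\<close>

lemma chi_rel_iff:
  "chi_rel (2, 3, h) (1, 1, l) n c \<longleftrightarrow>
    c \<noteq> 0 \<and> (\<exists>u. (n = h * u - 6 * l \<and> c = twelve_char u) \<or> (n = - (h * u - 6 * l) \<and> c = - twelve_char u))"
  (is "?L \<longleftrightarrow> ?R")
proof
  assume ?L
  then obtain e1 e2 e3 where e: "e1 \<in> {1, - 1}" "e2 \<in> {1, - 1}" "e3 \<in> {1, - 1 :: int}"
    "[n = 2 * 3 * h + e1 * 1 * 3 * h + e2 * 1 * 2 * h + e3 * l * 2 * 3] (mod (2 * (2 * 3 * h)))" "c = - (e1 * e2 * e3)"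
    unfolding chi_rel.simps by blast
  then obtain t where "n - (2 * 3 * h + e1 * 1 * 3 * h + e2 * 1 * 2 * h + e3 * l * 2 * 3) = 2 * (2 * 3 * h) * t"
    by (metis cong_iff_dvd_diff dvdE)
  then have t: "n = 6 * h + e1 * 3 * h + e2 * 2 * h + e3 * l * 6 + 12 * h * t"
    by algebra
  define u where "u = 6 + 3 * e1 + 2 * e2 + 12 * t"
  have u: "n = h * u + 6 * l * e3" unfolding t u_def by (simp add: algebra_simps)
  have um: "u mod 12 = (6 + 3 * e1 + 2 * e2) mod 12" by (simp add: u_def)
  have tu: "twelve_char u = e1 * e2" using e(1,2) um unfolding twelve_char_def by auto
  have "c \<noteq> 0" using e by auto
  moreover have "(n = h * u - 6 * l \<and> c = twelve_char u) \<or> (n = - (h * - u - 6 * l) \<and> c = - twelve_char (- u))"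
    using e(3,5) u tu twelve_char_minus[of u] by auto
  ultimately show ?R by blast
next
  have rel: "chi_rel (2, 3, h) (1, 1, l) (h * u + 6 * l * e3) (- (twelve_char u * e3))"
    if "twelve_char u \<noteq> 0" "e3 \<in> {1, - 1}" for u e3
  proof -
    have "\<exists>e1\<in>{1, - 1}. \<exists>e2\<in>{1, - 1}. u mod 12 = (6 + 3 * e1 + 2 * e2) mod 12 \<and> twelve_char u = e1 * e2"
      using that(1) unfolding twelve_char_def by (auto split: if_splits)
    then obtain e1 e2 where e: "e1 \<in> {1, - 1}" "e2 \<in> {1, - 1}" "u mod 12 = (6 + 3 * e1 + 2 * e2) mod 12" "twelve_char u = e1 * e2"
      by blast
    then have "12 dvd u - (6 + 3 * e1 + 2 * e2)" by (metis mod_eq_dvd_iff)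
    then obtain t where "u = 6 + 3 * e1 + 2 * e2 + 12 * t" by (metis add.commute diff_eq_eq dvdE)
    then have "h * u + 6 * l * e3 - (2 * 3 * h + e1 * 1 * 3 * h + e2 * 1 * 2 * h + e3 * l * 2 * 3) = (2 * (2 * 3 * h)) * t"
      by (simp add: algebra_simps)
    then have "[h * u + 6 * l * e3 = 2 * 3 * h + e1 * 1 * 3 * h + e2 * 1 * 2 * h + e3 * l * 2 * 3] (mod (2 * (2 * 3 * h)))"
      by (simp add: cong_iff_dvd_diff)
    then show ?thesis unfolding chi_rel.simps e(4) using e(1,2) that(2) by blast
  qed
  assume ?R
  then obtain u where c0: "c \<noteq> 0" and
    "(n = h * u - 6 * l \<and> c = twelve_char u) \<or> (n = - (h * u - 6 * l) \<and> c = - twelve_char u)" by blast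
  then show ?L
  proof (elim disjE conjE)
    assume "n = h * u - 6 * l" "c = twelve_char u"
    then show ?L using rel[of u "-1"] c0 by simp
  next
    assume "n = - (h * u - 6 * l)" "c = - twelve_char u"
    then show ?L using rel[of "- u" 1] c0 by (simp add: twelve_char_minus)
  qed
qed

text \<open>The part of \<open>chi\<close> with third sign -1; the part with +1 is minus its
  reflection.\<close>

definition half_chi :: "int \<Rightarrow> int" where
  "half_chi n = (if h dvd n + 6 * l then twelve_char ((n + 6 * l) div h) else 0)"

lemma half_chi_eval: "half_chi (h * u - 6 * l) = twelve_char u"
  using h by (simp add: half_chi_def)

lemma half_chi_nonzero: "half_chi n \<noteq> 0 \<Longrightarrow> \<exists>m. n = h * (2 * m + 1) - 6 * l \<and> half_chi n = twelve_char (2 * m + 1)"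
proof -
  assume *: "half_chi n \<noteq> 0"
  then obtain u where u: "n + 6 * l = h * u" by (auto simp: half_chi_def elim: dvdE split: if_splits)
  then have n: "n = h * u - 6 * l" by simp
  then have "odd u" using * half_chi_eval[of u] twelve_char_even[of u] by auto
  then obtain m where "u = 2 * m + 1" by (auto elim: oddE)
  then show ?thesis using n half_chi_eval[of u] by auto
qed

lemma half_chi_disjoint:
  assumes "half_chi n \<noteq> 0"
  shows "half_chi (- n) = 0"
proof (rule ccontr)
  assume "half_chi (- n) \<noteq> 0"
  then have "h dvd - n + 6 * l" "h dvd n + 6 * l" using assms by (auto simp: half_chi_def split: if_splits)
  then have "h dvd (- n + 6 * l) + (n + 6 * l)" by (rule dvd_add)
  then show False using not_dvd_12l by simp
qed

text \<open>The two parts cannot overlap, as h would then divide 12 l and hence l.\<close>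

lemma chi_eq: "chi (2, 3, h) (1, 1, l) n = half_chi n - half_chi (- n)"
proof -
  have iff: "chi_rel (2, 3, h) (1, 1, l) n c \<longleftrightarrow> c \<noteq> 0 \<and> c = half_chi n - half_chi (- n)" for c
  proof -
    have "chi_rel (2, 3, h) (1, 1, l) n c \<longleftrightarrow> c \<noteq> 0 \<and> (c = half_chi n \<or> c = - half_chi (- n))"
    proof
      assume "chi_rel (2, 3, h) (1, 1, l) n c"
      then show "c \<noteq> 0 \<and> (c = half_chi n \<or> c = - half_chi (- n))"
        unfolding chi_rel_iff using half_chi_eval by (metis minus_minus)
    next
      assume *: "c \<noteq> 0 \<and> (c = half_chi n \<or> c = - half_chi (- n))"
      then show "chi_rel (2, 3, h) (1, 1, l) n c"
        unfolding chi_rel_iff using half_chi_nonzero[of n] half_chi_nonzero[of "- n"]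
        by (metis add.inverse_inverse neg_equal_0_iff_equal)
    qed
    also have "\<dots> \<longleftrightarrow> c \<noteq> 0 \<and> c = half_chi n - half_chi (- n)"
      using half_chi_disjoint[of n] half_chi_disjoint[of "- n"] by auto
    finally show ?thesis .
  qed
  show ?thesis
  proof (cases "half_chi n - half_chi (- n) = 0")
    case True
    then show ?thesis unfolding chi_def iff by auto
  next
    case False
    then show ?thesis unfolding chi_def iff by auto
  qed
qed

lemma half_chi_add: "half_chi (n + 6 * h * int N) = (-1) ^ N * half_chi n"
proof (induction N)
  case (Suc N)
  have "half_chi (n + 6 * h) = - half_chi n" for n
  proof (cases "h dvd n + 6 * l")
    case True
    then obtain u where "n + 6 * l = h * u" by (auto elim: dvdE)
    then have "n = h * u - 6 * l" "n + 6 * h = h * (u + 6) - 6 * l" by (auto simp: algebra_simps)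
    then have "half_chi n = twelve_char u" "half_chi (n + 6 * h) = twelve_char (u + 6)" using half_chi_eval by metis+
    moreover have "twelve_char (u + 6) = - twelve_char u"
    proof -
      have "(u + 6) mod 12 = (u mod 12 + 6) mod 12" by (simp add: mod_simps)
      then show ?thesis using mod_12_cases[of u] unfolding twelve_char_def by auto
    qed
    ultimately show ?thesis by simp
  next
    case False
    moreover have "h dvd n + 6 * h + 6 * l \<longleftrightarrow> h dvd n + 6 * l"
      using dvd_add_left_iff[of h "6 * h" "n + 6 * l"] by (simp add: algebra_simps)
    ultimately show ?thesis by (simp add: half_chi_def)
  qed
  from this[of "n + 6 * h * int N"] show ?case using Suc by (simp add: algebra_simps)
qed simp

lemma half_chi_odd: "half_chi n \<noteq> 0 \<Longrightarrow> odd n"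
  using half_chi_nonzero[of n] odd_h by auto

end

section \<open>Values of the Eichler terms at the cusp\<close>

locale rational_cusp =
  fixes M N :: nat and x :: complex
  assumes N_pos: "N > 0" and coprime_MN: "coprime M N" and x_def: "x = of_real (real M / real N)"
begin

lemma qpow_half: "qpow x (real N * of_int k / 2) = (if even (int M * k) then 1 else - 1)"
proof -
  have "qpow x (real N * of_int k / 2) = exp (of_real pi * \<i> * of_int (int M * k))"
    using N_pos by (simp add: qpow_def x_def field_simps)
  then show ?thesis by (simp only: exp_pi_int)
qed

end

locale chi_23_cusp = chi_23 + rational_cusp
begin

text \<open>The exponents differ by N (n + 3hN) / 2, so the factor is the parity sign of M (n +
  3hN). For odd n it is opposite to (-1)^N: M is odd when N is even, and n + 3hN is even when N is
  odd.\<close>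

lemma qpow_antiperiodic:
  assumes "odd n"
  shows "qpow x ((real_of_int (n + 6 * h * int N))\<^sup>2 / (24 * of_int h)) =
    - ((-1) ^ N * qpow x ((real_of_int n)\<^sup>2 / (24 * of_int h)))"
proof -
  have "(real_of_int (n + 6 * h * int N))\<^sup>2 / (24 * of_int h) =
      (real_of_int n)\<^sup>2 / (24 * of_int h) + real N * of_int (n + 3 * h * int N) / 2"
    using h by (simp add: field_simps power2_eq_square)
  then have "qpow x ((real_of_int (n + 6 * h * int N))\<^sup>2 / (24 * of_int h)) =
      qpow x ((real_of_int n)\<^sup>2 / (24 * of_int h)) * (if even (int M * (n + 3 * h * int N)) then 1 else - 1)"
    by (simp only: qpow_add qpow_half)
  moreover have "odd M" if "even N"
    using coprime_MN that by (metis coprime_common_divisor odd_one)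
  ultimately show ?thesis using assms odd_h by (cases "even N") auto
qed

definition half_term :: "int \<Rightarrow> complex" where
  "half_term n = of_int (half_chi n) * qpow x ((real_of_int n)\<^sup>2 / (24 * of_int h))"

lemma half_term_antiperiodic: "half_term (n + 6 * h * int N) = - half_term n"
proof (cases "half_chi n = 0")
  case True
  then show ?thesis unfolding half_term_def half_chi_add by simp
next
  case False
  note qpow_antiperiodic[OF half_chi_odd[OF False]]
  then show ?thesis unfolding half_term_def half_chi_add by (cases "even N") auto
qed

lemma chi_term: "of_int (chi (2, 3, h) (1, 1, l) n) * qpow x ((real_of_int n)\<^sup>2 / (24 * of_int h)) =
    half_term n - half_term (- n)"
  by (simp add: chi_eq half_term_def algebra_simps)

lemma chi_term_antiperiodic:
  "half_term (n + 6 * h * int N) - half_term (- (n + 6 * h * int N)) = - (half_term n - half_term (- n))"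
  using half_term_antiperiodic[of n] half_term_antiperiodic[of "- (n + 6 * h * int N)"] by (simp add: algebra_simps)

text \<open>Antiperiodicity folds the reflected half onto the direct one, which doubles it. A block
  of length 6hN contains 3N candidates h(2m+1) - 6l, beginning with the first positive one; the
  hypotheses say that its index is m0.\<close>

lemma sum_chi_term:
  assumes m0: "h * (2 * m0 - 1) < 6 * l" "6 * l < h * (2 * m0 + 1)"
  shows "(\<Sum>n<nat (6 * h * int N). half_term (int n) - half_term (- int n)) / 2 =
    2 * abel_sum (3 * N) (\<lambda>m. hexagonal_char (m + m0 + 2) *
      qpow x ((of_int h * (2 * of_int (m + m0) + 1) - 6 * of_int l)\<^sup>2 / (24 * of_int h)))"
proof -
  define K where "K = 6 * h * int N"
  have K: "K > 0" using h N_pos by (simp add: K_def)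
  have "(\<Sum>n<nat K. half_term (int n) - half_term (- int n)) = (\<Sum>n\<in>{0..<K}. half_term n - half_term (- n))"
    by (rule sum.reindex_bij_witness[of _ nat int]) auto
  also have "\<dots> = (\<Sum>n\<in>{0..<K}. half_term n) - (\<Sum>n\<in>{0..<K}. half_term (- n))"
    by (rule sum_subtractf)
  \<comment> \<open>The point 0 must go before the reflection n -> K - n, which would send it
    outside the block.\<close>
  also have "(\<Sum>n\<in>{0..<K}. half_term (- n)) = (\<Sum>n\<in>{0<..<K}. half_term (- n))"
  proof (rule sum.mono_neutral_right)
    have "half_term 0 = 0" using not_dvd_6l by (simp add: half_term_def half_chi_def)
    then show "\<forall>n\<in>{0..<K} - {0<..<K}. half_term (- n) = 0" by auto
  qed auto
  also have "\<dots> = (\<Sum>n\<in>{0<..<K}. half_term (n - K))"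
    by (rule sum.reindex_bij_witness[of _ "\<lambda>n. K - n" "\<lambda>n. K - n"]) auto
  also have "\<dots> = - (\<Sum>n\<in>{0<..<K}. half_term n)"
  proof -
    have "half_term (n - K) = - half_term n" for n
      using half_term_antiperiodic[of "n - K"] by (simp add: K_def)
    then show ?thesis by (simp add: sum_negf)
  qed
  also have "(\<Sum>n\<in>{0<..<K}. half_term n) = (\<Sum>n\<in>{0..<K}. half_term n)"
  proof (rule sum.mono_neutral_left)
    have "half_term 0 = 0" using not_dvd_6l by (simp add: half_term_def half_chi_def)
    then show "\<forall>n\<in>{0..<K} - {0<..<K}. half_term n = 0" by auto
  qed auto
  also have "(\<Sum>n\<in>{0..<K}. half_term n) - - (\<Sum>n\<in>{0..<K}. half_term n) = 2 * (\<Sum>n\<in>{0..<K}. half_term n)" by simp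
  also have "(\<Sum>n\<in>{0..<K}. half_term n) = (\<Sum>n\<in>(\<lambda>i. h * (2 * (int i + m0) + 1) - 6 * l) ` {..<3 * N}. half_term n)"
  proof (rule sum.mono_neutral_right)
    show "(\<lambda>i. h * (2 * (int i + m0) + 1) - 6 * l) ` {..<3 * N} \<subseteq> {0..<K}"
    proof safe
      fix i :: nat assume i: "i < 3 * N"
      have "h * (2 * m0 + 1) \<le> h * (2 * (int i + m0) + 1)" using h by (intro mult_left_mono) auto
      moreover have "h * (2 * (int i + m0) + 1) \<le> h * (6 * int N + (2 * m0 - 1))" using h i by (intro mult_left_mono) auto
      moreover have "\<dots> = K + h * (2 * m0 - 1)" by (simp add: K_def algebra_simps)
      ultimately show "h * (2 * (int i + m0) + 1) - 6 * l \<in> {0..<K}" using m0 by auto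
    qed
    show "\<forall>n\<in>{0..<K} - (\<lambda>i. h * (2 * (int i + m0) + 1) - 6 * l) ` {..<3 * N}. half_term n = 0"
    proof (intro ballI, rule ccontr)
      fix n assume n: "n \<in> {0..<K} - (\<lambda>i. h * (2 * (int i + m0) + 1) - 6 * l) ` {..<3 * N}" "half_term n \<noteq> 0"
      then have "half_chi n \<noteq> 0" by (auto simp: half_term_def)
      then obtain m where m: "n = h * (2 * m + 1) - 6 * l" using half_chi_nonzero by blast
      have "h * (2 * m0 - 1) < h * (2 * m + 1)" using m0 n m by auto
      then have 1: "m \<ge> m0" using h by (simp add: mult_less_cancel_left)
      have "h * (2 * m + 1) < h * (2 * (m0 + 3 * int N) + 1)" using m0 n m by (auto simp: K_def algebra_simps)
      then have 2: "m < m0 + 3 * int N" using h by (simp add: mult_less_cancel_left)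
      define i where "i = nat (m - m0)"
      have "m = int i + m0" "i < 3 * N" using 1 2 by (auto simp: i_def)
      then show False using n m by auto
    qed
  qed auto
  also have "\<dots> = (\<Sum>i<3 * N. half_term (h * (2 * (int i + m0) + 1) - 6 * l))"
    using h by (subst sum.reindex) (auto simp: inj_on_def)
  also have "\<dots> = (\<Sum>i<3 * N. hexagonal_char (int i + m0 + 2) *
      qpow x ((of_int h * (2 * of_int (int i + m0) + 1) - 6 * of_int l)\<^sup>2 / (24 * of_int h)))"
    by (intro sum.cong) (simp_all add: half_term_def half_chi_eval hexagonal_char_eq)
  finally show ?thesis by (simp add: K_def abel_sum_def)
qed

lemma eichler_cusp_limit:
  assumes m0: "h * (2 * m0 - 1) < 6 * l" "6 * l < h * (2 * m0 + 1)"
  shows "has_cusp_limit (\<lambda>\<tau>. qpow \<tau> d * eichler (2, 3, h) (1, 1, l) \<tau>) (real M / real N)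
    (qpow x d * (2 * abel_sum (3 * N) (\<lambda>m. hexagonal_char (m + m0 + 2) *
      qpow x ((of_int h * (2 * of_int (m + m0) + 1) - 6 * of_int l)\<^sup>2 / (24 * of_int h)))))"
proof -
  define K where "K = nat (6 * h * int N)"
  have K: "int K = 6 * h * int N" "K > 0" using h N_pos by (auto simp: K_def)
  define g where "g = (\<lambda>n::nat. of_int (chi (2, 3, h) (1, 1, l) (int n)) :: complex)"
  have g: "g n * qpow x ((real n)\<^sup>2 / (24 * of_int h)) = half_term (int n) - half_term (- int n)" for n
    using chi_term[of "int n"] by (simp add: g_def)
  have "has_cusp_limit (\<lambda>\<tau>. qpow \<tau> d * (\<Sum>n. g n * qpow \<tau> ((real n)\<^sup>2 / (24 * of_int h)))) (real M / real N)
    (qpow (of_real (real M / real N)) d * ((\<Sum>n<K. g n * qpow (of_real (real M / real N)) ((real n)\<^sup>2 / (24 * of_int h))) / 2))"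
  proof (rule eichler_type_cusp_limit)
    show "g (n + K) * qpow (of_real (real M / real N)) ((real (n + K))\<^sup>2 / (24 * of_int h)) =
      - (g n * qpow (of_real (real M / real N)) ((real n)\<^sup>2 / (24 * of_int h)))" for n
      unfolding x_def[symmetric] g using chi_term_antiperiodic[of "int n"] K by (simp add: add.commute)
  qed (use K h in auto)
  then show ?thesis
    unfolding x_def[symmetric] g K_def sum_chi_term[OF m0] by (simp add: g_def)
qed

end

section \<open>Evaluation of the series and of the limits\<close>

text \<open>The block just below 0 is minus the block starting at 0. Needed where matching the
  exponents reverses the index.\<close>

lemma abel_sum_reflect:
  assumes "antiperiodic K e"
  shows "abel_sum K (\<lambda>m. e (- 1 - m)) = - abel_sum K e"
proof -
  have "(\<Sum>m<K. e (- 1 - int m)) = (\<Sum>m<K. e (int m - int K))"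
    by (rule sum.reindex_bij_witness[of _ "\<lambda>m. K - 1 - m" "\<lambda>m. K - 1 - m"])
      (auto simp: of_nat_diff intro!: arg_cong[of _ _ e])
  also have "\<dots> = (\<Sum>m<K. - e (int m))"
  proof (rule sum.cong[OF refl])
    fix m
    show "e (int m - int K) = - e (int m)"
      using assms[unfolded antiperiodic_def, rule_format, of "int m - int K"] by simp
  qed
  finally show ?thesis by (simp add: abel_sum_def sum_negf)
qed

section \<open>Half-line sums against cusp limits\<close>

context chi_23_cusp
begin

definition eichler_term :: "int \<Rightarrow> complex" where
  "eichler_term m = hexagonal_char (m + 2) * qpow x ((of_int h * (2 * of_int m + 1) - 6 * of_int l)\<^sup>2 / (24 * of_int h))"

lemma antiperiodic_eichler_term: "antiperiodic (3 * N) eichler_term"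
  unfolding antiperiodic_def
proof
  fix m
  have e: "eichler_term m = half_term (h * (2 * m + 1) - 6 * l)" for m
    by (simp add: half_term_def half_chi_eval hexagonal_char_eq eichler_term_def)
  have "h * (2 * (m + int (3 * N)) + 1) - 6 * l = h * (2 * m + 1) - 6 * l + 6 * h * int N"
    by (simp add: algebra_simps)
  then show "eichler_term (m + int (3 * N)) = - eichler_term m"
    unfolding e by (simp only: half_term_antiperiodic)
qed

abbreviation limit_at :: "real \<Rightarrow> complex \<Rightarrow> bool" where
  "limit_at d L \<equiv> has_cusp_limit (\<lambda>\<tau>. qpow \<tau> d * eichler (2, 3, h) (1, 1, l) \<tau>) (real M / real N) L"

lemma limit_at_0:
  assumes "6 * l < h"
  shows "limit_at d (2 * (qpow x d * abel_sum (3 * N) eichler_term))"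
proof -
  have "h * (2 * 0 - 1) < 6 * l" "6 * l < h * (2 * 0 + 1)" using assms l h by auto
  note eichler_cusp_limit[OF this, of d]
  also have "(\<lambda>m. hexagonal_char (m + 0 + 2) *
      qpow x ((of_int h * (2 * of_int (m + 0) + 1) - 6 * of_int l)\<^sup>2 / (24 * of_int h))) = eichler_term"
    by (simp add: eichler_term_def fun_eq_iff)
  finally show ?thesis by (simp only: mult.left_commute[of "qpow x d" 2])
qed

text \<open>Index 0 now gives h - 6l < 0, so the Eichler terms start at index 1; written through the
  sum from 0, one term is lost.\<close>

lemma limit_at_1:
  assumes "h < 6 * l" "6 * l < 3 * h"
  shows "limit_at d (2 * (qpow x d * (abel_sum (3 * N) eichler_term - eichler_term 0)))"
proof -
  have "h * (2 * 1 - 1) < 6 * l" "6 * l < h * (2 * 1 + 1)" using assms by auto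
  note eichler_cusp_limit[OF this, of d]
  also have "(\<lambda>m. hexagonal_char (m + 1 + 2) *
      qpow x ((of_int h * (2 * of_int (m + 1) + 1) - 6 * of_int l)\<^sup>2 / (24 * of_int h))) = (\<lambda>m. eichler_term (m + 1))"
    by (simp add: eichler_term_def)
  finally show ?thesis unfolding abel_sum_shift[OF antiperiodic_eichler_term]
    by (simp only: mult.left_commute[of "qpow x d" 2])
qed

lemma eichler_term_1: "eichler_term 1 = 0"
  by (simp add: eichler_term_def hexagonal_char_def)

lemma eichler_term_minus_2: "eichler_term (- 2) = 0"
  by (simp add: eichler_term_def hexagonal_char_def)

lemma abel_sum_shift_succ:
  assumes "\<And>m. f m = - (qpow x d * eichler_term (m + 1))" and l': "h < 6 * l" "6 * l < 3 * h"
  shows "\<exists>L. limit_at d L \<and> abel_sum (3 * N) f = - (1 / 2) * L"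
proof -
  have "f = (\<lambda>m. - qpow x d * eichler_term (m + 1))" using assms by (simp add: fun_eq_iff)
  then have "abel_sum (3 * N) f = - qpow x d * (abel_sum (3 * N) eichler_term - eichler_term 0)"
    by (simp only: abel_sum_cmult abel_sum_shift[OF antiperiodic_eichler_term])
  then show ?thesis using limit_at_1[OF l', of d] by (intro exI conjI) (assumption, simp)
qed

text \<open>Reversal produces minus the sum from index 2. As \<open>eichler_term 1\<close> is 0,
  this agrees with the sum from index 1 in the limit.\<close>

lemma abel_sum_reflect_pred:
  assumes "\<And>m. f m = qpow x d * eichler_term (1 - m)" and l': "h < 6 * l" "6 * l < 3 * h"
  shows "\<exists>L. limit_at d L \<and> abel_sum (3 * N) f = - (1 / 2) * L"
proof -
  define g where "g = (\<lambda>m. eichler_term (m + 1 + 1))"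
  have g: "antiperiodic (3 * N) g"
    unfolding g_def by (intro antiperiodic_shift[where d = 1] antiperiodic_eichler_term)
  have "f = (\<lambda>m. qpow x d * g (- 1 - m))" using assms by (simp add: fun_eq_iff g_def)
  then have "abel_sum (3 * N) f = - (qpow x d * abel_sum (3 * N) g)"
    by (simp only: abel_sum_cmult abel_sum_reflect[OF g] mult_minus_right)
  also have "abel_sum (3 * N) g = abel_sum (3 * N) eichler_term - eichler_term 0"
    unfolding g_def using abel_sum_shift[OF antiperiodic_shift[OF antiperiodic_eichler_term, of 1]]
      abel_sum_shift[OF antiperiodic_eichler_term] by (simp add: eichler_term_1)
  finally show ?thesis using limit_at_1[OF l', of d] by (intro exI conjI) (assumption, simp)
qed

text \<open>The value \<open>f 1\<close> cancels the term of index -1 picked up by the shift, and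
  index -2 contributes nothing. If h < 6l, the limit lacks the term of index 0, which is what
  \<open>f 2\<close> stands for.\<close>

lemma abel_sum_shift_minus_2:
  assumes f: "\<And>m. f m = qpow x d * eichler_term (m - 2)"
  shows "6 * l < h \<Longrightarrow> \<exists>L. limit_at d L \<and> f 1 - abel_sum (3 * N) f = - (1 / 2) * L"
    and "h < 6 * l \<Longrightarrow> 6 * l < 3 * h \<Longrightarrow> \<exists>L. limit_at d L \<and> f 1 - abel_sum (3 * N) f = - f 2 - (1 / 2) * L"
proof -
  define g where "g = (\<lambda>m. eichler_term (m - 1))"
  have g: "antiperiodic (3 * N) g"
    unfolding g_def using antiperiodic_shift[OF antiperiodic_eichler_term, of "- 1"] by simp
  have "f = (\<lambda>m. qpow x d * g (m - 1))" using f by (simp add: fun_eq_iff g_def)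
  then have "abel_sum (3 * N) f = qpow x d * (abel_sum (3 * N) g + g (- 1))"
    by (simp only: abel_sum_cmult abel_sum_shift_minus[OF g])
  also have "abel_sum (3 * N) g = abel_sum (3 * N) eichler_term + eichler_term (- 1)"
    unfolding g_def by (rule abel_sum_shift_minus[OF antiperiodic_eichler_term])
  finally have "abel_sum (3 * N) f = qpow x d * (abel_sum (3 * N) eichler_term + eichler_term (- 1) + eichler_term (- 2))"
    by (simp add: g_def)
  then have s: "f 1 - abel_sum (3 * N) f = - (qpow x d * abel_sum (3 * N) eichler_term)"
    using f[of 1] by (simp add: eichler_term_minus_2 algebra_simps)
  show "\<exists>L. limit_at d L \<and> f 1 - abel_sum (3 * N) f = - (1 / 2) * L" if "6 * l < h"
    using limit_at_0[OF that, of d] unfolding s by (intro exI conjI) (assumption, simp)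
  show "\<exists>L. limit_at d L \<and> f 1 - abel_sum (3 * N) f = - f 2 - (1 / 2) * L" if "h < 6 * l" "6 * l < 3 * h"
    using limit_at_1[OF that, of d] unfolding s by (intro exI conjI) (assumption, simp add: f[of 2] algebra_simps)
qed

text \<open>The values \<open>f (- 1)\<close> and \<open>f (- 2)\<close> belong to the indices -1
  and 0. The first always compensates the shift; the second is wanted only when the limit sum starts
  at index 1.\<close>

lemma abel_sum_reflect_succ:
  assumes f: "\<And>m. f m = - (qpow x d * eichler_term (- 2 - m))"
  shows "6 * l < h \<Longrightarrow> \<exists>L. limit_at d L \<and> - f (- 1) - abel_sum (3 * N) f = - (1 / 2) * L"
    and "h < 6 * l \<Longrightarrow> 6 * l < 3 * h \<Longrightarrow> \<exists>L. limit_at d L \<and> - f (- 1) - f (- 2) - abel_sum (3 * N) f = - (1 / 2) * L"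
proof -
  define g where "g = (\<lambda>m. eichler_term (m - 1))"
  have g: "antiperiodic (3 * N) g"
    unfolding g_def using antiperiodic_shift[OF antiperiodic_eichler_term, of "- 1"] by simp
  have "f = (\<lambda>m. - qpow x d * g (- 1 - m))" using f by (simp add: fun_eq_iff g_def)
  then have "abel_sum (3 * N) f = - qpow x d * - abel_sum (3 * N) g"
    by (simp only: abel_sum_cmult abel_sum_reflect[OF g])
  also have "abel_sum (3 * N) g = abel_sum (3 * N) eichler_term + eichler_term (- 1)"
    unfolding g_def by (rule abel_sum_shift_minus[OF antiperiodic_eichler_term])
  finally have s: "- f (- 1) - abel_sum (3 * N) f = - (qpow x d * abel_sum (3 * N) eichler_term)"
    using f[of "- 1"] by (simp add: algebra_simps)
  show "\<exists>L. limit_at d L \<and> - f (- 1) - abel_sum (3 * N) f = - (1 / 2) * L" if "6 * l < h"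
    using limit_at_0[OF that, of d] unfolding s by (intro exI conjI) (assumption, simp)
  have s2: "- f (- 1) - f (- 2) - abel_sum (3 * N) f = - (qpow x d * (abel_sum (3 * N) eichler_term - eichler_term 0))"
    using s f[of "- 2"] by (simp add: algebra_simps)
  show "\<exists>L. limit_at d L \<and> - f (- 1) - f (- 2) - abel_sum (3 * N) f = - (1 / 2) * L" if "h < 6 * l" "6 * l < 3 * h"
    using limit_at_1[OF that, of d] unfolding s2 by (intro exI conjI) (assumption, simp)
qed

end

section \<open>The first five series as Abel sums\<close>

context rational_cusp
begin

abbreviation \<zeta> :: complex where "\<zeta> \<equiv> qpow x 1"

lemma zeta_powi: "\<zeta> powi k = qpow x (of_int k)"
  by (rule qpow_power_int)

lemma zeta_power_eq_1_iff: "\<zeta> ^ k = 1 \<longleftrightarrow> N dvd k"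
proof -
  have "\<zeta> ^ k = qpow x (real k)" by (simp add: qpow_power)
  also have "\<dots> = exp (of_real (2 * pi * (real (M * k) / real N)) * \<i>)"
    by (simp add: qpow_def x_def algebra_simps)
  also have "\<dots> = 1 \<longleftrightarrow> (\<exists>j::int. real (M * k) / real N = of_int j)"
  proof -
    have "exp (of_real (2 * pi * y) * \<i>) = 1 \<longleftrightarrow> (\<exists>j::int. y = of_int j)" for y :: real
      by (simp add: exp_eq_1 mult_ac)
    then show ?thesis .
  qed
  also have "\<dots> \<longleftrightarrow> N dvd M * k"
  proof
    assume "\<exists>j::int. real (M * k) / real N = of_int j"
    then obtain j :: int where "real (M * k) / real N = of_int j" ..
    then have "real_of_int (int (M * k)) = real_of_int (j * int N)" using N_pos by (simp add: field_simps)
    then have "int (M * k) = j * int N" by (simp only: of_int_eq_iff)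
    then have "int N dvd int (M * k)" by simp
    then show "N dvd M * k" by (simp only: of_nat_dvd_iff)
  next
    assume "N dvd M * k"
    then obtain j where "M * k = N * j" by auto
    then have "real (M * k) / real N = of_int (int j)" using N_pos by simp
    then show "\<exists>j::int. real (M * k) / real N = of_int j" by blast
  qed
  also have "\<dots> \<longleftrightarrow> N dvd k" using coprime_MN by (simp add: coprime_dvd_mult_right_iff coprime_commute)
  finally show ?thesis .
qed

lemma not_dvd_less: "0 < k \<Longrightarrow> k < N \<Longrightarrow> \<not> N dvd k"
  by (auto dest: dvd_imp_le)

sublocale root: primitive_root \<zeta> N
  by unfold_locales (simp_all only: N_pos zeta_power_eq_1_iff dvd_refl not_dvd_less not_False_eq_True)

sublocale inv_root: primitive_root "inverse \<zeta>" N
  by unfold_locales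
    (simp_all only: N_pos power_inverse inverse_eq_1_iff zeta_power_eq_1_iff dvd_refl not_dvd_less not_False_eq_True)

lemma norm_zeta: "norm \<zeta> = 1"
  by (simp add: qpow_def x_def)

lemma hexagonal_char_exponent:
  assumes "hexagonal_char m \<noteq> 0"
  shows "real_of_int ((m + 1) * (m + 2) div 6) = (of_int m + 1) * (of_int m + 2) / 6"
proof -
  have "m mod 6 \<in> {1, 2, 4, 5}" using assms unfolding hexagonal_char_def by (auto split: if_splits)
  moreover have "(m + 1) * (m + 2) mod 6 = ((m mod 6 + 1) * (m mod 6 + 2)) mod 6"
    by (rule mod_mult_cong) (simp_all add: mod_simps)
  ultimately have "(m + 1) * (m + 2) mod 6 = 0" by auto
  then have "6 dvd (m + 1) * (m + 2)" by auto
  then have "real_of_int ((m + 1) * (m + 2) div 6) = real_of_int ((m + 1) * (m + 2)) / real_of_int 6"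
    by (rule real_of_int_div)
  then show ?thesis by simp
qed

text \<open>Real exponents are needed to complete the square, which produces denominators 24 h
  outside the integral powers of \<open>\<zeta>\<close>.\<close>

lemma trefoil_coeff_zeta:
  "trefoil_coeff \<zeta> m = hexagonal_char m * qpow x (- ((of_int m + 1) * (of_int m + 2) / 6))"
  "trefoil_coeff (inverse \<zeta>) m = hexagonal_char m * qpow x ((of_int m + 1) * (of_int m + 2) / 6)"
proof -
  define k where "k = (m + 1) * (m + 2) div 6"
  have k: "of_int k = (of_int m + 1) * (of_int m + 2) / (6::real)" if "hexagonal_char m \<noteq> 0"
    unfolding k_def by (rule hexagonal_char_exponent[OF that])
  have "inverse \<zeta> powi (- k) = \<zeta> powi k" by (simp add: power_int_inverse power_int_minus)
  moreover have "\<zeta> powi (- k) = qpow x (- of_int k)" unfolding zeta_powi by simp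
  ultimately have t: "trefoil_coeff \<zeta> m = hexagonal_char m * qpow x (- of_int k)"
    "trefoil_coeff (inverse \<zeta>) m = hexagonal_char m * qpow x (of_int k)"
    by (simp_all only: trefoil_coeff_def k_def[symmetric] zeta_powi)
  have "hexagonal_char m = 0 \<or> real_of_int k = (of_int m + 1) * (of_int m + 2) / 6" using k by blast
  then show "trefoil_coeff \<zeta> m = hexagonal_char m * qpow x (- ((of_int m + 1) * (of_int m + 2) / 6))"
    "trefoil_coeff (inverse \<zeta>) m = hexagonal_char m * qpow x ((of_int m + 1) * (of_int m + 2) / 6)"
    unfolding t by (elim disjE; simp only: mult_zero_left)+
qed

lemma zeta_powi_periodic: "a = b + int N * c \<Longrightarrow> \<zeta> powi a = \<zeta> powi b"
  using root.q_nonzero by (simp only: power_int_add root.powi_mult_N simp_thms mult_1_right)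

lemma chain_inner_at_0: "a 0 = 1 \<Longrightarrow> chain_inner a q p 0 = 1"
  by (induction p) auto

lemma qpoch_vanish: "n \<ge> N \<Longrightarrow> qpoch (\<zeta> ^ j) \<zeta> n = 0"
  by (rule qpoch_root_of_unity_eq_0[OF root.q_power_N N_pos])

lemma zeta_powi_inverse_power: "\<zeta> powi (- int n) = inverse \<zeta> ^ n"
  by (simp add: power_int_minus power_inverse)

lemma square_periodic: "\<zeta> powi (c * (m + int N)\<^sup>2) = \<zeta> powi (c * m\<^sup>2)"
  by (rule zeta_powi_periodic[where c = "c * (2 * m + int N)"]) (simp add: power2_eq_square algebra_simps)

lemma quadratic_periodic: "\<zeta> powi (c * ((m + int N)\<^sup>2 + (m + int N)) + d * (m + int N)) = \<zeta> powi (c * (m\<^sup>2 + m) + d * m)"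
  by (rule zeta_powi_periodic[where c = "c * (2 * m + int N + 1) + d"]) (simp add: power2_eq_square algebra_simps)

lemma H1_eq:
  "H1 (Suc p) \<zeta> = 1 - \<zeta> * abel_sum (3 * N) (\<lambda>m. trefoil_coeff \<zeta> m * \<zeta> powi (int (Suc p) * ((m - 2)\<^sup>2 + (m - 2))))"
proof -
  define w where "w = (\<lambda>k. \<zeta> powi (int (Suc p) * (k\<^sup>2 + k)))"
  have per: "w (k + int N) = w k" for k using quadratic_periodic[of "int (Suc p)" k 0] by (simp add: w_def)
  have "H1 (Suc p) \<zeta> = (\<Sum>n<N. \<zeta> ^ n * qpoch (\<zeta> ^ (n + 1)) \<zeta> (n + 1) * chain_inner (\<lambda>r. \<zeta> ^ (r * (r + 1))) \<zeta> p n)"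
    unfolding H1_def by (rule chain_sum_eq) (simp only: qpoch_vanish le_SucI Suc_eq_plus1[symmetric] mult_zero_right)
  also have "\<dots> = (\<Sum>n<N. \<zeta> ^ n * jacobi_sum \<zeta> w n (n + 1))"
    unfolding w_def chain_jacobi_unit_circle(3)[OF norm_zeta, symmetric] by (simp only: mult.assoc)
  also have "\<dots> = w (- 1) - \<zeta> * abel_sum (3 * N) (\<lambda>m. trefoil_coeff \<zeta> m * w (m - 2))"
    by (rule root.sum_jacobi_sum_eq(3)[of w, OF per])
  finally show ?thesis by (simp add: w_def)
qed

lemma H2_eq:
  "H2 (Suc p) \<zeta> = 1 + \<zeta> ^ Suc p - abel_sum (3 * N) (\<lambda>m. trefoil_coeff \<zeta> m * \<zeta> powi (int (Suc p) * (m + 2)\<^sup>2))"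
proof -
  define w where "w = (\<lambda>k. \<zeta> powi (int (Suc p) * k\<^sup>2))"
  have per: "w (k + int N) = w k" for k unfolding w_def by (rule square_periodic)
  \<comment> \<open>One vanishing term n = N is added, so that splitting off n = 0, where n - 1
    makes no sense, leaves exactly N terms.\<close>
  have "H2 (Suc p) \<zeta> = (\<Sum>n<Suc N. \<zeta> ^ n * qpoch (\<zeta> ^ n) \<zeta> n * chain_inner (\<lambda>r. \<zeta> ^ (r\<^sup>2)) \<zeta> p n)"
    unfolding H2_def by (rule chain_sum_eq) (simp only: qpoch_vanish Suc_leD mult_zero_right)
  also have "\<dots> = 1 + (\<Sum>n<N. \<zeta> ^ Suc n * (qpoch (\<zeta> ^ Suc n) \<zeta> (Suc n) * chain_inner (\<lambda>r. \<zeta> ^ (r\<^sup>2)) \<zeta> p (Suc n)))"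
    unfolding sum.lessThan_Suc_shift by (simp add: chain_inner_at_0 mult.assoc)
  also have "\<dots> = 1 + (\<Sum>n<N. \<zeta> ^ Suc n * jacobi_sum \<zeta> w (Suc n) n)"
    unfolding w_def chain_jacobi_unit_circle(2)[OF norm_zeta, symmetric] ..
  also have "\<dots> = 1 + (w 1 - abel_sum (3 * N) (\<lambda>m. trefoil_coeff \<zeta> m * w (m + 2)))"
    by (subst root.sum_jacobi_sum_eq(2)[of w, OF per]) (rule refl)
  finally show ?thesis by (simp add: w_def flip: power_int_of_nat)
qed

lemma H3_eq:
  "H3 (Suc p) \<zeta> = abel_sum (3 * N) (\<lambda>m. trefoil_coeff \<zeta> m * \<zeta> powi (int (Suc p) * (m\<^sup>2 + m) + m))"
proof -
  define w where "w = (\<lambda>k. \<zeta> powi (int (Suc p) * (k\<^sup>2 + k) + k))"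
  have per: "w (k + int N) = w k" for k using quadratic_periodic[of "int (Suc p)" k 1] by (simp add: w_def)
  have "H3 (Suc p) \<zeta> = (\<Sum>n<N. \<zeta> ^ (2 * n) * qpoch (\<zeta> ^ (n + 1)) \<zeta> n * chain_inner (\<lambda>r. \<zeta> ^ (r * (r + 1))) \<zeta> p n)"
    unfolding H3_def by (rule chain_sum_eq) (simp only: qpoch_vanish mult_zero_right)
  also have "\<dots> = (\<Sum>n<N. \<zeta> ^ n * jacobi_sum \<zeta> w n n)"
    unfolding w_def chain_jacobi_unit_circle(5)[OF norm_zeta, symmetric] by (simp add: mult_2 power_add mult.assoc)
  also have "\<dots> = abel_sum (3 * N) (\<lambda>m. trefoil_coeff \<zeta> m * w m)"
    by (rule root.sum_jacobi_sum_eq(1)[of w, OF per])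
  finally show ?thesis by (simp add: w_def)
qed

lemma H4_eq:
  "H4 (Suc p) \<zeta> = abel_sum (3 * N) (\<lambda>m. trefoil_coeff \<zeta> m * \<zeta> powi (int (Suc p) * (m\<^sup>2 + m)))"
proof -
  define w where "w = (\<lambda>k. \<zeta> powi (int (Suc p) * (k\<^sup>2 + k)))"
  have per: "w (k + int N) = w k" for k using quadratic_periodic[of "int (Suc p)" k 0] by (simp add: w_def)
  have "H4 (Suc p) \<zeta> = (\<Sum>n<N. \<zeta> ^ n * qpoch (\<zeta> ^ (n + 1)) \<zeta> n * chain_inner (\<lambda>r. \<zeta> ^ (r * (r + 1))) \<zeta> p n)"
    unfolding H4_def by (rule chain_sum_eq) (simp only: qpoch_vanish mult_zero_right)
  also have "\<dots> = (\<Sum>n<N. \<zeta> ^ n * jacobi_sum \<zeta> w n n)"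
    unfolding w_def chain_jacobi_unit_circle(4)[OF norm_zeta, symmetric] by (simp only: mult.assoc)
  also have "\<dots> = abel_sum (3 * N) (\<lambda>m. trefoil_coeff \<zeta> m * w m)"
    by (rule root.sum_jacobi_sum_eq(1)[of w, OF per])
  finally show ?thesis by (simp add: w_def)
qed

lemma H5_eq:
  "H5 (Suc p) \<zeta> = abel_sum (3 * N) (\<lambda>m. trefoil_coeff \<zeta> m * \<zeta> powi (int (Suc p) * m\<^sup>2))"
proof -
  define w where "w = (\<lambda>k. \<zeta> powi (int (Suc p) * k\<^sup>2))"
  have per: "w (k + int N) = w k" for k unfolding w_def by (rule square_periodic)
  have "H5 (Suc p) \<zeta> = (\<Sum>n<N. \<zeta> ^ n * qpoch (\<zeta> ^ (n + 1)) \<zeta> n * chain_inner (\<lambda>r. \<zeta> ^ (r\<^sup>2)) \<zeta> p n)"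
    unfolding H5_def by (rule chain_sum_eq) (simp only: qpoch_vanish mult_zero_right)
  also have "\<dots> = (\<Sum>n<N. \<zeta> ^ n * jacobi_sum \<zeta> w n n)"
    unfolding w_def chain_jacobi_unit_circle(1)[OF norm_zeta, symmetric] by (simp only: mult.assoc)
  also have "\<dots> = abel_sum (3 * N) (\<lambda>m. trefoil_coeff \<zeta> m * w m)"
    by (rule root.sum_jacobi_sum_eq(1)[of w, OF per])
  finally show ?thesis by (simp add: w_def)
qed

end

lemma hexagonal_char_minus: "hexagonal_char (- m) = - hexagonal_char m"
proof -
  have "(- m) mod 6 = (- (m mod 6)) mod 6" by (simp add: mod_simps)
  moreover have "m mod 6 \<in> {0, 1, 2, 3, 4, 5}" unfolding insert_iff empty_iff by presburger
  ultimately show ?thesis unfolding hexagonal_char_def by auto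
qed

lemma hexagonal_char_add_3: "hexagonal_char (m + 3) = - hexagonal_char m"
  using hexagonal_char_minus_3[of "m + 3"] by simp

section \<open>The last five series by inversion of the root\<close>

context rational_cusp
begin

lemma jacobi_sum_zeta:
  "jacobi_sum \<zeta> w n m = \<zeta> ^ (n * m) * jacobi_sum (inverse \<zeta>) (\<lambda>k. w k * \<zeta> powi ((int n - int m - 1) * k)) n m"
  by (rule jacobi_sum_inverse[OF root.q_nonzero])

lemma zeta_powi_mult: "\<zeta> powi a * \<zeta> powi b = \<zeta> powi (a + b)"
  using root.q_nonzero by (simp add: power_int_add)

lemma square_plus_self: "r\<^sup>2 + r = r * (r + 1)" for r :: nat
  by (simp add: power2_eq_square)

text \<open>Inversion twists the weight by - k and brings in a power n^2, which the prefactor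
  removes. Starting from the identity whose weight has an extra + k cancels the twist.\<close>

lemma H6_eq:
  "H6 (Suc p) \<zeta> = abel_sum (3 * N) (\<lambda>m. trefoil_coeff (inverse \<zeta>) m * \<zeta> powi (int (Suc p) * (m\<^sup>2 + m)))"
proof -
  define w where "w = (\<lambda>k. \<zeta> powi (int (Suc p) * (k\<^sup>2 + k)))"
  have per: "w (k + int N) = w k" for k using quadratic_periodic[of "int (Suc p)" k 0] by (simp add: w_def)
  have "H6 (Suc p) \<zeta> = (\<Sum>n<N. \<zeta> powi (- int (n\<^sup>2)) * qpoch (\<zeta> ^ (n + 1)) \<zeta> n *
      chain_inner (\<lambda>r. \<zeta> ^ (r\<^sup>2 + r)) \<zeta> p n)"
    unfolding H6_def by (rule chain_sum_eq) (simp only: qpoch_vanish mult_zero_right)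
  also have "\<dots> = (\<Sum>n<N. inverse \<zeta> ^ n * jacobi_sum (inverse \<zeta>) w n n)"
  proof (rule sum.cong[OF refl])
    fix n
    define X where "X = qpoch (\<zeta> ^ (n + 1)) \<zeta> n * chain_inner (\<lambda>r. \<zeta> ^ (r\<^sup>2 + r)) \<zeta> p n"
    have "\<zeta> ^ n * X = jacobi_sum \<zeta> (\<lambda>k. \<zeta> powi (int (Suc p) * (k\<^sup>2 + k) + k)) n n"
      unfolding X_def square_plus_self by (rule chain_jacobi_unit_circle(5)[OF norm_zeta])
    also have "\<dots> = \<zeta> ^ (n\<^sup>2) * jacobi_sum (inverse \<zeta>) w n n"
      unfolding jacobi_sum_zeta zeta_powi_mult by (simp add: w_def power2_eq_square)
    finally have "\<zeta> powi (- int (n\<^sup>2)) * X = inverse \<zeta> ^ n * jacobi_sum (inverse \<zeta>) w n n"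
      unfolding zeta_powi_inverse_power using root.q_nonzero by (simp add: field_simps)
    then show "\<zeta> powi (- int (n\<^sup>2)) * qpoch (\<zeta> ^ (n + 1)) \<zeta> n * chain_inner (\<lambda>r. \<zeta> ^ (r\<^sup>2 + r)) \<zeta> p n =
        inverse \<zeta> ^ n * jacobi_sum (inverse \<zeta>) w n n" by (simp only: X_def mult.assoc)
  qed
  also have "\<dots> = abel_sum (3 * N) (\<lambda>m. trefoil_coeff (inverse \<zeta>) m * w m)"
    by (rule inv_root.sum_jacobi_sum_eq(1)[of w, OF per])
  finally show ?thesis by (simp add: w_def)
qed

lemma H7_eq:
  "H7 (Suc p) \<zeta> = abel_sum (3 * N) (\<lambda>m. trefoil_coeff (inverse \<zeta>) m * \<zeta> powi (int (Suc p) * (m\<^sup>2 + m) - m))"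
proof -
  define w where "w = (\<lambda>k. \<zeta> powi (int (Suc p) * (k\<^sup>2 + k) + - 1 * k))"
  have per: "w (k + int N) = w k" for k using quadratic_periodic[of "int (Suc p)" k "- 1"] by (simp only: w_def)
  have "H7 (Suc p) \<zeta> = (\<Sum>n<N. \<zeta> powi (- int (n\<^sup>2) - int n) * qpoch (\<zeta> ^ (n + 1)) \<zeta> n *
      chain_inner (\<lambda>r. \<zeta> ^ (r\<^sup>2 + r)) \<zeta> p n)"
    unfolding H7_def by (rule chain_sum_eq) (simp only: qpoch_vanish mult_zero_right)
  also have "\<dots> = (\<Sum>n<N. inverse \<zeta> ^ n * jacobi_sum (inverse \<zeta>) w n n)"
  proof (rule sum.cong[OF refl])
    fix n
    define X where "X = qpoch (\<zeta> ^ (n + 1)) \<zeta> n * chain_inner (\<lambda>r. \<zeta> ^ (r\<^sup>2 + r)) \<zeta> p n"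
    have "X = jacobi_sum \<zeta> (\<lambda>k. \<zeta> powi (int (Suc p) * (k\<^sup>2 + k))) n n"
      unfolding X_def square_plus_self by (rule chain_jacobi_unit_circle(4)[OF norm_zeta])
    also have "\<dots> = \<zeta> ^ (n\<^sup>2) * jacobi_sum (inverse \<zeta>) w n n"
      unfolding jacobi_sum_zeta zeta_powi_mult by (simp add: w_def power2_eq_square)
    finally have "\<zeta> powi (- int (n\<^sup>2 + n)) * X = inverse \<zeta> ^ n * jacobi_sum (inverse \<zeta>) w n n"
      unfolding zeta_powi_inverse_power using root.q_nonzero by (simp add: power_add field_simps)
    moreover have "- int (n\<^sup>2) - int n = - int (n\<^sup>2 + n)" by simp
    ultimately show "\<zeta> powi (- int (n\<^sup>2) - int n) * qpoch (\<zeta> ^ (n + 1)) \<zeta> n * chain_inner (\<lambda>r. \<zeta> ^ (r\<^sup>2 + r)) \<zeta> p n =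
        inverse \<zeta> ^ n * jacobi_sum (inverse \<zeta>) w n n" by (simp only: X_def mult.assoc)
  qed
  also have "\<dots> = abel_sum (3 * N) (\<lambda>m. trefoil_coeff (inverse \<zeta>) m * w m)"
    by (rule inv_root.sum_jacobi_sum_eq(1)[of w, OF per])
  finally show ?thesis by (simp add: w_def)
qed

text \<open>For the range (n, n + 1) the twist is - 2 k, so the boundary value at k = -1 is
  \<open>\<zeta>\<^sup>2\<close> instead of 1.\<close>

lemma H8_eq:
  "H8 (Suc p) \<zeta> = \<zeta>\<^sup>2 - inverse \<zeta> * abel_sum (3 * N) (\<lambda>m. trefoil_coeff (inverse \<zeta>) m *
    \<zeta> powi (int (Suc p) * ((m - 2)\<^sup>2 + (m - 2)) - 2 * (m - 2)))"
proof -
  define w where "w = (\<lambda>k. \<zeta> powi (int (Suc p) * (k\<^sup>2 + k) + - 2 * k))"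
  have per: "w (k + int N) = w k" for k using quadratic_periodic[of "int (Suc p)" k "- 2"] by (simp only: w_def)
  have "H8 (Suc p) \<zeta> = (\<Sum>n<N. \<zeta> powi (- int (n * (n + 2))) * qpoch (\<zeta> ^ (n + 1)) \<zeta> (n + 1) *
      chain_inner (\<lambda>r. \<zeta> ^ (r * (r + 1))) \<zeta> p n)"
    unfolding H8_def by (rule chain_sum_eq) (simp only: qpoch_vanish le_SucI Suc_eq_plus1[symmetric] mult_zero_right)
  also have "\<dots> = (\<Sum>n<N. inverse \<zeta> ^ n * jacobi_sum (inverse \<zeta>) w n (n + 1))"
  proof (rule sum.cong[OF refl])
    fix n
    define X where "X = qpoch (\<zeta> ^ (n + 1)) \<zeta> (n + 1) * chain_inner (\<lambda>r. \<zeta> ^ (r * (r + 1))) \<zeta> p n"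
    have "X = jacobi_sum \<zeta> (\<lambda>k. \<zeta> powi (int (Suc p) * (k\<^sup>2 + k))) n (n + 1)"
      unfolding X_def by (rule chain_jacobi_unit_circle(3)[OF norm_zeta])
    also have "\<dots> = \<zeta> ^ (n * (n + 1)) * jacobi_sum (inverse \<zeta>) w n (n + 1)"
      unfolding jacobi_sum_zeta zeta_powi_mult by (simp add: w_def)
    finally have "X = \<zeta> ^ (n * (n + 1)) * jacobi_sum (inverse \<zeta>) w n (n + 1)" .
    moreover have "n * (n + 2) = n * (n + 1) + n" by simp
    ultimately have "\<zeta> powi (- int (n * (n + 2))) * X = inverse \<zeta> ^ n * jacobi_sum (inverse \<zeta>) w n (n + 1)"
      unfolding zeta_powi_inverse_power using root.q_nonzero by (simp add: power_add field_simps)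
    then show "\<zeta> powi (- int (n * (n + 2))) * qpoch (\<zeta> ^ (n + 1)) \<zeta> (n + 1) * chain_inner (\<lambda>r. \<zeta> ^ (r * (r + 1))) \<zeta> p n =
        inverse \<zeta> ^ n * jacobi_sum (inverse \<zeta>) w n (n + 1)" by (simp only: X_def mult.assoc)
  qed
  also have "\<dots> = w (- 1) - inverse \<zeta> * abel_sum (3 * N) (\<lambda>m. trefoil_coeff (inverse \<zeta>) m * w (m - 2))"
    by (rule inv_root.sum_jacobi_sum_eq(3)[of w, OF per])
  finally show ?thesis by (simp add: w_def)
qed

lemma H9_eq:
  "H9 (Suc p) \<zeta> = abel_sum (3 * N) (\<lambda>m. trefoil_coeff (inverse \<zeta>) m * \<zeta> powi (int (Suc p) * m\<^sup>2 - m))"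
proof -
  define w where "w = (\<lambda>k. \<zeta> powi (int (Suc p) * k\<^sup>2 - k))"
  have per: "w (k + int N) = w k" for k
    unfolding w_def by (rule zeta_powi_periodic[where c = "int (Suc p) * (2 * k + int N) - 1"])
      (simp add: power2_eq_square algebra_simps)
  have "H9 (Suc p) \<zeta> = (\<Sum>n<N. \<zeta> powi (- int (n\<^sup>2) - int n) * qpoch (\<zeta> ^ (n + 1)) \<zeta> n *
      chain_inner (\<lambda>r. \<zeta> ^ (r\<^sup>2)) \<zeta> p n)"
    unfolding H9_def by (rule chain_sum_eq) (simp only: qpoch_vanish mult_zero_right)
  also have "\<dots> = (\<Sum>n<N. inverse \<zeta> ^ n * jacobi_sum (inverse \<zeta>) w n n)"
  proof (rule sum.cong[OF refl])
    fix n
    define X where "X = qpoch (\<zeta> ^ (n + 1)) \<zeta> n * chain_inner (\<lambda>r. \<zeta> ^ (r\<^sup>2)) \<zeta> p n"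
    have "X = jacobi_sum \<zeta> (\<lambda>k. \<zeta> powi (int (Suc p) * k\<^sup>2)) n n"
      unfolding X_def by (rule chain_jacobi_unit_circle(1)[OF norm_zeta])
    also have "\<dots> = \<zeta> ^ (n\<^sup>2) * jacobi_sum (inverse \<zeta>) w n n"
      unfolding jacobi_sum_zeta zeta_powi_mult by (simp add: w_def power2_eq_square)
    finally have "\<zeta> powi (- int (n\<^sup>2 + n)) * X = inverse \<zeta> ^ n * jacobi_sum (inverse \<zeta>) w n n"
      unfolding zeta_powi_inverse_power using root.q_nonzero by (simp add: power_add field_simps)
    moreover have "- int (n\<^sup>2) - int n = - int (n\<^sup>2 + n)" by simp
    ultimately show "\<zeta> powi (- int (n\<^sup>2) - int n) * qpoch (\<zeta> ^ (n + 1)) \<zeta> n * chain_inner (\<lambda>r. \<zeta> ^ (r\<^sup>2)) \<zeta> p n =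
        inverse \<zeta> ^ n * jacobi_sum (inverse \<zeta>) w n n" by (simp only: X_def mult.assoc)
  qed
  also have "\<dots> = abel_sum (3 * N) (\<lambda>m. trefoil_coeff (inverse \<zeta>) m * w m)"
    by (rule inv_root.sum_jacobi_sum_eq(1)[of w, OF per])
  finally show ?thesis by (simp add: w_def)
qed

lemma H10_eq:
  "H10 (Suc p) \<zeta> = 1 + \<zeta> ^ Suc p - abel_sum (3 * N) (\<lambda>m. trefoil_coeff (inverse \<zeta>) m * \<zeta> powi (int (Suc p) * (m + 2)\<^sup>2))"
proof -
  define w where "w = (\<lambda>k. \<zeta> powi (int (Suc p) * k\<^sup>2))"
  have per: "w (k + int N) = w k" for k unfolding w_def by (rule square_periodic)
  have "H10 (Suc p) \<zeta> = (\<Sum>n<Suc N. \<zeta> powi (- int (n\<^sup>2)) * qpoch (\<zeta> ^ n) \<zeta> n * chain_inner (\<lambda>r. \<zeta> ^ (r\<^sup>2)) \<zeta> p n)"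
    unfolding H10_def by (rule chain_sum_eq) (simp only: qpoch_vanish Suc_leD mult_zero_right)
  also have "\<dots> = 1 + (\<Sum>n<N. \<zeta> powi (- int ((Suc n)\<^sup>2)) * (qpoch (\<zeta> ^ Suc n) \<zeta> (Suc n) * chain_inner (\<lambda>r. \<zeta> ^ (r\<^sup>2)) \<zeta> p (Suc n)))"
    unfolding sum.lessThan_Suc_shift by (simp add: chain_inner_at_0 mult.assoc)
  also have "(\<Sum>n<N. \<zeta> powi (- int ((Suc n)\<^sup>2)) * (qpoch (\<zeta> ^ Suc n) \<zeta> (Suc n) * chain_inner (\<lambda>r. \<zeta> ^ (r\<^sup>2)) \<zeta> p (Suc n))) =
      (\<Sum>n<N. inverse \<zeta> ^ Suc n * jacobi_sum (inverse \<zeta>) w (Suc n) n)"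
  proof (rule sum.cong[OF refl])
    fix n
    have "(Suc n)\<^sup>2 = Suc n + Suc n * n" by (simp add: power2_eq_square)
    moreover have "jacobi_sum \<zeta> w (Suc n) n = \<zeta> ^ (Suc n * n) * jacobi_sum (inverse \<zeta>) w (Suc n) n"
      by (subst jacobi_sum_zeta) simp
    ultimately have "\<zeta> powi (- int ((Suc n)\<^sup>2)) * jacobi_sum \<zeta> w (Suc n) n = inverse \<zeta> ^ Suc n * jacobi_sum (inverse \<zeta>) w (Suc n) n"
      unfolding zeta_powi_inverse_power using root.q_nonzero by (simp only: power_add power_inverse) (simp add: field_simps)
    then show "\<zeta> powi (- int ((Suc n)\<^sup>2)) * (qpoch (\<zeta> ^ Suc n) \<zeta> (Suc n) * chain_inner (\<lambda>r. \<zeta> ^ (r\<^sup>2)) \<zeta> p (Suc n)) =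
        inverse \<zeta> ^ Suc n * jacobi_sum (inverse \<zeta>) w (Suc n) n"
      unfolding chain_jacobi_unit_circle(2)[OF norm_zeta] w_def .
  qed
  also have "\<dots> = w 1 - abel_sum (3 * N) (\<lambda>m. trefoil_coeff (inverse \<zeta>) m * w (m + 2))"
    by (rule inv_root.sum_jacobi_sum_eq(2)[of w, OF per])
  finally show ?thesis by (simp add: w_def flip: power_int_of_nat)
qed

end

section \<open>Completing the square\<close>

context chi_23_cusp
begin

text \<open>Here \<open>u\<close> is the exponent of the trefoil coefficient and \<open>v\<close>
  that of the weight. The numbers \<open>c\<close> and \<open>z\<close> are read off the claimed
  prefactor, so each evaluation reduces to the polynomial identity in the last hypothesis.\<close>

lemma eichler_term_match:
  assumes "hexagonal_char a = hexagonal_char (b + 2)"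
    and d: "d = c - z\<^sup>2 / (24 * of_int h)"
    and sq: "(of_int h * (2 * of_int b + 1) - 6 * of_int l)\<^sup>2 = z\<^sup>2 + 24 * of_int h * (u + v - c)"
  shows "hexagonal_char a * qpow x u * qpow x v = qpow x d * eichler_term b"
proof -
  have "(of_int h * (2 * of_int b + 1) - 6 * of_int l)\<^sup>2 / (24 * of_int h) = z\<^sup>2 / (24 * of_int h) + (u + v - c)"
    unfolding sq using h by (simp add: add_divide_distrib)
  then have "u + v = d + (of_int h * (2 * of_int b + 1) - 6 * of_int l)\<^sup>2 / (24 * of_int h)"
    by (simp add: d)
  then have "qpow x u * qpow x v = qpow x d * qpow x ((of_int h * (2 * of_int b + 1) - 6 * of_int l)\<^sup>2 / (24 * of_int h))"
    by (metis qpow_add)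
  then show ?thesis by (simp add: assms(1) eichler_term_def mult_ac)
qed

lemma eichler_term_match_minus:
  assumes "hexagonal_char a = - hexagonal_char (b + 2)"
    and "d = c - z\<^sup>2 / (24 * of_int h)"
    and "(of_int h * (2 * of_int b + 1) - 6 * of_int l)\<^sup>2 = z\<^sup>2 + 24 * of_int h * (u + v - c)"
  shows "hexagonal_char a * qpow x u * qpow x v = - (qpow x d * eichler_term b)"
  using eichler_term_match[of "- a" b d c z u v] assms by (simp add: hexagonal_char_minus)

end

lemma coprime_6: "coprime (6 * k - 1) (6 :: int)" "coprime (6 * k + 1) (6 :: int)"
proof -
  have 1: "6 * k - (6 * k - 1) = 1" "(6 * k + 1) - 6 * k = 1" by simp_all
  show "coprime (6 * k - 1) (6 :: int)"
    by (rule coprimeI) (metis 1(1) dvd_diff dvd_mult2)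
  show "coprime (6 * k + 1) (6 :: int)"
    by (rule coprimeI) (metis 1(2) dvd_diff dvd_mult2)
qed

lemma hexagonal_char_3_minus: "hexagonal_char (3 - m) = hexagonal_char m"
  using hexagonal_char_add_3[of "- m"] by (simp add: hexagonal_char_minus)

section \<open>The ten evaluations\<close>

context rational_cusp
begin

lemma H3_limit:
  assumes "p \<ge> 1"
  shows "\<exists>L. has_cusp_limit (\<lambda>\<tau>. qpow \<tau> (- 1 - (6 * real p - 5)\<^sup>2 / (24 * (6 * real p - 1))) * eichler (2, 3, 6 * int p - 1) (1, 1, 2 * int p - 1) \<tau>) (real M / real N) L \<and>
    H3 p \<zeta> = - (1 / 2) * L"
proof -
  obtain p' where p: "p = Suc p'" using assms by (cases p) auto
  interpret chi_23_cusp "6 * int p - 1" "2 * int p - 1" M N x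
    by unfold_locales (use assms coprime_6 in auto)
  show ?thesis
    unfolding p H3_eq unfolding p[symmetric]
  proof (rule abel_sum_shift_succ)
    fix m
    have "trefoil_coeff \<zeta> m * \<zeta> powi (int p * (m\<^sup>2 + m) + m) = hexagonal_char m * qpow x (- ((of_int m + 1) * (of_int m + 2) / 6)) * qpow x (real p * ((of_int m)\<^sup>2 + of_int m) + of_int m)"
      by (simp add: trefoil_coeff_zeta zeta_powi)
    also have "\<dots> = - (qpow x (- 1 - (6 * real p - 5)\<^sup>2 / (24 * (6 * real p - 1))) * eichler_term (m + 1))"
    proof (rule eichler_term_match_minus[where c = "- 1" and z = "6 * real p - 5"])
      show "hexagonal_char m = - hexagonal_char (m + 1 + 2)"
        using hexagonal_char_add_3[of m] by (simp add: add.commute)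
    qed (simp_all add: power2_eq_square field_simps)
    finally show "trefoil_coeff \<zeta> m * \<zeta> powi (int p * (m\<^sup>2 + m) + m) = - (qpow x (- 1 - (6 * real p - 5)\<^sup>2 / (24 * (6 * real p - 1))) * eichler_term (m + 1))" .
  qed (use assms in auto)
qed

lemma H4_limit:
  assumes "p \<ge> 1"
  shows "\<exists>L. has_cusp_limit (\<lambda>\<tau>. qpow \<tau> (- ((6 * real p + 1)\<^sup>2 / (24 * (6 * real p - 1)))) * eichler (2, 3, 6 * int p - 1) (1, 1, 2 * int p) \<tau>) (real M / real N) L \<and>
    H4 p \<zeta> = - (1 / 2) * L"
proof -
  obtain p' where p: "p = Suc p'" using assms by (cases p) auto
  interpret chi_23_cusp "6 * int p - 1" "2 * int p" M N x
    by unfold_locales (use assms coprime_6 in auto)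
  show ?thesis
    unfolding p H4_eq unfolding p[symmetric]
  proof (rule abel_sum_shift_succ)
    fix m
    have "trefoil_coeff \<zeta> m * \<zeta> powi (int p * (m\<^sup>2 + m)) = hexagonal_char m * qpow x (- ((of_int m + 1) * (of_int m + 2) / 6)) * qpow x (real p * ((of_int m)\<^sup>2 + of_int m))"
      by (simp add: trefoil_coeff_zeta zeta_powi)
    also have "\<dots> = - (qpow x (- ((6 * real p + 1)\<^sup>2 / (24 * (6 * real p - 1)))) * eichler_term (m + 1))"
    proof (rule eichler_term_match_minus[where c = "0" and z = "6 * real p + 1"])
      show "hexagonal_char m = - hexagonal_char (m + 1 + 2)"
        using hexagonal_char_add_3[of m] by (simp add: add.commute)
    qed (simp_all add: power2_eq_square field_simps)
    finally show "trefoil_coeff \<zeta> m * \<zeta> powi (int p * (m\<^sup>2 + m)) = - (qpow x (- ((6 * real p + 1)\<^sup>2 / (24 * (6 * real p - 1)))) * eichler_term (m + 1))" .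
  qed (use assms in auto)
qed

lemma H5_limit:
  assumes "p \<ge> 1"
  shows "\<exists>L. has_cusp_limit (\<lambda>\<tau>. qpow \<tau> (real p - 1 - (12 * real p - 5)\<^sup>2 / (24 * (6 * real p - 1))) * eichler (2, 3, 6 * int p - 1) (1, 1, 3 * int p - 1) \<tau>) (real M / real N) L \<and>
    H5 p \<zeta> = - (1 / 2) * L"
proof -
  obtain p' where p: "p = Suc p'" using assms by (cases p) auto
  interpret chi_23_cusp "6 * int p - 1" "3 * int p - 1" M N x
    by unfold_locales (use assms coprime_6 in auto)
  show ?thesis
    unfolding p H5_eq unfolding p[symmetric]
  proof (rule abel_sum_reflect_pred)
    fix m
    have "trefoil_coeff \<zeta> m * \<zeta> powi (int p * m\<^sup>2) = hexagonal_char m * qpow x (- ((of_int m + 1) * (of_int m + 2) / 6)) * qpow x (real p * (of_int m)\<^sup>2)"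
      by (simp add: trefoil_coeff_zeta zeta_powi)
    also have "\<dots> = qpow x (real p - 1 - (12 * real p - 5)\<^sup>2 / (24 * (6 * real p - 1))) * eichler_term (1 - m)"
    proof (rule eichler_term_match[where c = "real p - 1" and z = "12 * real p - 5"])
      show "hexagonal_char m = hexagonal_char (1 - m + 2)"
        using hexagonal_char_3_minus[of m] by (simp add: add.commute)
    qed (simp_all add: power2_eq_square field_simps)
    finally show "trefoil_coeff \<zeta> m * \<zeta> powi (int p * m\<^sup>2) = qpow x (real p - 1 - (12 * real p - 5)\<^sup>2 / (24 * (6 * real p - 1))) * eichler_term (1 - m)" .
  qed (use assms in auto)
qed

lemma H6_limit:
  assumes "p \<ge> 1"
  shows "\<exists>L. has_cusp_limit (\<lambda>\<tau>. qpow \<tau> (- ((6 * real p - 1)\<^sup>2 / (24 * (6 * real p + 1)))) * eichler (2, 3, 6 * int p + 1) (1, 1, 2 * int p) \<tau>) (real M / real N) L \<and>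
    H6 p \<zeta> = - (1 / 2) * L"
proof -
  obtain p' where p: "p = Suc p'" using assms by (cases p) auto
  interpret chi_23_cusp "6 * int p + 1" "2 * int p" M N x
    by unfold_locales (use assms coprime_6 in auto)
  show ?thesis
    unfolding p H6_eq unfolding p[symmetric]
  proof (rule abel_sum_shift_succ)
    fix m
    have "trefoil_coeff (inverse \<zeta>) m * \<zeta> powi (int p * (m\<^sup>2 + m)) = hexagonal_char m * qpow x ((of_int m + 1) * (of_int m + 2) / 6) * qpow x (real p * ((of_int m)\<^sup>2 + of_int m))"
      by (simp add: trefoil_coeff_zeta zeta_powi)
    also have "\<dots> = - (qpow x (- ((6 * real p - 1)\<^sup>2 / (24 * (6 * real p + 1)))) * eichler_term (m + 1))"
    proof (rule eichler_term_match_minus[where c = "0" and z = "6 * real p - 1"])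
      show "hexagonal_char m = - hexagonal_char (m + 1 + 2)"
        using hexagonal_char_add_3[of m] by (simp add: add.commute)
    qed (simp_all add: power2_eq_square field_simps)
    finally show "trefoil_coeff (inverse \<zeta>) m * \<zeta> powi (int p * (m\<^sup>2 + m)) = - (qpow x (- ((6 * real p - 1)\<^sup>2 / (24 * (6 * real p + 1)))) * eichler_term (m + 1))" .
  qed (use assms in auto)
qed

lemma H7_limit:
  assumes "p \<ge> 1"
  shows "\<exists>L. has_cusp_limit (\<lambda>\<tau>. qpow \<tau> (1 - (6 * real p + 5)\<^sup>2 / (24 * (6 * real p + 1))) * eichler (2, 3, 6 * int p + 1) (1, 1, 2 * int p + 1) \<tau>) (real M / real N) L \<and>
    H7 p \<zeta> = - (1 / 2) * L"
proof -
  obtain p' where p: "p = Suc p'" using assms by (cases p) auto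
  interpret chi_23_cusp "6 * int p + 1" "2 * int p + 1" M N x
    by unfold_locales (use assms coprime_6 in auto)
  show ?thesis
    unfolding p H7_eq unfolding p[symmetric]
  proof (rule abel_sum_shift_succ)
    fix m
    have "trefoil_coeff (inverse \<zeta>) m * \<zeta> powi (int p * (m\<^sup>2 + m) - m) = hexagonal_char m * qpow x ((of_int m + 1) * (of_int m + 2) / 6) * qpow x (real p * ((of_int m)\<^sup>2 + of_int m) - of_int m)"
      by (simp add: trefoil_coeff_zeta zeta_powi)
    also have "\<dots> = - (qpow x (1 - (6 * real p + 5)\<^sup>2 / (24 * (6 * real p + 1))) * eichler_term (m + 1))"
    proof (rule eichler_term_match_minus[where c = "1" and z = "6 * real p + 5"])
      show "hexagonal_char m = - hexagonal_char (m + 1 + 2)"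
        using hexagonal_char_add_3[of m] by (simp add: add.commute)
    qed (simp_all add: power2_eq_square field_simps)
    finally show "trefoil_coeff (inverse \<zeta>) m * \<zeta> powi (int p * (m\<^sup>2 + m) - m) = - (qpow x (1 - (6 * real p + 5)\<^sup>2 / (24 * (6 * real p + 1))) * eichler_term (m + 1))" .
  qed (use assms in auto)
qed

text \<open>With h = 6p + 1 and z = 12p - 1 = 2h - 3, comparing constant terms in the square gives c
  = (h - 1)/6 = p. The analogous comparison for H_5, with h = 6p - 1, gives (h - 5)/6 = p -
  1.\<close>

lemma H9_limit:
  assumes "p \<ge> 1"
  shows "\<exists>L. has_cusp_limit (\<lambda>\<tau>. qpow \<tau> (real p - (12 * real p - 1)\<^sup>2 / (24 * (6 * real p + 1))) * eichler (2, 3, 6 * int p + 1) (1, 1, 3 * int p) \<tau>) (real M / real N) L \<and>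
    H9 p \<zeta> = - (1 / 2) * L"
proof -
  obtain p' where p: "p = Suc p'" using assms by (cases p) auto
  interpret chi_23_cusp "6 * int p + 1" "3 * int p" M N x
    by unfold_locales (use assms coprime_6 in auto)
  show ?thesis
    unfolding p H9_eq unfolding p[symmetric]
  proof (rule abel_sum_reflect_pred)
    fix m
    have "trefoil_coeff (inverse \<zeta>) m * \<zeta> powi (int p * m\<^sup>2 - m) = hexagonal_char m * qpow x ((of_int m + 1) * (of_int m + 2) / 6) * qpow x (real p * (of_int m)\<^sup>2 - of_int m)"
      by (simp add: trefoil_coeff_zeta zeta_powi)
    also have "\<dots> = qpow x (real p - (12 * real p - 1)\<^sup>2 / (24 * (6 * real p + 1))) * eichler_term (1 - m)"
    proof (rule eichler_term_match[where c = "real p" and z = "12 * real p - 1"])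
      show "hexagonal_char m = hexagonal_char (1 - m + 2)"
        using hexagonal_char_3_minus[of m] by (simp add: add.commute)
    qed (simp_all add: power2_eq_square field_simps)
    finally show "trefoil_coeff (inverse \<zeta>) m * \<zeta> powi (int p * m\<^sup>2 - m) = qpow x (real p - (12 * real p - 1)\<^sup>2 / (24 * (6 * real p + 1))) * eichler_term (1 - m)" .
  qed (use assms in auto)
qed

text \<open>Since 6p - 1 < 6p, the Eichler terms start at index 1, and both boundary values 1 and
  \<open>\<zeta> ^ p\<close> are absorbed.\<close>

lemma H2_limit:
  assumes "p \<ge> 1"
  shows "\<exists>L. has_cusp_limit (\<lambda>\<tau>. qpow \<tau> (- (1 / (24 * (6 * real p - 1)))) * eichler (2, 3, 6 * int p - 1) (1, 1, int p) \<tau>) (real M / real N) L \<and>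
    H2 p \<zeta> = - (1 / 2) * L"
proof -
  obtain p' where p: "p = Suc p'" using assms by (cases p) auto
  interpret chi_23_cusp "6 * int p - 1" "int p" M N x
    by unfold_locales (use assms coprime_6 in auto)
  define f where "f = (\<lambda>m. trefoil_coeff \<zeta> m * \<zeta> powi (int p * (m + 2)\<^sup>2))"
  have H: "H2 p \<zeta> = 1 + \<zeta> ^ p - abel_sum (3 * N) f"
    unfolding p H2_eq unfolding f_def p[symmetric] ..
  have f: "f m = - (qpow x (- (1 / (24 * (6 * real p - 1)))) * eichler_term (- 2 - m))" for m
  proof -
    have "f m = hexagonal_char m * qpow x (- ((of_int m + 1) * (of_int m + 2) / 6)) * qpow x (real p * (of_int m + 2)\<^sup>2)"
      by (simp add: f_def trefoil_coeff_zeta zeta_powi)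
    also have "\<dots> = - (qpow x (- (1 / (24 * (6 * real p - 1)))) * eichler_term (- 2 - m))"
    proof (rule eichler_term_match_minus[where c = 0 and z = 1])
      show "hexagonal_char m = - hexagonal_char (- 2 - m + 2)"
        using hexagonal_char_minus[of m] by simp
    qed (simp_all add: power2_eq_square field_simps)
    finally show ?thesis .
  qed
  have vals: "- f (- 1) = \<zeta> ^ p" "- f (- 2) = 1"
    by (simp_all add: f_def trefoil_coeff_def hexagonal_char_def flip: power_int_of_nat)
  have "H2 p \<zeta> = - f (- 1) - f (- 2) - abel_sum (3 * N) f"
    unfolding H using vals by simp
  then show ?thesis
    using abel_sum_reflect_succ(2)[OF f] assms by simp
qed

text \<open>Since 6p < 6p + 1, the Eichler terms start at index 0, so only
  \<open>\<zeta> ^ p\<close> is absorbed and the value 1 from the empty product at n = 0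
  remains.\<close>

lemma H10_limit:
  assumes "p \<ge> 1"
  shows "\<exists>L. has_cusp_limit (\<lambda>\<tau>. qpow \<tau> (- (1 / (24 * (6 * real p + 1)))) * eichler (2, 3, 6 * int p + 1) (1, 1, int p) \<tau>) (real M / real N) L \<and>
    H10 p \<zeta> = 1 - (1 / 2) * L"
proof -
  obtain p' where p: "p = Suc p'" using assms by (cases p) auto
  interpret chi_23_cusp "6 * int p + 1" "int p" M N x
    by unfold_locales (use assms coprime_6 in auto)
  define f where "f = (\<lambda>m. trefoil_coeff (inverse \<zeta>) m * \<zeta> powi (int p * (m + 2)\<^sup>2))"
  have H: "H10 p \<zeta> = 1 + \<zeta> ^ p - abel_sum (3 * N) f"
    unfolding p H10_eq unfolding f_def p[symmetric] ..
  have f: "f m = - (qpow x (- (1 / (24 * (6 * real p + 1)))) * eichler_term (- 2 - m))" for m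
  proof -
    have "f m = hexagonal_char m * qpow x ((of_int m + 1) * (of_int m + 2) / 6) * qpow x (real p * (of_int m + 2)\<^sup>2)"
      by (simp add: f_def trefoil_coeff_zeta zeta_powi)
    also have "\<dots> = - (qpow x (- (1 / (24 * (6 * real p + 1)))) * eichler_term (- 2 - m))"
    proof (rule eichler_term_match_minus[where c = 0 and z = 1])
      show "hexagonal_char m = - hexagonal_char (- 2 - m + 2)"
        using hexagonal_char_minus[of m] by simp
    qed (simp_all add: power2_eq_square field_simps)
    finally show ?thesis .
  qed
  have vals: "- f (- 1) = \<zeta> ^ p" "- f (- 2) = 1"
    by (simp_all add: f_def trefoil_coeff_def hexagonal_char_def flip: power_int_of_nat)
  obtain L where "limit_at (- (1 / (24 * (6 * real p + 1)))) L" "- f (- 1) - abel_sum (3 * N) f = - (1 / 2) * L"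
    using abel_sum_reflect_succ(1)[OF f] assms by auto
  then show ?thesis
    unfolding H using vals(1) by (intro exI[of _ L] conjI) (assumption, simp add: algebra_simps)
qed

text \<open>Here l = 1, so the case is decided by 6 against 6p - 1. Only p = 1 gives h = 5 < 6, and
  the missing term of index 0 then appears as the inverse of \<open>\<zeta>\<close>.\<close>

lemma H1_limit:
  assumes "p \<ge> 1"
  defines "d \<equiv> - ((6 * real p + 5)\<^sup>2 / (24 * (6 * real p - 1)))"
  shows "p \<ge> 2 \<Longrightarrow> \<exists>L. has_cusp_limit (\<lambda>\<tau>. qpow \<tau> d * eichler (2, 3, 6 * int p - 1) (1, 1, 1) \<tau>) (real M / real N) L \<and>
      H1 p \<zeta> = - (1 / 2) * L"
    and "p = 1 \<Longrightarrow> \<exists>L. has_cusp_limit (\<lambda>\<tau>. qpow \<tau> d * eichler (2, 3, 6 * int p - 1) (1, 1, 1) \<tau>) (real M / real N) L \<and>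
      H1 p \<zeta> = - inverse \<zeta> - (1 / 2) * L"
proof -
  obtain p' where p: "p = Suc p'" using assms by (cases p) auto
  interpret chi_23_cusp "6 * int p - 1" 1 M N x
    by unfold_locales (use assms coprime_6 in auto)
  define f where "f = (\<lambda>m. \<zeta> * (trefoil_coeff \<zeta> m * \<zeta> powi (int p * ((m - 2)\<^sup>2 + (m - 2)))))"
  have H: "H1 p \<zeta> = 1 - abel_sum (3 * N) f"
    unfolding p H1_eq unfolding f_def p[symmetric] abel_sum_cmult ..
  have f: "f m = qpow x d * eichler_term (m - 2)" for m
  proof -
    have "f m = hexagonal_char m * qpow x (- ((of_int m + 1) * (of_int m + 2) / 6)) * qpow x (1 + real p * ((of_int m - 2)\<^sup>2 + (of_int m - 2)))"
      by (simp add: f_def trefoil_coeff_zeta zeta_powi qpow_add)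
    also have "\<dots> = qpow x d * eichler_term (m - 2)"
      unfolding d_def by (rule eichler_term_match[where c = 0 and z = "6 * real p + 5"])
        (simp_all add: power2_eq_square field_simps)
    finally show ?thesis .
  qed
  have vals: "f 1 = 1" "f 2 = inverse \<zeta>"
    using root.q_nonzero by (simp_all add: f_def trefoil_coeff_def hexagonal_char_def power_int_minus field_simps power2_eq_square)
  show "\<exists>L. limit_at d L \<and> H1 p \<zeta> = - (1 / 2) * L" if "p \<ge> 2"
    using abel_sum_shift_minus_2(1)[OF f] that unfolding H vals by simp
  show "\<exists>L. limit_at d L \<and> H1 p \<zeta> = - inverse \<zeta> - (1 / 2) * L" if "p = 1"
    using abel_sum_shift_minus_2(2)[OF f] that unfolding H vals by simp
qed

lemma H8_limit:
  assumes "p \<ge> 1"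
  defines "d \<equiv> 1 - (6 * real p - 5)\<^sup>2 / (24 * (6 * real p + 1))"
  shows "\<exists>L. has_cusp_limit (\<lambda>\<tau>. qpow \<tau> d * eichler (2, 3, 6 * int p + 1) (1, 1, 1) \<tau>) (real M / real N) L \<and>
      H8 p \<zeta> = - (1 / 2) * L"
proof -
  obtain p' where p: "p = Suc p'" using assms by (cases p) auto
  interpret chi_23_cusp "6 * int p + 1" 1 M N x
    by unfold_locales (use assms coprime_6 in auto)
  define f where "f = (\<lambda>m. inverse \<zeta> * (trefoil_coeff (inverse \<zeta>) m * \<zeta> powi (int p * ((m - 2)\<^sup>2 + (m - 2)) - 2 * (m - 2))))"
  have H: "H8 p \<zeta> = \<zeta>\<^sup>2 - abel_sum (3 * N) f"
    unfolding p H8_eq unfolding f_def p[symmetric] abel_sum_cmult ..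
  have f: "f m = qpow x d * eichler_term (m - 2)" for m
  proof -
    have "f m = hexagonal_char m * qpow x ((of_int m + 1) * (of_int m + 2) / 6) *
        qpow x (- 1 + (real p * ((of_int m - 2)\<^sup>2 + (of_int m - 2)) - 2 * (of_int m - 2)))"
      unfolding qpow_add[of x "- 1"] by (simp add: f_def trefoil_coeff_zeta zeta_powi qpow_minus)
    also have "\<dots> = qpow x d * eichler_term (m - 2)"
      unfolding d_def by (rule eichler_term_match[where c = 1 and z = "6 * real p - 5"])
        (simp_all add: power2_eq_square field_simps)
    finally show ?thesis .
  qed
  have vals: "f 1 = \<zeta>\<^sup>2"
    using root.q_nonzero by (simp add: f_def trefoil_coeff_def hexagonal_char_def power_int_minus power_int_inverse)
  show ?thesis
    using abel_sum_shift_minus_2(1)[OF f] assms(1) unfolding H vals by simp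
qed

end

text \<open>Two clauses deviate from the formulas in English: the exponent for H_9 begins with p
  rather than p - 1, and H_10 carries an additional 1. At N = 1 the series H_10 equals 1 and its
  limit is 0, so that constant cannot be dropped.\<close>

theorem theorem1p2:
  fixes M N :: nat and \<zeta> :: complex
  assumes "M > 0" and "N > 0" and "coprime M N"
    and "\<zeta> = exp (2 * of_real pi * \<i> * of_nat M / of_nat N)"
  shows "(\<forall>p\<ge>2. \<exists>L. has_cusp_limit
          (\<lambda>\<tau>. qpow \<tau> (- ((6 * real p + 5)\<^sup>2 / (24 * (6 * real p - 1)))) * eichler (2, 3, 6 * int p - 1) (1, 1, 1) \<tau>)
          (real M / real N) L \<and> H1 p \<zeta> = - (1 / 2) * L) \<and>
         (\<exists>L. has_cusp_limit
          (\<lambda>\<tau>. qpow \<tau> (- (121 / 120)) * eichler (2, 3, 5) (1, 1, 1) \<tau>)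
          (real M / real N) L \<and> H1 1 \<zeta> = - inverse \<zeta> - (1 / 2) * L) \<and>
         (\<forall>p\<ge>1. \<exists>L. has_cusp_limit
          (\<lambda>\<tau>. qpow \<tau> (- (1 / (24 * (6 * real p - 1)))) * eichler (2, 3, 6 * int p - 1) (1, 1, int p) \<tau>)
          (real M / real N) L \<and> H2 p \<zeta> = - (1 / 2) * L) \<and>
         (\<forall>p\<ge>1. \<exists>L. has_cusp_limit
          (\<lambda>\<tau>. qpow \<tau> (- 1 - (6 * real p - 5)\<^sup>2 / (24 * (6 * real p - 1))) * eichler (2, 3, 6 * int p - 1) (1, 1, 2 * int p - 1) \<tau>)
          (real M / real N) L \<and> H3 p \<zeta> = - (1 / 2) * L) \<and>
         (\<forall>p\<ge>1. \<exists>L. has_cusp_limit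
          (\<lambda>\<tau>. qpow \<tau> (- ((6 * real p + 1)\<^sup>2 / (24 * (6 * real p - 1)))) * eichler (2, 3, 6 * int p - 1) (1, 1, 2 * int p) \<tau>)
          (real M / real N) L \<and> H4 p \<zeta> = - (1 / 2) * L) \<and>
         (\<forall>p\<ge>1. \<exists>L. has_cusp_limit
          (\<lambda>\<tau>. qpow \<tau> (real p - 1 - (12 * real p - 5)\<^sup>2 / (24 * (6 * real p - 1))) * eichler (2, 3, 6 * int p - 1) (1, 1, 3 * int p - 1) \<tau>)
          (real M / real N) L \<and> H5 p \<zeta> = - (1 / 2) * L) \<and>
         (\<forall>p\<ge>1. \<exists>L. has_cusp_limit
          (\<lambda>\<tau>. qpow \<tau> (- ((6 * real p - 1)\<^sup>2 / (24 * (6 * real p + 1)))) * eichler (2, 3, 6 * int p + 1) (1, 1, 2 * int p) \<tau>)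
          (real M / real N) L \<and> H6 p \<zeta> = - (1 / 2) * L) \<and>
         (\<forall>p\<ge>1. \<exists>L. has_cusp_limit
          (\<lambda>\<tau>. qpow \<tau> (1 - (6 * real p + 5)\<^sup>2 / (24 * (6 * real p + 1))) * eichler (2, 3, 6 * int p + 1) (1, 1, 2 * int p + 1) \<tau>)
          (real M / real N) L \<and> H7 p \<zeta> = - (1 / 2) * L) \<and>
         (\<forall>p\<ge>1. \<exists>L. has_cusp_limit
          (\<lambda>\<tau>. qpow \<tau> (1 - (6 * real p - 5)\<^sup>2 / (24 * (6 * real p + 1))) * eichler (2, 3, 6 * int p + 1) (1, 1, 1) \<tau>)
          (real M / real N) L \<and> H8 p \<zeta> = - (1 / 2) * L) \<and>
         (\<forall>p\<ge>1. \<exists>L. has_cusp_limit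
          (\<lambda>\<tau>. qpow \<tau> (real p - (12 * real p - 1)\<^sup>2 / (24 * (6 * real p + 1))) * eichler (2, 3, 6 * int p + 1) (1, 1, 3 * int p) \<tau>)
          (real M / real N) L \<and> H9 p \<zeta> = - (1 / 2) * L) \<and>
         (\<forall>p\<ge>1. \<exists>L. has_cusp_limit
          (\<lambda>\<tau>. qpow \<tau> (- (1 / (24 * (6 * real p + 1)))) * eichler (2, 3, 6 * int p + 1) (1, 1, int p) \<tau>)
          (real M / real N) L \<and> H10 p \<zeta> = 1 - (1 / 2) * L)"
proof -
  define x where "x = complex_of_real (real M / real N)"
  interpret rational_cusp M N x
    by unfold_locales (use assms in \<open>simp_all add: x_def\<close>)
  have z: "\<zeta> = qpow x 1"
    using assms(4) by (simp add: qpow_def x_def)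
  have one: "\<exists>L. has_cusp_limit (\<lambda>\<tau>. qpow \<tau> (- (121 / 120)) * eichler (2, 3, 5) (1, 1, 1) \<tau>) (real M / real N) L \<and>
      H1 1 \<zeta> = - inverse \<zeta> - (1 / 2) * L"
    using H1_limit(2)[of 1] unfolding z by simp
  show ?thesis
    using one H1_limit(1) H2_limit H3_limit H4_limit H5_limit H6_limit H7_limit H8_limit H9_limit H10_limit
    unfolding z by (intro conjI allI impI) simp_all
qed

end
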